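(* Let $\mathbf A$ be an enumerated $\mathcal L$-structure with $\mathrm{Age}(\mathbf A)\subseteq\mathcal K$ and fix $m<|\mathbf A|$. Let $f\in\mathrm{AEmb}(\mathrm{ct}^{\mathbf A}|_m,\mathrm{ct})$ and let $$F:=\{g\in\mathrm{AEmb}(\mathrm{ct}^{\mathbf A}|_{m+1},\mathrm{ct}): g|_{T(<m)}=f\}.$$ Let $\chi:F\to 2$ be a coloring. Then there is $h\in\mathrm{AEmb}(\mathrm{ct},\mathrm{ct})$ with $h|_{T(\le\tilde f(m-1))}=\mathrm{id}$ such that $\{h\circ g: g\in F\}$ is monochromatic for $\chi$. (When $m=0$, $f$ is the empty map, $F=\mathrm{AEmb}(\mathrm{ct}^{\mathbf A}|_1,\mathrm{ct})$, and the requirement $h|_{T(\le\tilde f(m-1))}=\mathrm{id}$ is vacuous.)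
   Context: Conventions. $\mathcal L=\{U_0,\dots,U_{k-1};R_0,\dots,R_{k-1}\}$ is a finite relational language, $U_i$ unary, $R_i$ binary, and all $\mathcal L$-structures $\mathbf A$ satisfy: every $R_i^{\mathbf A}$ is irreflexive; $\mathbf A=\bigsqcup_{i<k}U_i^{\mathbf A}$; $\mathbf A^2\setminus\{(a,a):a\in\mathbf A\}=\bigsqcup_{i<k}R_i^{\mathbf A}$; and there is $\mathrm{Flip}:k\to k$ with $\mathrm{Flip}^2=\mathrm{id}$, $\mathrm{Flip}(0)=0$, such that $R^{\mathbf A}(a,b)=i$ iff $R^{\mathbf A}(b,a)=\mathrm{Flip}(i)$. Here $U^{\mathbf A}(a)=i$ means $U_i^{\mathbf A}(a)$ and $R^{\mathbf A}(a,b)=i$ means $R_i^{\mathbf A}(a,b)$; $R_0$ plays the role of "no relation". $\mathcal K$ is a Fraïssé class of finite $\mathcal L$-structures with free amalgamation: any embeddings $f:\mathbf A\to\mathbf B$, $g:\mathbf A\to\mathbf C$ in $\mathcal K$ can be amalgamated by embeddings $r:\mathbf B\to\mathbf D$, $s:\mathbf C\to\mathbf D$ with $\mathbf D\in\mathcal K$, $r\circ f=s\circ g$, $\mathbf D=\mathrm{im}(r)\cup\mathrm{im}(s)$, $\mathrm{im}(r)\cap\mathrm{im}(s)=\mathrm{im}(r\circ f)$, and $R^{\mathbf D}(a,b)=0$ unless $\{a,b\}\subseteq\mathrm{im}(r)$ or $\{a,b\}\subseteq\mathrm{im}(s)$. An enumerated structure is one whose underlying set is the cardinal $|\mathbf A|\le\omega$;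 for $m\le|\mathbf A|$, $\mathbf A_m$ is the induced substructure on $m=\{0,\dots,m-1\}$. $\mathbf K$ is a Fraïssé limit of $\mathcal K$ with underlying set $\omega$ which is left dense: for every $m<\omega$ and every $\mathbf A\in\mathcal K$ with underlying set $m+1$ and $\mathbf A_m=\mathbf K_m$ there is $n\ge m$ such that the map $i\mapsto i$ ($i<m$), $m\mapsto n$ is an embedding $\mathbf A\to\mathbf K$ and $R^{\mathbf K}(r,n)=0$ for all $m\le r<n$. Write $U=U^{\mathbf K}$, $R=R^{\mathbf K}$. $\mathrm{Age}(\mathbf A)$ is the class of finite structures embeddable in $\mathbf A$. Trees. $T=k^{<\omega}$, $T(n)=k^n$, with $T(<n),T(\le n)$ as usual; $s\sqsubseteq t$ means $t$ extends $s$; $s\wedge t$ is the longest common initial segment; $s^\frown i$ appends $i<k$. Coding trees. For enumerated $\mathbf A$, $\mathrm{ct}^{\mathbf A}=(c^{\mathbf A},u^{\mathbf A})$ where $c^{\mathbf A}(j)\in T(j)$ is given by $c^{\mathbf A}(j)(i)=R^{\mathbf A}(i,j)$ for $i<j<|\mathbf A|$, and $u^{\mathbf A}(j)=U^{\mathbf A}(j)$; $\mathrm{ct}^{\mathbf A}|_m$ is the restriction to domain $m$. Write $\mathrm{ct}=(c,u)=\mathrm{ct}^{\mathbf K}$. Labeled structures. For a finite set $X$, an $X$-labeled structure is a finite $\mathcal L$-structure $\mathbf B$ with a map $\phi:\mathbf B\to X$. For enumerated $\mathbf A$, $m\le|\mathbf A|$, $m<\omega$, and a $T(m)$-labeled $(\mathbf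 B,\phi)$ with $\mathbf B\cap\omega=\emptyset$, $\mathbf B[\phi,\mathbf A]$ is the $\mathcal L$-structure on $\mathbf B\cup\mathbf A_m$ with $\mathbf B$ and $\mathbf A_m$ as induced substructures and $R(i,b)=\phi(b)(i)$ for $i<m$, $b\in\mathbf B$. If $\mathrm{Age}(\mathbf A)\subseteq\mathcal K$, $\mathcal C^{\mathbf A}(m)$ is the class of $T(m)$-labeled $(\mathbf B,\phi)$ with $\mathbf B[\phi,\mathbf A]\in\mathcal K$; $\mathcal C(m)=\mathcal C^{\mathbf K}(m)$. Given finite sets $X,Y$ with classes $\mathcal C_X,\mathcal C_Y$ of $X$- resp. $Y$-labeled structures, an age map is an injection $f:X\to Y$ such that for every $X$-labeled $(\mathbf B,\phi)$: $(\mathbf B,\phi)\in\mathcal C_X$ iff $(\mathbf B,f\circ\phi)\in\mathcal C_Y$. Embeddings. Let $\mathbf A$ be enumerated with $\mathrm{Age}(\mathbf A)\subseteq\mathcal K$ and $m\le|\mathbf A|$. A map $f:T(<m)\to T$ is an embedding of $\mathrm{ct}^{\mathbf A}|_m$ into $\mathrm{ct}$ if (1) $f$ is injective; (2) there is an increasing $\tilde f:m\to\omega$ with $f[T(j)]\subseteq T(\tilde f(j))$ for $j<m$; (3) $f(s\wedge t)=f(s)\wedge f(t)$; (4) $f(s^\frown i)\sqsupseteq f(s)^\frown i$ whenever $s^\frown i\in T(<m)$; (5) $f(c^{\mathbf A}(j))=c(\tilde f(j))$ and $u^{\mathbf A}(j)=u(\tilde f(j))$ for $j<m$. It is an aged embedding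 if moreover for each $j<m$, $f|_{T(j)}:(T(j),\mathcal C^{\mathbf A}(j))\to(T(\tilde f(j)),\mathcal C(\tilde f(j)))$ is an age map. $\mathrm{AEmb}(\mathrm{ct}^{\mathbf A}|_m,\mathrm{ct})$ is the set of these; $\mathrm{AEmb}(\mathrm{ct},\mathrm{ct})$ is the case $\mathbf A=\mathbf K$, $m=\omega$ (maps $T\to T$). *)

theory Defs
  imports
    "HOL-Library.FuncSet"
    "HOL-Library.Disjoint_Sets"
    "HOL-Library.Extended_Nat"
    "HOL-Library.Sublist"
begin

section \<open>Structures\<close>

record 'a lstruct =
  univ :: "'a set"
  unary :: "nat \<Rightarrow> 'a set"
  binary :: "nat \<Rightarrow> ('a \<times> 'a) set"

definition is_flip :: "nat \<Rightarrow> (nat \<Rightarrow> nat) \<Rightarrow> bool" where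
  "is_flip k Flip \<longleftrightarrow> 0 < k \<and> Flip ` {..<k} \<subseteq> {..<k} \<and> (\<forall>i<k. Flip (Flip i) = i) \<and> Flip 0 = 0"

text \<open>
  Symbols with index at least \<open>k\<close> are not in the language; their interpretation is fixed to be
  empty, so that equality of records is equality of structures.
\<close>

definition lstructure :: "nat \<Rightarrow> (nat \<Rightarrow> nat) \<Rightarrow> 'a lstruct \<Rightarrow> bool" where
  "lstructure k Flip A \<longleftrightarrow>
     (\<forall>i<k. \<forall>a. (a, a) \<notin> binary A i) \<and>
     univ A = (\<Union>i<k. unary A i) \<and> disjoint_family_on (unary A) {..<k} \<and>
     {(a, b). a \<in> univ A \<and> b \<in> univ A \<and> a \<noteq> b} = (\<Union>i<k. binary A i) \<and>
     disjoint_family_on (binary A) {..<k} \<and>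
     (\<forall>i<k. \<forall>a b. (a, b) \<in> binary A i \<longleftrightarrow> (b, a) \<in> binary A (Flip i)) \<and>
     (\<forall>i\<ge>k. unary A i = {} \<and> binary A i = {})"

definition ulab :: "'a lstruct \<Rightarrow> 'a \<Rightarrow> nat" where
  "ulab A a = (THE i. a \<in> unary A i)"

definition rlab :: "'a lstruct \<Rightarrow> 'a \<Rightarrow> 'a \<Rightarrow> nat" where
  "rlab A a b = (THE i. (a, b) \<in> binary A i)"

definition induced :: "'a lstruct \<Rightarrow> 'a set \<Rightarrow> 'a lstruct" where
  "induced A X = \<lparr>univ = univ A \<inter> X,
                  unary = (\<lambda>i. unary A i \<inter> X),
                  binary = (\<lambda>i. binary A i \<inter> X \<times> X)\<rparr>"

definition embedding :: "('a \<Rightarrow> 'b) \<Rightarrow> 'a lstruct \<Rightarrow> 'b lstruct \<Rightarrow> bool" where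
  "embedding f A B \<longleftrightarrow>
     f \<in> univ A \<rightarrow> univ B \<and> inj_on f (univ A) \<and>
     (\<forall>i. \<forall>a\<in>univ A. a \<in> unary A i \<longleftrightarrow> f a \<in> unary B i) \<and>
     (\<forall>i. \<forall>a\<in>univ A. \<forall>b\<in>univ A. (a, b) \<in> binary A i \<longleftrightarrow> (f a, f b) \<in> binary B i)"

definition isomorphism :: "('a \<Rightarrow> 'b) \<Rightarrow> 'a lstruct \<Rightarrow> 'b lstruct \<Rightarrow> bool" where
  "isomorphism f A B \<longleftrightarrow> embedding f A B \<and> f ` univ A = univ B"


section \<open>Classes of finite structures\<close>

text \<open>
  An isomorphism-closed class of finite structures is represented by its members whose underlying
  set is a set of natural numbers. Membership of a finite structure over another type is membership
  of an isomorphic copy.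
\<close>

definition in_class :: "nat lstruct set \<Rightarrow> 'a lstruct \<Rightarrow> bool" where
  "in_class \<K> B \<longleftrightarrow> (\<exists>C\<in>\<K>. \<exists>g. isomorphism g C B)"

definition age :: "nat \<Rightarrow> (nat \<Rightarrow> nat) \<Rightarrow> 'a lstruct \<Rightarrow> nat lstruct set" where
  "age k Flip A = {B. lstructure k Flip B \<and> finite (univ B) \<and> (\<exists>f. embedding f B A)}"

text \<open>
  There are only countably many finite structures on sets of natural numbers, so countability of
  the class up to isomorphism need not be demanded.
\<close>

definition fraisse_class :: "nat \<Rightarrow> (nat \<Rightarrow> nat) \<Rightarrow> nat lstruct set \<Rightarrow> bool" where
  "fraisse_class k Flip \<K> \<longleftrightarrow>
     \<K> \<noteq> {} \<and>
     (\<forall>A\<in>\<K>. lstructure k Flip A \<and> finite (univ A)) \<and>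
     \<comment> \<open>closed under isomorphism\<close>
     (\<forall>A\<in>\<K>. \<forall>B. lstructure k Flip B \<and> (\<exists>f. isomorphism f A B) \<longrightarrow> B \<in> \<K>) \<and>
     \<comment> \<open>hereditary\<close>
     (\<forall>A\<in>\<K>. \<forall>X\<subseteq>univ A. induced A X \<in> \<K>) \<and>
     \<comment> \<open>joint embedding\<close>
     (\<forall>B\<in>\<K>. \<forall>C\<in>\<K>. \<exists>D\<in>\<K>. (\<exists>r. embedding r B D) \<and> (\<exists>s. embedding s C D)) \<and>
     \<comment> \<open>amalgamation\<close>
     (\<forall>A\<in>\<K>. \<forall>B\<in>\<K>. \<forall>C\<in>\<K>. \<forall>f g. embedding f A B \<and> embedding g A C \<longrightarrow>
        (\<exists>D\<in>\<K>. \<exists>r s. embedding r B D \<and> embedding s C D \<and> (\<forall>a\<in>univ A. r (f a) = s (g a))))"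

definition free_amalgamation :: "nat lstruct set \<Rightarrow> bool" where
  "free_amalgamation \<K> \<longleftrightarrow>
     (\<forall>A\<in>\<K>. \<forall>B\<in>\<K>. \<forall>C\<in>\<K>. \<forall>f g. embedding f A B \<and> embedding g A C \<longrightarrow>
        (\<exists>D\<in>\<K>. \<exists>r s. embedding r B D \<and> embedding s C D \<and>
           (\<forall>a\<in>univ A. r (f a) = s (g a)) \<and>
           univ D = r ` univ B \<union> s ` univ C \<and>
           r ` univ B \<inter> s ` univ C = r ` f ` univ A \<and>
           (\<forall>a\<in>univ D. \<forall>b\<in>univ D.
              \<not> {a, b} \<subseteq> r ` univ B \<and> \<not> {a, b} \<subseteq> s ` univ C \<longrightarrow> rlab D a b = 0)))"

definition ultrahomogeneous :: "'a lstruct \<Rightarrow> bool" where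
  "ultrahomogeneous K \<longleftrightarrow>
     (\<forall>X\<subseteq>univ K. \<forall>Y\<subseteq>univ K. \<forall>g. finite X \<and> isomorphism g (induced K X) (induced K Y) \<longrightarrow>
        (\<exists>h. isomorphism h K K \<and> (\<forall>x\<in>X. h x = g x)))"

text \<open>A Fraisse limit, taken with underlying set all of \<open>\<omega>\<close>.\<close>

definition fraisse_limit ::
    "nat \<Rightarrow> (nat \<Rightarrow> nat) \<Rightarrow> nat lstruct set \<Rightarrow> nat lstruct \<Rightarrow> bool" where
  "fraisse_limit k Flip \<K> K \<longleftrightarrow>
     lstructure k Flip K \<and> univ K = UNIV \<and> age k Flip K = \<K> \<and> ultrahomogeneous K"

text \<open>\<open>initial A m\<close> is the substructure of \<open>A\<close> induced on the first \<open>m\<close> natural numbers.\<close>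

abbreviation initial :: "nat lstruct \<Rightarrow> nat \<Rightarrow> nat lstruct" where
  "initial A m \<equiv> induced A {..<m}"

definition left_dense :: "nat lstruct set \<Rightarrow> nat lstruct \<Rightarrow> bool" where
  "left_dense \<K> K \<longleftrightarrow>
     (\<forall>m. \<forall>A\<in>\<K>. univ A = {..<Suc m} \<and> initial A m = initial K m \<longrightarrow>
        (\<exists>n\<ge>m. embedding (\<lambda>i. if i < m then i else n) A K \<and> (\<forall>r\<in>{m..<n}. rlab K r n = 0)))"

definition ecard :: "'a set \<Rightarrow> enat" where
  "ecard X = (if finite X then enat (card X) else \<infinity>)"

definition enumerated :: "nat \<Rightarrow> (nat \<Rightarrow> nat) \<Rightarrow> nat lstruct \<Rightarrow> bool" where
  "enumerated k Flip A \<longleftrightarrow> lstructure k Flip A \<and> univ A = {i. enat i < ecard (univ A)}"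


section \<open>Coding trees\<close>

text \<open>Nodes of the tree of finite sequences over \<open>k\<close> are lists; the empty list is the root.\<close>

definition tree :: "nat \<Rightarrow> nat list set" where
  "tree k = {s. set s \<subseteq> {..<k}}"

definition level :: "nat \<Rightarrow> nat \<Rightarrow> nat list set" where
  "level k n = {s \<in> tree k. length s = n}"

definition tree_le :: "nat \<Rightarrow> nat \<Rightarrow> nat list set" where
  "tree_le k n = {s \<in> tree k. length s \<le> n}"

definition tree_lt :: "nat \<Rightarrow> enat \<Rightarrow> nat list set" where
  "tree_lt k m = {s \<in> tree k. enat (length s) < m}"

definition code :: "nat lstruct \<Rightarrow> nat \<Rightarrow> nat list" where
  "code A j = map (\<lambda>i. rlab A i j) [0..<j]"


section \<open>Labeled structures and age maps\<close>

text \<open>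
  The underlying set of \<open>B\<close> is made disjoint from the natural numbers by placing the points
  of \<open>A\<close> in the left and those of \<open>B\<close> in the right summand of the sum type.
\<close>

definition attach ::
    "(nat \<Rightarrow> nat) \<Rightarrow> nat \<Rightarrow> 'b lstruct \<Rightarrow> ('b \<Rightarrow> nat list) \<Rightarrow> nat lstruct \<Rightarrow> (nat + 'b) lstruct" where
  "attach Flip m B \<phi> A =
     \<lparr>univ = Inl ` univ (initial A m) \<union> Inr ` univ B,
      unary = (\<lambda>i. Inl ` unary (initial A m) i \<union> Inr ` unary B i),
      binary = (\<lambda>i.
         {(Inl a, Inl b) | a b. (a, b) \<in> binary (initial A m) i} \<union>
         {(Inr a, Inr b) | a b. (a, b) \<in> binary B i} \<union>
         {(Inl a, Inr b) | a b. a < m \<and> b \<in> univ B \<and> \<phi> b ! a = i} \<union>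
         {(Inr b, Inl a) | a b. a < m \<and> b \<in> univ B \<and> Flip (\<phi> b ! a) = i})\<rparr>"

definition labeled ::
    "nat \<Rightarrow> (nat \<Rightarrow> nat) \<Rightarrow> 'x set \<Rightarrow> (nat lstruct \<times> (nat \<Rightarrow> 'x)) set" where
  "labeled k Flip X =
     {(B, \<phi>). lstructure k Flip B \<and> finite (univ B) \<and> \<phi> \<in> univ B \<rightarrow>\<^sub>E X}"

definition labeled_class ::
    "nat \<Rightarrow> (nat \<Rightarrow> nat) \<Rightarrow> nat lstruct set \<Rightarrow> nat lstruct \<Rightarrow> nat \<Rightarrow>
     (nat lstruct \<times> (nat \<Rightarrow> nat list)) set" where
  "labeled_class k Flip \<K> A m =
     {(B, \<phi>) \<in> labeled k Flip (level k m). in_class \<K> (attach Flip m B \<phi> A)}"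

definition age_map ::
    "nat \<Rightarrow> (nat \<Rightarrow> nat) \<Rightarrow> ('x \<Rightarrow> 'y) \<Rightarrow>
     'x set \<Rightarrow> (nat lstruct \<times> (nat \<Rightarrow> 'x)) set \<Rightarrow>
     'y set \<Rightarrow> (nat lstruct \<times> (nat \<Rightarrow> 'y)) set \<Rightarrow> bool" where
  "age_map k Flip f X CX Y CY \<longleftrightarrow>
     f \<in> X \<rightarrow> Y \<and> inj_on f X \<and>
     (\<forall>(B, \<phi>) \<in> labeled k Flip X. (B, \<phi>) \<in> CX \<longleftrightarrow> (B, compose (univ B) f \<phi>) \<in> CY)"


section \<open>Embeddings of coding trees\<close>

text \<open>
  \<open>level_fun k f\<close> is the function written f-tilde: since levels are nonempty for positive \<open>k\<close>,
  the level containing the image of a level is unique if it exists.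
\<close>

definition level_fun :: "nat \<Rightarrow> (nat list \<Rightarrow> nat list) \<Rightarrow> nat \<Rightarrow> nat" where
  "level_fun k f j = (THE n. f ` level k j \<subseteq> level k n)"

text \<open>
  Maps defined on \<open>tree_lt k m\<close> are extensional functions. The bound \<open>m\<close> may be \<open>\<infinity>\<close>, which gives
  maps on the whole tree.
\<close>

definition Emb ::
    "nat \<Rightarrow> nat lstruct \<Rightarrow> nat lstruct \<Rightarrow> enat \<Rightarrow> (nat list \<Rightarrow> nat list) set" where
  "Emb k K A m =
     {f \<in> tree_lt k m \<rightarrow>\<^sub>E tree k.
        inj_on f (tree_lt k m) \<and>
        strict_mono_on {j. enat j < m} (level_fun k f) \<and>
        (\<forall>j. enat j < m \<longrightarrow> f ` level k j \<subseteq> level k (level_fun k f j)) \<and>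
        (\<forall>s\<in>tree_lt k m. \<forall>t\<in>tree_lt k m.
           f (longest_common_prefix s t) = longest_common_prefix (f s) (f t)) \<and>
        (\<forall>s i. s @ [i] \<in> tree_lt k m \<longrightarrow> prefix (f s @ [i]) (f (s @ [i]))) \<and>
        (\<forall>j. enat j < m \<longrightarrow>
           f (code A j) = code K (level_fun k f j) \<and> ulab A j = ulab K (level_fun k f j))}"

definition AEmb ::
    "nat \<Rightarrow> (nat \<Rightarrow> nat) \<Rightarrow> nat lstruct set \<Rightarrow> nat lstruct \<Rightarrow> nat lstruct \<Rightarrow> enat \<Rightarrow>
     (nat list \<Rightarrow> nat list) set" where
  "AEmb k Flip \<K> K A m =
     {f \<in> Emb k K A m. \<forall>j. enat j < m \<longrightarrow>
        age_map k Flip f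
          (level k j) (labeled_class k Flip \<K> A j)
          (level k (level_fun k f j)) (labeled_class k Flip \<K> K (level_fun k f j))}"

definition monochromatic :: "'c set \<Rightarrow> ('c \<Rightarrow> nat) \<Rightarrow> 'c set \<Rightarrow> bool" where
  "monochromatic F \<chi> S \<longleftrightarrow> S \<subseteq> F \<and> (\<exists>c. \<forall>g\<in>S. \<chi> g = c)"

end

theory Submission
  imports Defs "HOL-Library.Countable_Set"
begin

text \<open>
  Put \<open>N = level_fun k f (m - 1) + 1\<close>. On \<open>T(m)\<close> an extension of \<open>f\<close> is an age map \<open>v\<close> from level \<open>N\<close> to
  some level \<open>n\<close> which extends nodes and sends one fixed node \<open>x0\<close> to the coding node of level \<open>n\<close>. So
  \<open>\<chi>\<close> colors such maps, which is a Halpern-Laeuchli situation for the trees above the nodes of \<open>T(N)\<close>,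
  restricted to age maps. By free amalgamation a partial age map can be continued by zeroes on the
  remaining nodes, and by left density the continuation of a node by zeroes meets coding nodes. With
  these two facts, induction on the number of trees already thinned out to a single branch gives a
  color \<open>b\<close> and an age map \<open>w\<close> such that above \<open>w\<close> every level can be age-mapped to a higher one where
  all values are \<open>b\<close>. The map \<open>h\<close> is the identity below \<open>N\<close>, agrees with \<open>w\<close> at first, and is then
  built level by level, passing at each coding node to a level where the color is \<open>b\<close>.
\<close>

section \<open>Extension systems\<close>

text \<open>Being an age map is a condition on all nodes jointly, so one tree cannot be shrunk to a
  subtree independently of the others. The subtrees of the usual Halpern-Laeuchli argument are
  therefore replaced by maps \<open>e\<close> between whole levels, and instead of restricting the
  maps that get colored, the coloring itself is composed with an \<open>e\<close> at each level
  (\<open>pullback\<close>). A map that settles one node may spoil what was achieved for another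
  one; continuing the settled nodes by zeroes protects them, and this is where free amalgamation
  enters. Reducing a tree to one branch must not lose the failure of density. Levels are finite, so
  only countably many failures have to be remembered, and a single branch can pass a witness for
  each of them; the coloring that goes with the branch is the diagonal of the colorings met on the
  way. The dichotomy is not symmetric: one color wins above the root, the other perhaps only above
  some \<open>w\<close>, which is why \<open>h\<close> may have to begin with a nontrivial
  \<open>w\<close>.\<close>

lemma level_length: "s \<in> level k n \<Longrightarrow> length s = n"
  by (simp add: level_def)

lemma finite_level: "finite (level k n)"
proof -
  have "level k n = {s. set s \<subseteq> {..<k} \<and> length s = n}"
    by (auto simp: level_def tree_def)
  then show ?thesis by (simp add: finite_lists_length_eq)
qed

lemma take_level: "s \<in> level k n \<Longrightarrow> m \<le> n \<Longrightarrow> take m s \<in> level k m"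
  by (auto simp: level_def tree_def dest: in_set_takeD)

definition zpad :: "nat \<Rightarrow> nat list \<Rightarrow> nat list" where
  "zpad m s = s @ replicate (m - length s) 0"

lemma take_zpad: "length s = n \<Longrightarrow> take n (zpad m s) = s"
  by (simp add: zpad_def)

lemma zpad_zpad: "length s \<le> m \<Longrightarrow> m \<le> p \<Longrightarrow> zpad p (zpad m s) = zpad p s"
  by (simp add: zpad_def replicate_add [symmetric])

text \<open>
  In the application \<open>E X n m f\<close> means that \<open>f\<close> is an age map from \<open>X \<subseteq> T(n)\<close> to \<open>T(m)\<close> which extends
  nodes. Axiom \<open>E_zero\<close> is the only one that depends on free amalgamation.
\<close>

locale ext_system =
  fixes k :: nat
    and E :: "nat list set \<Rightarrow> nat \<Rightarrow> nat \<Rightarrow> (nat list \<Rightarrow> nat list) \<Rightarrow> bool"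
  assumes pos: "0 < k"
    and E_dom: "E X n m f \<Longrightarrow> X \<subseteq> level k n \<and> n \<le> m"
    and E_maps: "E X n m f \<Longrightarrow> x \<in> X \<Longrightarrow> f x \<in> level k m \<and> take n (f x) = x"
    and E_empty: "n \<le> m \<Longrightarrow> E {} n m f"
    and E_id: "X \<subseteq> level k n \<Longrightarrow> E X n n (\<lambda>x. x)"
    and E_comp: "E X n m f \<Longrightarrow> E (f ` X) m p g \<Longrightarrow> E X n p (\<lambda>x. g (f x))"
    and E_mono: "E X n m f \<Longrightarrow> Y \<subseteq> X \<Longrightarrow> E Y n m f"
    and E_cong: "E X n m f \<Longrightarrow> (\<And>x. x \<in> X \<Longrightarrow> f x = g x) \<Longrightarrow> E X n m g"
    and E_trunc: "E X n m f \<Longrightarrow> n \<le> a \<Longrightarrow> a \<le> b \<Longrightarrow> b \<le> m \<Longrightarrow>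
        (\<And>x. x \<in> X \<Longrightarrow> h (take a (f x)) = take b (f x)) \<Longrightarrow>
        E ((\<lambda>x. take a (f x)) ` X) a b h"
    and E_zero: "E X n m f \<Longrightarrow> E (level k n) n m (\<lambda>x. if x \<in> X then f x else zpad m x)"
begin

section \<open>Branches, colored maps and density\<close>

abbreviation L where "L \<equiv> level k"

lemma zpad_level: "s \<in> L n \<Longrightarrow> n \<le> m \<Longrightarrow> zpad m s \<in> L m"
  using pos by (auto simp: level_def tree_def zpad_def)

lemma E_comp_total:
  assumes "E X n m f" and "E (L m) m p g"
  shows "E X n p (\<lambda>x. g (f x))"
proof (rule E_comp[OF assms(1)])
  show "E (f ` X) m p g"
    by (rule E_mono[OF assms(2)]) (use E_maps[OF assms(1)] in blast)
qed

text \<open>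
  The trees above the nodes in \<open>P\<close> have been thinned out: above \<open>x \<in> P\<close> only the branch with nodes
  \<open>d x n\<close> is left.
\<close>

definition good :: "nat \<Rightarrow> nat list set \<Rightarrow> (nat list \<Rightarrow> nat \<Rightarrow> nat list) \<Rightarrow> bool" where
  "good N P d \<longleftrightarrow> P \<subseteq> L N \<and> (\<forall>m\<ge>N. E P N m (\<lambda>x. d x m)) \<and>
     (\<forall>x\<in>P. \<forall>a b. N \<le> a \<longrightarrow> a \<le> b \<longrightarrow> take a (d x b) = d x a)"

text \<open>\<open>Wd\<close> holds the maps that get colored and \<open>Ed\<close> the maps applied
  after them. Both respect the branches that are left above \<open>P\<close>, so that
  \<open>Wd\<close> is closed under composition with \<open>Ed\<close>.\<close>

definition Wd :: "nat \<Rightarrow> nat list set \<Rightarrow> (nat list \<Rightarrow> nat \<Rightarrow> nat list) \<Rightarrow> nat \<Rightarrow> (nat list \<Rightarrow> nat list) set"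
  where "Wd N P d q = {w. E (L N) N q w \<and> (\<forall>x\<in>P. w x = d x q)}"

definition Ed :: "nat list set \<Rightarrow> (nat list \<Rightarrow> nat \<Rightarrow> nat list) \<Rightarrow> nat \<Rightarrow> nat \<Rightarrow> (nat list \<Rightarrow> nat list) set"
  where "Ed P d n m = {e. E (L n) n m e \<and> (\<forall>x\<in>P. e (d x n) = d x m)}"

text \<open>The order of the quantifiers matters: one \<open>e\<close> serves all \<open>u\<close>
  above \<open>w\<close> at level \<open>n\<close> simultaneously, so it can be chosen before it is
  known with which extension it will be composed.\<close>

definition dense ::
    "nat \<Rightarrow> nat list set \<Rightarrow> (nat list \<Rightarrow> nat \<Rightarrow> nat list) \<Rightarrow> (nat \<Rightarrow> (nat list \<Rightarrow> nat list) \<Rightarrow> bool) \<Rightarrow>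
     nat \<Rightarrow> (nat list \<Rightarrow> nat list) \<Rightarrow> bool" where
  "dense N P d D q w \<longleftrightarrow> (\<forall>n\<ge>q. \<exists>m\<ge>n. \<exists>e\<in>Ed P d n m. \<forall>u\<in>Wd N P d n.
     (\<forall>x\<in>L N. take q (u x) = w x) \<longrightarrow> D m (\<lambda>x. e (u x)))"

text \<open>The substitute for passing to a subtree: \<open>D'\<close> sees at level
  \<open>m'\<close> what \<open>D\<close> sees after some \<open>e\<close>, which may differ from
  level to level. Equality for all \<open>u\<close>, also for those outside \<open>Wd\<close>, makes
  the notion stable under negation.\<close>

definition pullback ::
    "nat \<Rightarrow> nat list set \<Rightarrow> (nat list \<Rightarrow> nat \<Rightarrow> nat list) \<Rightarrow> (nat \<Rightarrow> (nat list \<Rightarrow> nat list) \<Rightarrow> bool) \<Rightarrow>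
     (nat \<Rightarrow> (nat list \<Rightarrow> nat list) \<Rightarrow> bool) \<Rightarrow> bool" where
  "pullback N P d D' D \<longleftrightarrow> (\<forall>m'\<ge>N. \<exists>m\<ge>m'. \<exists>e\<in>Ed P d m' m. \<forall>u. D' m' u = D m (\<lambda>x. e (u x)))"

definition local_col :: "nat \<Rightarrow> (nat \<Rightarrow> (nat list \<Rightarrow> nat list) \<Rightarrow> bool) \<Rightarrow> bool" where
  "local_col N D \<longleftrightarrow> (\<forall>m\<ge>N. \<forall>u v. (\<forall>x\<in>L N. u x = v x) \<longrightarrow> D m u = D m v)"

lemma Ed_id: "(\<lambda>x. x) \<in> Ed P d n n"
  by (simp add: Ed_def E_id)

lemma Ed_comp: "e \<in> Ed P d n m \<Longrightarrow> e' \<in> Ed P d m p \<Longrightarrow> (\<lambda>x. e' (e x)) \<in> Ed P d n p"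
  by (auto simp: Ed_def intro: E_comp_total)

lemma Wd_Ed: "u \<in> Wd N P d n \<Longrightarrow> e \<in> Ed P d n m \<Longrightarrow> (\<lambda>x. e (u x)) \<in> Wd N P d m"
  by (auto simp: Ed_def Wd_def intro: E_comp_total)

lemma Ed_maps: "e \<in> Ed P d n m \<Longrightarrow> z \<in> L n \<Longrightarrow> e z \<in> L m \<and> take n (e z) = z"
  using E_maps by (auto simp: Ed_def)

lemma Wd_maps: "u \<in> Wd N P d n \<Longrightarrow> z \<in> L N \<Longrightarrow> u z \<in> L n \<and> take N (u z) = z"
  using E_maps by (auto simp: Wd_def)

lemma Wd_Ed_take:
  assumes "u \<in> Wd N P d n" and "e \<in> Ed P d n m" and "x \<in> L N" and "q \<le> n"
  shows "take q (e (u x)) = take q (u x)"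
proof -
  have "take n (e (u x)) = u x"
    using assms Wd_maps Ed_maps by blast
  then have "take q (take n (e (u x))) = take q (u x)" by simp
  then show ?thesis using \<open>q \<le> n\<close> by (simp add: min_absorb1)
qed

lemma good_branch:
  assumes "good N P d" and "x \<in> P" and "N \<le> m"
  shows "d x m \<in> L m" and "take N (d x m) = x"
  using assms E_maps unfolding good_def by blast+

text \<open>By coherence \<open>d x n\<close> is a truncation of \<open>d x m\<close>, so this is
  \<open>E_trunc\<close> for the map that sends \<open>x\<close> in \<open>P\<close> to
  \<open>d x m\<close>.\<close>

lemma good_trunc:
  assumes "good N P d" and "N \<le> n" and "n \<le> m" and "\<And>x. x \<in> P \<Longrightarrow> e (d x n) = d x m"
  shows "E ((\<lambda>x. d x n) ` P) n m e"
proof -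
  have co: "\<And>x a. x \<in> P \<Longrightarrow> N \<le> a \<Longrightarrow> a \<le> m \<Longrightarrow> take a (d x m) = d x a"
    using assms(1) by (auto simp: good_def)
  have *: "E P N m (\<lambda>x. d x m)" using assms by (auto simp: good_def)
  have "E ((\<lambda>x. take n (d x m)) ` P) n m e"
    by (rule E_trunc[OF *]) (use assms co in auto)
  moreover have "(\<lambda>x. take n (d x m)) ` P = (\<lambda>x. d x n) ` P"
    using co assms by auto
  ultimately show ?thesis by simp
qed

lemma Ed_nonempty:
  assumes g: "good N P d" and nm: "N \<le> n" "n \<le> m"
  shows "\<exists>e\<in>Ed P d n m. \<forall>z\<in>L n. z \<notin> (\<lambda>x. d x n) ` P \<longrightarrow> e z = zpad m z"
proof -
  \<comment> \<open>Cutting a branch node at \<open>N\<close> recovers the element of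
    \<open>P\<close> it belongs to.\<close>
  define e0 where "e0 = (\<lambda>z. d (take N z) m)"
  have "e0 (d x n) = d x m" if "x \<in> P" for x
    using good_branch[OF g that nm(1)] by (simp add: e0_def)
  from E_zero[OF good_trunc[OF g nm this]]
  have E0: "E (L n) n m (\<lambda>x. if x \<in> (\<lambda>x. d x n) ` P then e0 x else zpad m x)" .
  show ?thesis
    using E0 \<open>\<And>x. x \<in> P \<Longrightarrow> e0 (d x n) = d x m\<close>
    by (intro bexI[of _ "\<lambda>x. if x \<in> (\<lambda>x. d x n) ` P then e0 x else zpad m x"]) (auto simp: Ed_def)
qed

lemma pullback_refl: "pullback N P d D D"
  unfolding pullback_def
proof (intro allI impI)
  fix m' :: nat
  show "\<exists>m\<ge>m'. \<exists>e\<in>Ed P d m' m. \<forall>u. D m' u = D m (\<lambda>x. e (u x))"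
    by (rule exI[of _ m'], intro conjI bexI[of _ "\<lambda>x. x"]) (auto simp: Ed_id)
qed

lemma pullback_trans:
  assumes "pullback N P d D'' D'" and "pullback N P d D' D"
  shows "pullback N P d D'' D"
  unfolding pullback_def
proof (intro allI impI)
  fix m'' assume "N \<le> m''"
  then obtain m' e' where 1: "m'' \<le> m'" "e' \<in> Ed P d m'' m'"
    "\<forall>u. D'' m'' u = D' m' (\<lambda>x. e' (u x))"
    using assms(1) by (auto simp: pullback_def)
  then have "N \<le> m'" using \<open>N \<le> m''\<close> by simp
  then obtain m e where 2: "m' \<le> m" "e \<in> Ed P d m' m" "\<forall>u. D' m' u = D m (\<lambda>x. e (u x))"
    using assms(2) by (auto simp: pullback_def)
  show "\<exists>m\<ge>m''. \<exists>e\<in>Ed P d m'' m. \<forall>u. D'' m'' u = D m (\<lambda>x. e (u x))"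
    by (rule exI[of _ m], intro conjI bexI[of _ "\<lambda>x. e (e' x)"])
      (use 1 2 Ed_comp in auto)
qed

lemma pullback_local:
  assumes "pullback N P d D' D" and "local_col N D"
  shows "local_col N D'"
  unfolding local_col_def
proof (intro allI impI)
  fix m' and u v :: "nat list \<Rightarrow> nat list"
  assume "N \<le> m'" and uv: "\<forall>x\<in>L N. u x = v x"
  then obtain m e where "m' \<le> m" "\<forall>u. D' m' u = D m (\<lambda>x. e (u x))"
    using assms(1) unfolding pullback_def by blast
  moreover have "D m (\<lambda>x. e (u x)) = D m (\<lambda>x. e (v x))"
    using assms(2) \<open>N \<le> m'\<close> \<open>m' \<le> m\<close> uv by (simp add: local_col_def)
  ultimately show "D' m' u = D' m' v" by simp
qed

lemma pullback_not: "pullback N P d D' D \<Longrightarrow> pullback N P d (\<lambda>m u. \<not> D' m u) (\<lambda>m u. \<not> D m u)"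
  by (simp add: pullback_def)

text \<open>Mostly used negated: if the negation of \<open>D\<close> is dense nowhere, the same
  holds for every pullback of \<open>D\<close>, so this hypothesis survives each change of
  coloring.\<close>

lemma dense_pullback:
  assumes pb: "pullback N P d D' D" and den: "dense N P d D' q w" and q: "N \<le> q"
  shows "dense N P d D q w"
  unfolding dense_def
proof (intro allI impI)
  fix n assume "q \<le> n"
  then obtain m e where 1: "n \<le> m" "e \<in> Ed P d n m"
    and 2: "\<And>u. u \<in> Wd N P d n \<Longrightarrow> \<forall>x\<in>L N. take q (u x) = w x \<Longrightarrow> D' m (\<lambda>x. e (u x))"
    using den unfolding dense_def by blast
  obtain m2 e2 where 3: "m \<le> m2" "e2 \<in> Ed P d m m2" "\<And>u. D' m u = D m2 (\<lambda>x. e2 (u x))"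
  proof -
    have "N \<le> m" using q \<open>q \<le> n\<close> \<open>n \<le> m\<close> by simp
    then show ?thesis using that pb unfolding pullback_def by blast
  qed
  show "\<exists>m\<ge>n. \<exists>e\<in>Ed P d n m. \<forall>u\<in>Wd N P d n.
     (\<forall>x\<in>L N. take q (u x) = w x) \<longrightarrow> D m (\<lambda>x. e (u x))"
    by (rule exI[of _ m2], intro conjI bexI[of _ "\<lambda>x. e2 (e x)"])
      (use 1 2 3 Ed_comp in auto)
qed

text \<open>The nodes of level \<open>n\<close> above \<open>x\<close> are treated one after the other, the others being continued by zeroes.\<close>

lemma collect:
  assumes g: "good N P d" and x: "x \<in> L N" "x \<notin> P" and lc: "local_col N D"
    and Nl: "N \<le> l" "l \<le> n"
    and Ok: "\<And>m' m u e. u \<in> Wd N P d m' \<Longrightarrow> e \<in> Ed P d m' m \<Longrightarrow> l \<le> m' \<Longrightarrow> Q m' u \<Longrightarrow> Q m (\<lambda>x. e (u x))"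
    and reach: "\<And>D' m' b. pullback N P d D' D \<Longrightarrow> l \<le> m' \<Longrightarrow> b \<in> L m' \<Longrightarrow> take N b = x \<Longrightarrow>
       \<exists>m\<ge>m'. \<exists>e\<in>Ed P d m' m. \<forall>u\<in>Wd N P d m'. Q m' u \<longrightarrow> u x = b \<longrightarrow> D' m (\<lambda>x. e (u x))"
  shows "\<exists>m\<ge>n. \<exists>e\<in>Ed P d n m. \<forall>u\<in>Wd N P d n. Q n u \<longrightarrow> D m (\<lambda>x. e (u x))"
proof -
  define Bs where "Bs = {b \<in> L n. take N b = x}"
  have "finite Bs" unfolding Bs_def using finite_level by simp
  have Nn: "N \<le> n" using Nl by simp
  \<comment> \<open>The claim covers all levels \<open>m'\<close> from \<open>n\<close> on, because
    the map chosen for the next node lifts everything to a level not known in advance. Nodes already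
    settled must be recognisable there, and \<open>zpad m' b\<close> is the form in which they
    arrive.\<close>
  have "\<exists>D'. pullback N P d D' D \<and>
      (\<forall>m'\<ge>n. \<forall>u\<in>Wd N P d m'. Q m' u \<longrightarrow> (\<exists>b\<in>B. u x = zpad m' b) \<longrightarrow> D' m' u)"
    if "finite B" "B \<subseteq> Bs" for B
    using that
  proof (induction B rule: finite_induct)
    case empty
    then show ?case using pullback_refl by blast
  next
    case (insert b B)
    then obtain D' where D': "pullback N P d D' D"
      and hold: "\<And>m' u. n \<le> m' \<Longrightarrow> u \<in> Wd N P d m' \<Longrightarrow> Q m' u \<Longrightarrow> \<exists>b\<in>B. u x = zpad m' b \<Longrightarrow> D' m' u"
      by auto
    have lc': "local_col N D'" using D' lc pullback_local by blast
    have bB: "b \<in> L n" "take N b = x" "\<And>b'. b' \<in> B \<Longrightarrow> b' \<in> L n \<and> take N b' = x"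
      using insert by (auto simp: Bs_def)
    have tkz: "take N (zpad m' b') = x" "zpad m' b' \<in> L m'" if "b' \<in> insert b B" "n \<le> m'" for b' m'
    proof -
      have 1: "b' \<in> L n" "take N b' = x" using that bB by auto
      then show "take N (zpad m' b') = x"
        using Nn by (simp add: zpad_def level_length)
      show "zpad m' b' \<in> L m'" using 1 that zpad_level by blast
    qed
    have step: "\<exists>p. m' \<le> fst p \<and> snd p \<in> Ed P d m' (fst p) \<and>
       (n \<le> m' \<longrightarrow> (\<forall>u\<in>Wd N P d m'. Q m' u \<longrightarrow> (\<exists>b\<in>insert b B. u x = zpad m' b) \<longrightarrow> D' (fst p) (\<lambda>y. snd p (u y))))"
      if "N \<le> m'" for m'
    proof (cases "n \<le> m'")
      case False
      \<comment> \<open>Nothing is demanded below \<open>n\<close>, but a pullback has to be given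
        at every level from \<open>N\<close> on.\<close>
      then show ?thesis using Ed_id by (intro exI[of _ "(m', \<lambda>x. x)"]) auto
    next
      case True
      then have "l \<le> m'" using Nl by simp
      from reach[OF D' this tkz(2)[of b] tkz(1)[of b]] True
      obtain m e where me: "m' \<le> m" "e \<in> Ed P d m' m"
        "\<And>u. u \<in> Wd N P d m' \<Longrightarrow> Q m' u \<Longrightarrow> u x = zpad m' b \<Longrightarrow> D' m (\<lambda>x. e (u x))"
        by auto
      define Z where "Z = zpad m' ` B"
      \<comment> \<open>Settled nodes are continued by zeroes instead of by \<open>e\<close>. This
        does not disturb the thinned branches: they run above \<open>P\<close>, and \<open>Z\<close>
        lies above \<open>x\<close>.\<close>
      define e' where "e' = (\<lambda>z. if z \<in> L m' - Z then e z else zpad m z)"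
      have Ee': "E (L m') m' m e'"
        unfolding e'_def by (rule E_zero, rule E_mono[of "L m'"]) (use me in \<open>auto simp: Ed_def\<close>)
      have notZ: "z \<notin> Z" if "take N z \<noteq> x" for z
        using that tkz(1) True by (auto simp: Z_def)
      have PZ: "d y m' \<in> L m' - Z" if "y \<in> P" for y
        using good_branch[OF g that \<open>N \<le> m'\<close>] that x(2) notZ[of "d y m'"] by auto
      have e'Ed: "e' \<in> Ed P d m' m"
        using Ee' PZ me(2) by (auto simp: Ed_def e'_def)
      have "D' m (\<lambda>y. e' (u y))" if u: "u \<in> Wd N P d m'" "Q m' u" and ex: "\<exists>b\<in>insert b B. u x = zpad m' b" for u
      proof (cases "u x \<in> Z")
        case True
        then obtain b' where b': "b' \<in> B" "u x = zpad m' b'" by (auto simp: Z_def)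
        have "length b' \<le> m'"
          using bB(3)[OF b'(1)] \<open>n \<le> m'\<close> by (auto dest: level_length)
        then have "e' (u x) = zpad m b'"
          using True b' me(1) by (simp add: e'_def zpad_zpad)
        then show ?thesis
          using hold[OF _ Wd_Ed[OF u(1) e'Ed] Ok[OF u(1) e'Ed \<open>l \<le> m'\<close> u(2)]] b'(1) True me(1) \<open>n \<le> m'\<close>
          by auto
      next
        case False
        then have uxb: "u x = zpad m' b" using ex by (auto simp: Z_def)
        \<comment> \<open>The remaining values of \<open>u\<close> lie above nodes other than
          \<open>x\<close>, hence outside \<open>Z\<close>.\<close>
        have "e' (u y) = e (u y)" if "y \<in> L N" for y
        proof (cases "y = x")
          case True
          then show ?thesis using False Wd_maps[OF u(1) x(1)] by (simp add: e'_def)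
        next
          case False
          then show ?thesis using Wd_maps[OF u(1) that] notZ[of "u y"] by (simp add: e'_def)
        qed
        then have "D' m (\<lambda>y. e' (u y)) = D' m (\<lambda>y. e (u y))"
          using lc' \<open>N \<le> m'\<close> me(1) by (simp add: local_col_def)
        then show ?thesis using me(3)[OF u uxb] by simp
      qed
      then show ?thesis
        using me(1) e'Ed by (intro exI[of _ "(m, e')"]) auto
    qed
    then have "\<forall>m'. \<exists>p. N \<le> m' \<longrightarrow> m' \<le> fst p \<and> snd p \<in> Ed P d m' (fst p) \<and>
       (n \<le> m' \<longrightarrow> (\<forall>u\<in>Wd N P d m'. Q m' u \<longrightarrow> (\<exists>b\<in>insert b B. u x = zpad m' b) \<longrightarrow> D' (fst p) (\<lambda>y. snd p (u y))))"
      by blast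
    from choice[OF this] obtain p where p: "\<And>m'. N \<le> m' \<Longrightarrow> m' \<le> fst (p m') \<and> snd (p m') \<in> Ed P d m' (fst (p m')) \<and>
       (n \<le> m' \<longrightarrow> (\<forall>u\<in>Wd N P d m'. Q m' u \<longrightarrow> (\<exists>b\<in>insert b B. u x = zpad m' b) \<longrightarrow> D' (fst (p m')) (\<lambda>y. snd (p m') (u y))))"
      by blast
    define D'' where "D'' = (\<lambda>m' u. D' (fst (p m')) (\<lambda>y. snd (p m') (u y)))"
    have "pullback N P d D'' D'"
      unfolding pullback_def D''_def using p by blast
    then have "pullback N P d D'' D" using D' pullback_trans by blast
    moreover have "\<forall>m'\<ge>n. \<forall>u\<in>Wd N P d m'. Q m' u \<longrightarrow> (\<exists>b\<in>insert b B. u x = zpad m' b) \<longrightarrow> D'' m' u"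
      using p Nn by (auto simp: D''_def)
    ultimately show ?case by blast
  qed
  from this[OF \<open>finite Bs\<close> order_refl] obtain D' where D': "pullback N P d D' D"
    and h: "\<And>u. u \<in> Wd N P d n \<Longrightarrow> Q n u \<Longrightarrow> \<exists>b\<in>Bs. u x = zpad n b \<Longrightarrow> D' n u"
    by blast
  \<comment> \<open>At level \<open>n\<close> itself padding changes nothing, so every
    \<open>u\<close> has one of the settled values at \<open>x\<close>.\<close>
  have all: "D' n u" if "u \<in> Wd N P d n" "Q n u" for u
  proof (rule h[OF that], rule bexI[of _ "u x"])
    show "u x = zpad n (u x)" "u x \<in> Bs"
      using Wd_maps[OF that(1) x(1)] by (auto simp: Bs_def zpad_def dest: level_length)
  qed
  obtain m e where "n \<le> m" "e \<in> Ed P d n m" "\<And>u. D' n u = D m (\<lambda>x. e (u x))"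
    using D' Nn unfolding pullback_def by blast
  with all show ?thesis by auto
qed

section \<open>Thinning a tree to a branch by diagonalisation\<close>

abbreviation joint where
  "joint N P d x l v \<equiv> E (insert x P) N l (\<lambda>y. if y = x then v else d y l)"

text \<open>The node \<open>v\<close> is first lengthened by zeroes beyond level \<open>q\<close>.
  If the result is not above \<open>w x\<close>, the pair \<open>(q, w)\<close> does not concern the
  branch. Otherwise \<open>w\<close> lifts to a map \<open>w'\<close> through the longer node, and
  since avoiding the color is not dense above \<open>w'\<close>, \<open>collect\<close> read
  backwards yields a node at which no \<open>e\<close> avoids the color.\<close>

lemma diagonal_step:
  assumes g: "good N P d" and x: "x \<in> L N" "x \<notin> P" and lc: "local_col N Dc"
    and H: "\<And>q w. N \<le> q \<Longrightarrow> w \<in> Wd N P d q \<Longrightarrow> \<not> dense N P d (\<lambda>m u. \<not> Dc m u) q w"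
    and Nl: "N \<le> l" and J: "joint N P d x l v"
    and q: "N \<le> q" and w: "w \<in> Wd N P d q"
  shows "\<exists>D' l' v'. pullback N P d D' Dc \<and> l < l' \<and> take l v' = v \<and> joint N P d x l' v' \<and>
    q \<le> l' \<and> (take q v' = w x \<longrightarrow> (\<forall>m\<ge>l'. \<forall>e\<in>Ed P d l' m. \<exists>u\<in>Wd N P d l'.
       (\<forall>y\<in>L N. take q (u y) = w y) \<and> u x = v' \<and> D' m (\<lambda>y. e (u y))))"
proof -
  \<comment> \<open>Beyond \<open>l\<close>, so that the branch grows, and beyond \<open>q\<close>,
    so that the comparison with \<open>w x\<close> is decided.\<close>
  define l1 where "l1 = Suc (max l q)"
  define v1 where "v1 = zpad l1 v"
  have l1: "l < l1" "q < l1" "N \<le> l1" using Nl by (auto simp: l1_def)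
  have v: "v \<in> L l" "take N v = x" using E_maps[OF J, of x] by auto
  have tv: "take l v1 = v" using v level_length take_zpad by (auto simp: v1_def)
  obtain e where e: "e \<in> Ed P d l l1" "\<And>z. z \<in> L l \<Longrightarrow> z \<notin> (\<lambda>x. d x l) ` P \<Longrightarrow> e z = zpad l1 z"
    using Ed_nonempty[OF g Nl, of l1] l1 by auto
  have "v \<notin> (\<lambda>x. d x l) ` P"
    using good_branch(2)[OF g _ Nl] v(2) x(2) by auto
  then have ev: "e v = v1" using e(2) v(1) by (simp add: v1_def)
  have J1: "joint N P d x l1 v1"
    by (rule E_cong[OF E_comp_total[OF J, of l1 e]]) (use e(1) ev in \<open>auto simp: Ed_def\<close>)
  have v1: "v1 \<in> L l1" "take N v1 = x" using E_maps[OF J1, of x] by auto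
  show ?thesis
  proof (cases "w x = take q v1")
    case False
    show ?thesis
      by (rule exI[of _ Dc], rule exI[of _ l1], rule exI[of _ v1])
        (use False tv J1 l1 pullback_refl in auto)
  next
    case True
    let ?j = "\<lambda>y. if y = x then v1 else d y l1"
    \<comment> \<open>On the nodes at which the branches and \<open>v1\<close> pass level
      \<open>q\<close> the lift is prescribed by the joint map, with \<open>take N\<close> telling
      the trees apart; all other nodes are continued by zeroes.\<close>
    define h where "h = (\<lambda>z. ?j (take N z))"
    define X where "X = (\<lambda>y. take q (?j y)) ` insert x P"
    have jN: "take N (?j y) = y" if "y \<in> insert x P" for y
      using that v1 good_branch(2)[OF g _ l1(3)] by auto
    have jL: "?j y \<in> L l1" if "y \<in> insert x P" for y
      using that v1 good_branch(1)[OF g _ l1(3)] by auto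
    have jq: "take N (take q (?j y)) = y" if "y \<in> insert x P" for y
      using jN[OF that] q by (simp add: min_absorb1 split del: if_split)
    have hj: "h (take q (?j y)) = ?j y" if "y \<in> insert x P" for y
      unfolding h_def jq[OF that] ..
    have jl: "take l1 (?j y) = ?j y" if "y \<in> insert x P" for y
      using level_length[OF jL[OF that]] by (simp split del: if_split)
    have "E X q l1 h"
      unfolding X_def
      by (rule E_trunc[OF J1 q]) (use l1 hj jl in \<open>simp_all split del: if_split\<close>)
    from E_zero[OF this] have e0: "E (L q) q l1 (\<lambda>z. if z \<in> X then h z else zpad l1 z)" .
    define w' where "w' = (\<lambda>y. if w y \<in> X then h (w y) else zpad l1 (w y))"
    have Ew: "E (L N) N q w" and wP: "\<And>y. y \<in> P \<Longrightarrow> w y = d y q" using w by (auto simp: Wd_def)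
    have Ew': "E (L N) N l1 w'"
      using E_comp_total[OF Ew e0] by (simp add: w'_def)
    have wL: "w y \<in> L q" if "y \<in> L N" for y using E_maps[OF Ew that] by simp
    have w'q: "take q (w' y) = w y" if "y \<in> L N" for y
      using E_maps[OF e0 wL[OF that]] by (simp add: w'_def)
    have w'j: "w' y = ?j y" if "y \<in> insert x P" for y
    proof -
      have "w y = take q (?j y)"
      proof (cases "y = x")
        case False
        then have "y \<in> P" using that by simp
        then show ?thesis using False wP g q l1 by (auto simp: good_def)
      qed (use True in simp)
      then show ?thesis using that hj[OF that] by (auto simp: w'_def X_def split del: if_split)
    qed
    have "w' \<in> Wd N P d l1"
      using Ew' w'j x(2) by (auto simp: Wd_def)
    then have nd: "\<not> dense N P d (\<lambda>m u. \<not> Dc m u) l1 w'" using H l1 by blast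
    have "\<exists>D' l' b. pullback N P d D' Dc \<and> l1 \<le> l' \<and> b \<in> L l' \<and> take N b = x \<and>
       (\<forall>m\<ge>l'. \<forall>e\<in>Ed P d l' m. \<exists>u\<in>Wd N P d l'. (\<forall>y\<in>L N. take l1 (u y) = w' y) \<and> u x = b \<and> D' m (\<lambda>y. e (u y)))"
    proof (rule ccontr)
      assume contra: "\<not> ?thesis"
      \<comment> \<open>Without such a node, the negated color could be forced at every node above
        \<open>x\<close> and for every pullback, with lying above \<open>w'\<close> as the side
        condition \<open>Q\<close>; then \<open>collect\<close> applies.\<close>
      have "dense N P d (\<lambda>m u. \<not> Dc m u) l1 w'"
        unfolding dense_def
      proof (intro allI impI)
        fix n assume "l1 \<le> n"
        show "\<exists>m\<ge>n. \<exists>e\<in>Ed P d n m. \<forall>u\<in>Wd N P d n.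
            (\<forall>y\<in>L N. take l1 (u y) = w' y) \<longrightarrow> \<not> Dc m (\<lambda>y. e (u y))"
        proof (rule collect[OF g x _ l1(3) \<open>l1 \<le> n\<close>, where Q = "\<lambda>m u. \<forall>y\<in>L N. take l1 (u y) = w' y"])
          show "local_col N (\<lambda>m u. \<not> Dc m u)" using lc unfolding local_col_def by blast
        next
          fix m' m u e
          assume "u \<in> Wd N P d m'" "e \<in> Ed P d m' m" "l1 \<le> m'" "\<forall>y\<in>L N. take l1 (u y) = w' y"
          then show "\<forall>y\<in>L N. take l1 (e (u y)) = w' y" using Wd_Ed_take by simp
        next
          fix D'' m' b
          assume pb: "pullback N P d D'' (\<lambda>m u. \<not> Dc m u)" and "l1 \<le> m'" "b \<in> L m'" "take N b = x"
          have "pullback N P d (\<lambda>m u. \<not> D'' m u) Dc" using pullback_not[OF pb] by simp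
          then show "\<exists>m\<ge>m'. \<exists>e\<in>Ed P d m' m. \<forall>u\<in>Wd N P d m'. (\<forall>y\<in>L N. take l1 (u y) = w' y) \<longrightarrow>
              u x = b \<longrightarrow> D'' m (\<lambda>y. e (u y))"
            using contra \<open>l1 \<le> m'\<close> \<open>b \<in> L m'\<close> \<open>take N b = x\<close> by blast
        qed
      qed
      with nd show False by simp
    qed
    then obtain D' l' b where pb: "pullback N P d D' Dc" and l': "l1 \<le> l'" and b: "b \<in> L l'" "take N b = x"
      and bad: "\<And>m e. l' \<le> m \<Longrightarrow> e \<in> Ed P d l' m \<Longrightarrow>
         \<exists>u\<in>Wd N P d l'. (\<forall>y\<in>L N. take l1 (u y) = w' y) \<and> u x = b \<and> D' m (\<lambda>y. e (u y))"
      by blast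
    obtain u where u: "u \<in> Wd N P d l'" "\<And>y. y \<in> L N \<Longrightarrow> take l1 (u y) = w' y" "u x = b"
      using bad[OF order_refl Ed_id] by blast
    have tb: "take l1 b = v1" using u(2)[OF x(1)] u(3) w'j[of x] by simp
    have "take l (take l1 b) = take l b" using l1 by (simp add: min_absorb1)
    then have tlb: "take l b = v" using tb tv by simp
    have Jb: "joint N P d x l' b"
      by (rule E_cong[of _ _ _ u], rule E_mono[of "L N"])
        (use u x(1) g in \<open>auto simp: Wd_def good_def\<close>)
    have "\<exists>u\<in>Wd N P d l'. (\<forall>y\<in>L N. take q (u y) = w y) \<and> u x = b \<and> D' m (\<lambda>y. e (u y))"
      if me: "l' \<le> m" "e \<in> Ed P d l' m" for m e
    proof -
      obtain u where u: "u \<in> Wd N P d l'" "\<And>y. y \<in> L N \<Longrightarrow> take l1 (u y) = w' y" "u x = b" "D' m (\<lambda>y. e (u y))"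
        using bad[OF me] by blast
      have "take q (u y) = w y" if "y \<in> L N" for y
      proof -
        have "take q (take l1 (u y)) = take q (u y)" using l1 by (simp add: min_absorb1)
        then show ?thesis using u(2)[OF that] w'q[OF that] by simp
      qed
      with u show ?thesis by blast
    qed
    then show ?thesis
      by (intro exI[of _ D'] exI[of _ l'] exI[of _ b]) (use pb l1 l' tlb Jb in auto)
  qed
qed

text \<open>An extensional \<open>w\<close> is determined by its values on the finite level
  \<open>N\<close>. Without extensionality the arbitrary values elsewhere would make the set
  uncountable.\<close>

lemma countable_tasks: "countable {(q, w). N \<le> q \<and> w \<in> Wd N P d q \<and> w \<in> extensional (L N)}"
proof (rule countable_subset)
  show "{(q, w). N \<le> q \<and> w \<in> Wd N P d q \<and> w \<in> extensional (L N)} \<subseteq> (SIGMA q:UNIV. L N \<rightarrow>\<^sub>E L q)"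
    using Wd_maps by (auto simp: PiE_def)
  show "countable (SIGMA q:(UNIV :: nat set). L N \<rightarrow>\<^sub>E L q)"
    by (rule countable_SIGMA[OF countableI_type countable_finite[OF finite_PiE[OF finite_level finite_level]]])
qed

lemma good_base:
  assumes "good N P d" and "y \<in> P"
  shows "d y N = y"
  using good_branch[OF assms order_refl] level_length by (metis order_refl take_all)

lemma Wd_restrict:
  assumes "w \<in> Wd N P d q" and "P \<subseteq> L N"
  shows "restrict w (L N) \<in> Wd N P d q"
proof -
  have "E (L N) N q (restrict w (L N))"
    by (rule E_cong[of _ _ _ w]) (use assms in \<open>auto simp: Wd_def\<close>)
  then show ?thesis using assms by (auto simp: Wd_def)
qed

text \<open>
  If the claim fails at \<open>b\<close>, there is a branch through \<open>b\<close> that meets, for each of the countably many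
  \<open>(q, w)\<close>, a level at which \<open>D\<close> cannot be avoided above \<open>w\<close>. Thinning out the tree above \<open>x\<close> to this branch
  contradicts both alternatives of \<open>IH\<close>.
\<close>

lemma reach_node:
  assumes g: "good N P d" and x: "x \<in> L N" "x \<notin> P" and lc: "local_col N D"
    and IH: "\<And>d' D'. good N (insert x P) d' \<Longrightarrow> local_col N D' \<Longrightarrow>
       dense N (insert x P) d' D' N (\<lambda>x. x) \<or>
       (\<exists>q\<ge>N. \<exists>w\<in>Wd N (insert x P) d' q. dense N (insert x P) d' (\<lambda>m u. \<not> D' m u) q w)"
    and H: "\<And>q w. N \<le> q \<Longrightarrow> w \<in> Wd N P d q \<Longrightarrow> \<not> dense N P d (\<lambda>m u. \<not> D m u) q w"
    and n: "N \<le> n" and b: "b \<in> L n" "take N b = x"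
  shows "\<exists>m\<ge>n. \<exists>e\<in>Ed P d n m. \<forall>u\<in>Wd N P d n. u x = b \<longrightarrow> D m (\<lambda>y. e (u y))"
proof (rule ccontr)
  assume F: "\<not> ?thesis"
  then have F': "\<exists>u\<in>Wd N P d n. u x = b \<and> \<not> D m (\<lambda>y. e (u y))"
    if "n \<le> m" "e \<in> Ed P d n m" for m e
    using that by blast
  define Tk where "Tk = {(q, w). N \<le> q \<and> w \<in> Wd N P d q \<and> w \<in> extensional (L N)}"
  have PL: "P \<subseteq> L N" using g by (simp add: good_def)
  have "(\<lambda>x. x) \<in> Wd N P d N" using good_base[OF g] by (auto simp: Wd_def E_id)
  then have "(N, restrict (\<lambda>x. x) (L N)) \<in> Tk" using Wd_restrict PL by (auto simp: Tk_def)
  then have Tne: "Tk \<noteq> {}" by blast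
  have Tc: "countable Tk" unfolding Tk_def by (rule countable_tasks)
  define t where "t = from_nat_into Tk"
  have t: "t i \<in> Tk" for i using from_nat_into[OF Tne] by (simp add: t_def)
  \<comment> \<open>Failure for the identity already supplies a map through \<open>b\<close>; it
    shows that \<open>b\<close> is compatible with the branches above \<open>P\<close>, so the new
    branch can start there.\<close>
  obtain u0 where u0: "u0 \<in> Wd N P d n" "u0 x = b"
    using F'[OF order_refl Ed_id] by blast
  have J0: "joint N P d x n b"
    by (rule E_cong[of _ _ _ u0], rule E_mono[of "L N"]) (use u0 x(1) PL in \<open>auto simp: Wd_def\<close>)
  define Inv where "Inv = (\<lambda>(Dc, l, v). pullback N P d Dc D \<and> n \<le> l \<and> take n v = b \<and> joint N P d x l v)"
  define Rel where "Rel = (\<lambda>i (Dc, l, v) (D', l', v'). pullback N P d D' Dc \<and> l < l' \<and> take l v' = v \<and>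
     (case t i of (q, w) \<Rightarrow> q \<le> l' \<and> (take q v' = w x \<longrightarrow> (\<forall>m\<ge>l'. \<forall>e\<in>Ed P d l' m. \<exists>u\<in>Wd N P d l'.
       (\<forall>y\<in>L N. take q (u y) = w y) \<and> u x = v' \<and> D' m (\<lambda>y. e (u y))))))"
  have "\<exists>s. \<forall>i. Inv (s i) \<and> Rel i (s i) (s (Suc i))"
  proof (rule dependent_nat_choice)
    show "\<exists>s. Inv s"
      by (rule exI[of _ "(D, n, b)"])
        (use pullback_refl J0 b level_length in \<open>auto simp: Inv_def\<close>)
  next
    fix s i assume "Inv s"
    obtain Dc l v where s: "s = (Dc, l, v)" by (cases s)
    obtain q w where ti: "t i = (q, w)" by (cases "t i")
    have I: "pullback N P d Dc D" "n \<le> l" "take n v = b" "joint N P d x l v"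
      using \<open>Inv s\<close> by (auto simp: Inv_def s)
    have lcc: "local_col N Dc" using I(1) lc pullback_local by blast
    have HH: "\<not> dense N P d (\<lambda>m u. \<not> Dc m u) q w" if "N \<le> q" "w \<in> Wd N P d q" for q w
      using H[OF that] dense_pullback[OF pullback_not[OF I(1)] _ that(1)] by blast
    have "N \<le> l" "N \<le> q" "w \<in> Wd N P d q" using n I(2) t[of i] ti by (auto simp: Tk_def)
    from diagonal_step[OF g x lcc HH this(1) I(4) this(2,3)]
    obtain D' l' v' where 1: "pullback N P d D' Dc" "l < l'" "take l v' = v" "joint N P d x l' v'"
      "q \<le> l'" "take q v' = w x \<longrightarrow> (\<forall>m\<ge>l'. \<forall>e\<in>Ed P d l' m. \<exists>u\<in>Wd N P d l'.
       (\<forall>y\<in>L N. take q (u y) = w y) \<and> u x = v' \<and> D' m (\<lambda>y. e (u y)))"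
      by blast
    have "take n (take l v') = take n v'" using I(2) by (simp add: min_absorb1)
    then have "Inv (D', l', v')"
      using I 1 pullback_trans by (auto simp: Inv_def)
    moreover have "Rel i s (D', l', v')" using 1 by (simp add: Rel_def s ti)
    ultimately show "\<exists>s'. Inv s' \<and> Rel i s s'" by blast
  qed
  then obtain s where s: "\<And>i. Inv (s i)" "\<And>i. Rel i (s i) (s (Suc i))" by blast
  define Ds ls vs where "Ds = (\<lambda>i. fst (s i))" and "ls = (\<lambda>i. fst (snd (s i)))" and "vs = (\<lambda>i. snd (snd (s i)))"
  have I: "pullback N P d (Ds i) D" "n \<le> ls i" "take n (vs i) = b" "joint N P d x (ls i) (vs i)" for i
    using s(1)[of i] unfolding Inv_def Ds_def ls_def vs_def split_beta by simp_all
  have R: "pullback N P d (Ds (Suc i)) (Ds i)" "ls i < ls (Suc i)" "take (ls i) (vs (Suc i)) = vs i"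
    "case t i of (q, w) \<Rightarrow> q \<le> ls (Suc i) \<and> (take q (vs (Suc i)) = w x \<longrightarrow>
       (\<forall>m\<ge>ls (Suc i). \<forall>e\<in>Ed P d (ls (Suc i)) m. \<exists>u\<in>Wd N P d (ls (Suc i)).
       (\<forall>y\<in>L N. take q (u y) = w y) \<and> u x = vs (Suc i) \<and> Ds (Suc i) m (\<lambda>y. e (u y))))" for i
    using s(2)[of i] unfolding Rel_def Ds_def ls_def vs_def split_beta by simp_all
  have mono: "strict_mono ls" using R(2) by (simp add: strict_mono_Suc_iff)
  have ls_ge: "i \<le> ls i" for i using mono by (simp add: strict_mono_imp_increasing)
  have pbs: "pullback N P d (Ds j) (Ds i)" if "i \<le> j" for i j
    using that by (induction j rule: dec_induct) (use pullback_refl pullback_trans R(1) in blast)+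
  have vs_take: "take (ls i) (vs j) = vs i" if "i \<le> j" for i j
    using that
  proof (induction j rule: dec_induct)
    case base
    have "vs i \<in> L (ls i)" using E_maps[OF I(4)[of i], of x] by simp
    then show ?case using level_length by auto
  next
    case (step j)
    have "ls i \<le> ls j" using mono step(1) by (simp add: strict_mono_less_eq)
    then have "take (ls i) (vs (Suc j)) = take (ls i) (take (ls j) (vs (Suc j)))" by (simp add: min_absorb1)
    then show ?case using step R(3) by simp
  qed
  \<comment> \<open>Since \<open>ls m\<close> is at least \<open>m\<close>, the node
    \<open>vs m\<close> is long enough, and \<open>\<beta> m\<close> is the node of the limit branch
    at level \<open>m\<close>.\<close>
  define \<beta> where "\<beta> = (\<lambda>m. take m (vs m))"
  have \<beta>: "take m (vs j) = \<beta> m" if "m \<le> ls j" for m j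
  proof (cases "j \<le> m")
    case True
    have "take m (take (ls j) (vs m)) = take m (vs m)" using that by (simp add: min_absorb1)
    then show ?thesis using vs_take[OF True] by (simp add: \<beta>_def)
  next
    case False
    have "take m (take (ls m) (vs j)) = take m (vs j)" using ls_ge by (simp add: min_absorb1)
    then show ?thesis using vs_take[of m j] False by (simp add: \<beta>_def)
  qed
  \<comment> \<open>\<open>idx m\<close> counts the stages after the initial one whose level is at
    most \<open>m\<close>. Taking the coloring of that stage at level \<open>m\<close> makes the
    diagonal coloring, from level \<open>ls i\<close> on, a composition of \<open>Ds i\<close> with
    maps in \<open>Ed\<close>.\<close>
  define idx where "idx = (\<lambda>m. card {j. ls (Suc j) \<le> m})"
  have idx: "i \<le> idx m" if "ls i \<le> m" for i m
  proof -
    have "{j. ls (Suc j) \<le> m} \<subseteq> {..<m}" using ls_ge by (auto intro: Suc_le_lessD order_trans)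
    then have "finite {j. ls (Suc j) \<le> m}" using finite_subset by blast
    moreover have "{..<i} \<subseteq> {j. ls (Suc j) \<le> m}"
    proof
      fix j assume "j \<in> {..<i}"
      then have "ls (Suc j) \<le> ls i" using mono by (simp add: strict_mono_less_eq)
      with that show "j \<in> {j. ls (Suc j) \<le> m}" by simp
    qed
    ultimately have "card {..<i} \<le> idx m" unfolding idx_def by (rule card_mono)
    then show ?thesis by simp
  qed
  define Dl where "Dl = (\<lambda>m. Ds (idx m) m)"
  define P' d' where "P' = insert x P" and "d' = d(x := \<beta>)"
  have \<beta>take: "take a (\<beta> m) = \<beta> a" if "a \<le> m" for a m
  proof -
    have "take a (\<beta> m) = take a (vs m)" using that by (simp add: \<beta>_def min_absorb1)
    then show ?thesis using \<beta>[of a m] that ls_ge[of m] by simp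
  qed
  have g': "good N P' d'"
    unfolding good_def
  proof (intro conjI allI impI ballI)
    show "P' \<subseteq> L N" using PL x by (simp add: P'_def)
  next
    fix m assume "N \<le> m"
    let ?j = "\<lambda>y. if y = x then vs m else d y (ls m)"
    have J: "E (insert x P) N (ls m) ?j" using I(4) .
    have tN: "take N (?j y) = y" if "y \<in> insert x P" for y
      using E_maps[OF J that] by simp
    have tm: "take m (?j y) = d' y m" if "y \<in> insert x P" for y
    proof (cases "y = x")
      case False
      then have "take m (d y (ls m)) = d y m"
        using that g \<open>N \<le> m\<close> ls_ge[of m] by (auto simp: good_def)
      then show ?thesis using False by (simp add: d'_def)
    qed (simp add: d'_def \<beta>_def)
    \<comment> \<open>The joint map of stage \<open>m\<close> reaches level \<open>ls m\<close>,
      which is at least \<open>m\<close>. Truncated to \<open>m\<close> it shows that the old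
      branches and the new one are admissible together.\<close>
    have "E ((\<lambda>y. take N (?j y)) ` insert x P) N m (\<lambda>y. d' y m)"
      by (rule E_trunc[OF J order_refl \<open>N \<le> m\<close> ls_ge]) (use tN tm in simp)
    moreover have "(\<lambda>y. take N (?j y)) ` insert x P = P'"
      using tN by (simp add: P'_def image_def)
    ultimately show "E P' N m (\<lambda>y. d' y m)" by simp
  next
    fix y a c assume "y \<in> P'" "N \<le> a" "a \<le> c"
    then show "take a (d' y c) = d' y a"
      using g \<beta>take by (auto simp: P'_def d'_def good_def)
  qed
  have lc': "local_col N Dl"
    using pullback_local[OF I(1) lc] unfolding local_col_def Dl_def by blast
  have EdP: "Ed P' d' a c \<subseteq> Ed P d a c" for a c
    using x(2) by (auto simp: Ed_def P'_def d'_def)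
  have WdP: "u \<in> Wd N P' d' a" if "u \<in> Wd N P d a" "u x = \<beta> a" for u a
    using that x(2) by (auto simp: Wd_def P'_def d'_def)
  from IH[OF g'[unfolded P'_def] lc'] have
    "dense N P' d' Dl N (\<lambda>x. x) \<or> (\<exists>q\<ge>N. \<exists>w\<in>Wd N P' d' q. dense N P' d' (\<lambda>m u. \<not> Dl m u) q w)"
    by (simp add: P'_def)
  then show False
  proof (elim disjE exE conjE bexE)
    \<comment> \<open>The map \<open>e\<close> given by density works for every \<open>u\<close>
      through \<open>\<beta> n\<close>, which is \<open>b\<close>. Read back in \<open>D\<close>,
      this is what was assumed to fail at \<open>b\<close>.\<close>
    assume "dense N P' d' Dl N (\<lambda>x. x)"
    then obtain m e where me: "n \<le> m" "e \<in> Ed P' d' n m"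
      and hit: "\<And>u. u \<in> Wd N P' d' n \<Longrightarrow> \<forall>y\<in>L N. take N (u y) = y \<Longrightarrow> Dl m (\<lambda>y. e (u y))"
      using n unfolding dense_def by blast
    obtain m2 e2 where me2: "m \<le> m2" "e2 \<in> Ed P d m m2" "\<And>u. Ds (idx m) m u = D m2 (\<lambda>y. e2 (u y))"
      proof -
      have "N \<le> m" using n me(1) by simp
      then show ?thesis using that I(1)[of "idx m"] unfolding pullback_def by blast
    qed
    have "e \<in> Ed P d n m" using me EdP by blast
    then have "(\<lambda>y. e2 (e y)) \<in> Ed P d n m2" using me2 Ed_comp by blast
    moreover have "n \<le> m2" using me me2 by simp
    ultimately obtain u where u: "u \<in> Wd N P d n" "u x = b" "\<not> D m2 (\<lambda>y. e2 (e (u y)))"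
      using F' by blast
    have "\<beta> n = b" using \<beta>[of n 0] I(2,3)[of 0] by simp
    then have "u \<in> Wd N P' d' n" using u WdP by simp
    moreover have "\<forall>y\<in>L N. take N (u y) = y" using Wd_maps[OF u(1)] by simp
    ultimately have "Dl m (\<lambda>y. e (u y))" by (rule hit)
    then show False using u(3) me2(3) by (simp add: Dl_def)
  next
    \<comment> \<open>The pair was served at some stage \<open>i\<close>. At level
      \<open>ls (Suc i)\<close> no map avoids the color along the branch, whereas density claims
      that one does. The two colorings can be compared because \<open>idx m\<close> is at least
      \<open>Suc i\<close>.\<close>
    fix q w assume q: "N \<le> q" and w: "w \<in> Wd N P' d' q" and den: "dense N P' d' (\<lambda>m u. \<not> Dl m u) q w"
    have "restrict w (L N) \<in> Wd N P d q"
      using w x PL by (intro Wd_restrict) (auto simp: Wd_def P'_def d'_def)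
    then have "(q, restrict w (L N)) \<in> Tk" using q by (simp add: Tk_def)
    then obtain i where i: "t i = (q, restrict w (L N))"
      using from_nat_into_surj[OF Tc] by (auto simp: t_def)
    let ?l = "ls (Suc i)"
    have "q \<le> ?l" and alt: "take q (vs (Suc i)) = w x \<longrightarrow> (\<forall>m\<ge>?l. \<forall>e\<in>Ed P d ?l m. \<exists>u\<in>Wd N P d ?l.
       (\<forall>y\<in>L N. take q (u y) = w y) \<and> u x = vs (Suc i) \<and> Ds (Suc i) m (\<lambda>y. e (u y)))"
      using R(4)[of i] x(1) by (simp_all add: i)
    have vsl: "vs (Suc i) = \<beta> ?l"
      using \<beta>[of ?l "Suc i"] vs_take[of "Suc i" "Suc i"] by simp
    have wx: "w x = \<beta> q" using w by (simp add: Wd_def P'_def d'_def)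
    have "take q (vs (Suc i)) = w x" using \<beta>[OF \<open>q \<le> ?l\<close>] wx by simp
    then have bad: "\<And>m e. ?l \<le> m \<Longrightarrow> e \<in> Ed P d ?l m \<Longrightarrow> \<exists>u\<in>Wd N P d ?l.
       (\<forall>y\<in>L N. take q (u y) = w y) \<and> u x = vs (Suc i) \<and> Ds (Suc i) m (\<lambda>y. e (u y))"
      using alt by blast
    obtain m e where me: "?l \<le> m" "e \<in> Ed P' d' ?l m"
      and hit: "\<And>u. u \<in> Wd N P' d' ?l \<Longrightarrow> \<forall>y\<in>L N. take q (u y) = w y \<Longrightarrow> \<not> Dl m (\<lambda>y. e (u y))"
      using den \<open>q \<le> ?l\<close> unfolding dense_def by blast
    have "N \<le> m" using n I(2)[of "Suc i"] me(1) by simp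
    then obtain m2 e2 where me2: "m \<le> m2" "e2 \<in> Ed P d m m2"
      "\<And>u. Ds (idx m) m u = Ds (Suc i) m2 (\<lambda>y. e2 (u y))"
      using pbs[OF idx[OF me(1)]] unfolding pullback_def by blast
    have "(\<lambda>y. e2 (e y)) \<in> Ed P d ?l m2" using me me2 EdP Ed_comp by blast
    then obtain u where u: "u \<in> Wd N P d ?l" "\<forall>y\<in>L N. take q (u y) = w y" "u x = vs (Suc i)"
      "Ds (Suc i) m2 (\<lambda>y. e2 (e (u y)))"
      using bad[of m2 "\<lambda>y. e2 (e y)"] me me2 by auto
    then show False using hit WdP vsl me2(3) by (simp add: Dl_def)
  qed
qed

text \<open>Once every tree is a branch, the color is a sequence of truth values indexed by levels:
  true cofinally or false from some level on. With a tree left over, failure of the second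
  alternative lets \<open>reach_node\<close> force the color at each single node above some
  \<open>x\<close>, and \<open>collect\<close> joins these nodes.\<close>

theorem dense_dichotomy:
  assumes "good N P d" and "local_col N D"
  shows "dense N P d D N (\<lambda>x. x) \<or> (\<exists>q\<ge>N. \<exists>w\<in>Wd N P d q. dense N P d (\<lambda>m u. \<not> D m u) q w)"
  using assms
proof (induction "card (L N - P)" arbitrary: P d D)
  case 0
  have PL: "P = L N"
    using 0 finite_level by (auto simp: good_def)
  have Wu: "(\<forall>x\<in>L N. u x = d x n)" if "u \<in> Wd N P d n" for u n
    using that by (simp add: Wd_def PL)
  \<comment> \<open>No freedom is left in \<open>u\<close> or in \<open>e\<close> on the relevant
    nodes, so the color depends on the level alone.\<close>
  have hit: "C m (\<lambda>x. e (u x)) = C m (\<lambda>x. d x m)"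
    if "local_col N C" "N \<le> n" "n \<le> m" "u \<in> Wd N P d n" "e \<in> Ed P d n m" for C n m u e
  proof -
    have "\<forall>x\<in>L N. e (u x) = d x m" using that Wu by (simp add: Ed_def PL)
    then show ?thesis using that(1-3) by (simp add: local_col_def)
  qed
  show ?case
  proof (cases "\<forall>n\<ge>N. \<exists>m\<ge>n. D m (\<lambda>x. d x m)")
    case True
    have "dense N P d D N (\<lambda>x. x)"
      unfolding dense_def
    proof (intro allI impI)
      fix n assume "N \<le> n"
      then obtain m where m: "n \<le> m" "D m (\<lambda>x. d x m)" using True by blast
      obtain e where "e \<in> Ed P d n m" using Ed_nonempty[OF 0(2) \<open>N \<le> n\<close> m(1)] by blast
      then show "\<exists>m\<ge>n. \<exists>e\<in>Ed P d n m. \<forall>u\<in>Wd N P d n.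
          (\<forall>x\<in>L N. take N (u x) = x) \<longrightarrow> D m (\<lambda>x. e (u x))"
        using m hit[OF 0(3) \<open>N \<le> n\<close> m(1)] by blast
    qed
    then show ?thesis ..
  next
    case False
    then obtain n where n: "N \<le> n" "\<And>m. n \<le> m \<Longrightarrow> \<not> D m (\<lambda>x. d x m)" by blast
    have id: "(\<lambda>x. x) \<in> Wd N P d N" using good_base[OF 0(2)] by (auto simp: Wd_def E_id)
    have "dense N P d (\<lambda>m u. \<not> D m u) N (\<lambda>x. x)"
      unfolding dense_def
    proof (intro allI impI)
      fix n' assume "N \<le> n'"
      have "n' \<le> max n n'" by simp
      obtain e where e: "e \<in> Ed P d n' (max n n')"
        using Ed_nonempty[OF 0(2) \<open>N \<le> n'\<close> \<open>n' \<le> max n n'\<close>] by blast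
      then show "\<exists>m\<ge>n'. \<exists>e\<in>Ed P d n' m. \<forall>u\<in>Wd N P d n'.
          (\<forall>x\<in>L N. take N (u x) = x) \<longrightarrow> \<not> D m (\<lambda>x. e (u x))"
        using n hit[OF 0(3) \<open>N \<le> n'\<close> \<open>n' \<le> max n n'\<close>]
        by (intro exI[of _ "max n n'"]) auto
    qed
    then show ?thesis using id by blast
  qed
next
  case (Suc c)
  have fin: "finite (L N - P)" using finite_level by simp
  then obtain x where x: "x \<in> L N" "x \<notin> P"
    using Suc(2) by (metis Diff_iff card.empty ex_in_conv nat.distinct(1))
  have "c = card (L N - insert x P)"
    using Suc(2) x fin by (metis Diff_iff Diff_insert card_Diff_singleton diff_Suc_1)
  note IH = Suc(1)[OF this]
  show ?case
  proof (rule disjCI)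
    assume "\<not> (\<exists>q\<ge>N. \<exists>w\<in>Wd N P d q. dense N P d (\<lambda>m u. \<not> D m u) q w)"
    then have H: "\<And>q w. N \<le> q \<Longrightarrow> w \<in> Wd N P d q \<Longrightarrow> \<not> dense N P d (\<lambda>m u. \<not> D m u) q w"
      by blast
    \<comment> \<open>Needed for all pullbacks, since \<open>collect\<close> changes the coloring
      after each node; the assumption \<open>H\<close> passes to pullbacks.\<close>
    have reach: "\<exists>m\<ge>m'. \<exists>e\<in>Ed P d m' m. \<forall>u\<in>Wd N P d m'. u x = b \<longrightarrow> D' m (\<lambda>y. e (u y))"
      if pb: "pullback N P d D' D" and "N \<le> m'" "b \<in> L m'" "take N b = x" for D' m' b
    proof (rule reach_node[OF Suc(3) x pullback_local[OF pb Suc(4)] _ _ that(2-4)])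
      fix q w assume "N \<le> q" "w \<in> Wd N P d q"
      then show "\<not> dense N P d (\<lambda>m u. \<not> D' m u) q w"
        using H dense_pullback[OF pullback_not[OF pb]] by blast
    qed (use IH in blast)
    show "dense N P d D N (\<lambda>x. x)"
      unfolding dense_def
    proof (intro allI impI)
      fix n assume "N \<le> n"
      have "\<exists>m\<ge>n. \<exists>e\<in>Ed P d n m. \<forall>u\<in>Wd N P d n. True \<longrightarrow> D m (\<lambda>y. e (u y))"
        by (rule collect[OF Suc(3) x Suc(4) order_refl \<open>N \<le> n\<close>, where Q = "\<lambda>_ _. True"]) (use reach in auto)
      then show "\<exists>m\<ge>n. \<exists>e\<in>Ed P d n m. \<forall>u\<in>Wd N P d n.
          (\<forall>x\<in>L N. take N (u x) = x) \<longrightarrow> D m (\<lambda>x. e (u x))"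
        by blast
    qed
  qed
qed

text \<open>The case of no thinned tree. The color \<open>b\<close> absorbs the asymmetry of the
  dichotomy: under the first alternative \<open>w\<close> is the identity of level
  \<open>N\<close>.\<close>

corollary extension_dichotomy:
  assumes "local_col N D"
  shows "\<exists>b q w. N \<le> q \<and> E (L N) N q w \<and>
    (\<forall>n\<ge>q. \<exists>m\<ge>n. \<exists>e. E (L n) n m e \<and> (\<forall>u. E (L N) N n u \<longrightarrow>
       (\<forall>x\<in>L N. take q (u x) = w x) \<longrightarrow> D m (\<lambda>x. e (u x)) = b))"
proof -
  have good: "good N {} (\<lambda>_ _. [])" by (auto simp: good_def intro: E_empty)
  have N: "E (L N) N N (\<lambda>x. x)" by (rule E_id) simp
  let ?D = "\<lambda>b m u. D m u = b"
  have "\<exists>b q w. N \<le> q \<and> E (L N) N q w \<and> dense N {} (\<lambda>_ _. []) (?D b) q w"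
    using dense_dichotomy[OF good assms]
  proof (elim disjE exE conjE bexE)
    assume "dense N {} (\<lambda>_ _. []) D N (\<lambda>x. x)"
    then have "dense N {} (\<lambda>_ _. []) (?D True) N (\<lambda>x. x)" by simp
    with N show ?thesis by blast
  next
    fix q w assume "N \<le> q" "w \<in> Wd N {} (\<lambda>_ _. []) q" "dense N {} (\<lambda>_ _. []) (\<lambda>m u. \<not> D m u) q w"
    moreover from this have "dense N {} (\<lambda>_ _. []) (?D False) q w" by simp
    ultimately show ?thesis unfolding Wd_def by blast
  qed
  then obtain b q w where "N \<le> q" "E (L N) N q w" and den: "dense N {} (\<lambda>_ _. []) (?D b) q w"
    by blast
  then show ?thesis
    by (intro exI[of _ b] exI[of _ q] exI[of _ w]) (force simp: dense_def Wd_def Ed_def)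
qed

end

section \<open>Structures and free limits\<close>

lemma lstructureD:
  assumes "lstructure k Flip A"
  shows "univ A = (\<Union>i<k. unary A i)"
    and "(\<Union>i<k. binary A i) = {(a, b). a \<in> univ A \<and> b \<in> univ A \<and> a \<noteq> b}"
    and "i < k \<Longrightarrow> (a, b) \<in> binary A i \<longleftrightarrow> (b, a) \<in> binary A (Flip i)"
    and "k \<le> i \<Longrightarrow> unary A i = {}" and "k \<le> i \<Longrightarrow> binary A i = {}"
  using assms unfolding lstructure_def by metis+

lemma lstructure_rlab:
  assumes A: "lstructure k Flip A" and ab: "a \<in> univ A" "b \<in> univ A" "a \<noteq> b"
  shows "rlab A a b < k" and "(a, b) \<in> binary A i \<longleftrightarrow> rlab A a b = i"
proof -
  have "(a, b) \<in> (\<Union>i<k. binary A i)" using lstructureD(2)[OF A] ab by blast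
  then obtain j where j: "j < k" "(a, b) \<in> binary A j" by auto
  have uniq: "i = j" if "(a, b) \<in> binary A i" for i
  proof (rule ccontr)
    assume "i \<noteq> j"
    have "i < k" using that lstructureD(5)[OF A, of i] by (cases "i < k") auto
    then have "binary A i \<inter> binary A j = {}"
      using A \<open>i \<noteq> j\<close> j by (auto simp: lstructure_def disjoint_family_on_def)
    with that j show False by blast
  qed
  have "rlab A a b = j" unfolding rlab_def by (rule the_equality, rule j(2), erule uniq)
  then show "rlab A a b < k" "(a, b) \<in> binary A i \<longleftrightarrow> rlab A a b = i"
    using j uniq by blast+
qed

lemma lstructure_ulab:
  assumes A: "lstructure k Flip A" and a: "a \<in> univ A"
  shows "ulab A a < k" and "a \<in> unary A i \<longleftrightarrow> ulab A a = i"
proof -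
  obtain j where j: "j < k" "a \<in> unary A j" using lstructureD(1)[OF A] a by auto
  have uniq: "i = j" if "a \<in> unary A i" for i
  proof (rule ccontr)
    assume "i \<noteq> j"
    have "i < k" using that lstructureD(4)[OF A, of i] by (cases "i < k") auto
    then have "unary A i \<inter> unary A j = {}"
      using A \<open>i \<noteq> j\<close> j by (auto simp: lstructure_def disjoint_family_on_def)
    with that j show False by blast
  qed
  have "ulab A a = j" unfolding ulab_def by (rule the_equality, rule j(2), erule uniq)
  then show "ulab A a < k" "a \<in> unary A i \<longleftrightarrow> ulab A a = i"
    using j uniq by blast+
qed

lemma lstructure_binaryD:
  assumes A: "lstructure k Flip A" and "(a, b) \<in> binary A i"
  shows "a \<in> univ A" "b \<in> univ A" "a \<noteq> b" "i < k"
proof -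
  show "i < k" using assms(2) lstructureD(5)[OF A, of i] by (cases "i < k") auto
  then have "(a, b) \<in> (\<Union>i<k. binary A i)" using assms by auto
  also have "\<dots> = {(a, b). a \<in> univ A \<and> b \<in> univ A \<and> a \<noteq> b}" by (rule lstructureD(2)[OF A])
  finally show "a \<in> univ A" "b \<in> univ A" "a \<noteq> b" by auto
qed

lemma lstructure_unaryD:
  assumes "lstructure k Flip A" and "a \<in> unary A i"
  shows "a \<in> univ A"
proof -
  have "i < k" using assms(2) lstructureD(4)[OF assms(1), of i] by (cases "i < k") auto
  then show ?thesis using assms lstructureD(1)[OF assms(1)] by auto
qed

lemma rlab_flip:
  assumes A: "lstructure k Flip A" and ab: "a \<in> univ A" "b \<in> univ A" "a \<noteq> b"
  shows "rlab A b a = Flip (rlab A a b)"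
proof -
  have "(a, b) \<in> binary A (rlab A a b)" using lstructure_rlab(2)[OF A ab] by simp
  then have "(b, a) \<in> binary A (Flip (rlab A a b))"
    using lstructureD(3)[OF A lstructure_rlab(1)[OF A ab]] by blast
  then show ?thesis using lstructure_rlab(2)[OF A ab(2,1)] ab(3) by simp
qed

text \<open>Every point and every pair of distinct points carries exactly one label, so preserving
  labels already preserves and reflects all symbols.\<close>

lemma embedding_iff:
  assumes A: "lstructure k Flip A" and B: "lstructure k Flip' B"
  shows "embedding f A B \<longleftrightarrow> f \<in> univ A \<rightarrow> univ B \<and> inj_on f (univ A) \<and>
    (\<forall>a\<in>univ A. ulab B (f a) = ulab A a) \<and>
    (\<forall>a\<in>univ A. \<forall>b\<in>univ A. a \<noteq> b \<longrightarrow> rlab B (f a) (f b) = rlab A a b)"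
    (is "?L \<longleftrightarrow> ?R")
proof
  assume e: ?L
  have "ulab B (f a) = ulab A a" if "a \<in> univ A" for a
    using e that lstructure_ulab(2)[OF A that] lstructure_ulab(2)[OF B, of "f a"]
    unfolding embedding_def by blast
  moreover have "rlab B (f a) (f b) = rlab A a b" if "a \<in> univ A" "b \<in> univ A" "a \<noteq> b" for a b
  proof -
    have "f a \<noteq> f b" using e that by (auto simp: embedding_def inj_on_def)
    then show ?thesis
      using e that lstructure_rlab(2)[OF A that] lstructure_rlab(2)[OF B, of "f a" "f b"]
      unfolding embedding_def by blast
  qed
  ultimately show ?R using e by (auto simp: embedding_def)
next
  assume r: ?R
  then have f: "\<And>a. a \<in> univ A \<Longrightarrow> f a \<in> univ B" by auto
  have "a \<in> unary A i \<longleftrightarrow> f a \<in> unary B i" if "a \<in> univ A" for a i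
    using r that lstructure_ulab(2)[OF A that] lstructure_ulab(2)[OF B f[OF that]] by simp
  moreover have "(a, b) \<in> binary A i \<longleftrightarrow> (f a, f b) \<in> binary B i" if "a \<in> univ A" "b \<in> univ A" for a b i
  proof (cases "a = b")
    case True
    then show ?thesis using lstructure_binaryD(3)[OF A] lstructure_binaryD(3)[OF B] by metis
  next
    case False
    then have "f a \<noteq> f b" using r that by (auto simp: inj_on_def)
    then show ?thesis
      using r that False lstructure_rlab(2)[OF A that False] lstructure_rlab(2)[OF B f[OF that(1)] f[OF that(2)]]
      by simp
  qed
  ultimately show ?L using r by (auto simp: embedding_def)
qed

lemma univ_induced [simp]: "univ (induced A X) = univ A \<inter> X"
  by (simp add: induced_def)

lemma ulab_induced: "a \<in> X \<Longrightarrow> ulab (induced A X) a = ulab A a"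
  by (simp add: ulab_def induced_def)

lemma rlab_induced: "a \<in> X \<Longrightarrow> b \<in> X \<Longrightarrow> rlab (induced A X) a b = rlab A a b"
  by (simp add: rlab_def induced_def)

text \<open>The structure pulled back along a map. It serves to rename points, in particular to put
  a point of \<open>K\<close> at position \<open>n\<close> as left density requires.\<close>

definition transport :: "'a set \<Rightarrow> ('a \<Rightarrow> 'b) \<Rightarrow> 'b lstruct \<Rightarrow> 'a lstruct" where
  "transport X f A = \<lparr>univ = X, unary = (\<lambda>i. {x \<in> X. f x \<in> unary A i}),
     binary = (\<lambda>i. {(x, y). x \<in> X \<and> y \<in> X \<and> (f x, f y) \<in> binary A i})\<rparr>"

lemma lstructure_transport:
  assumes A: "lstructure k Flip A" and inj: "inj_on f X" and sub: "f ` X \<subseteq> univ A"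
  shows "lstructure k Flip (transport X f A)"
proof -
  have all: "(\<Union>i<k. binary A i) = {(a, b). a \<in> univ A \<and> b \<in> univ A \<and> a \<noteq> b}"
    "(\<Union>i<k. unary A i) = univ A"
    using lstructureD(1,2)[OF A] by auto
  have 1: "(\<exists>i<k. (f x, f y) \<in> binary A i) \<longleftrightarrow> x \<noteq> y" if "x \<in> X" "y \<in> X" for x y
  proof -
    have "(\<exists>i<k. (f x, f y) \<in> binary A i) \<longleftrightarrow> (f x, f y) \<in> (\<Union>i<k. binary A i)" by blast
    then show ?thesis using that inj sub unfolding all(1) by (auto simp: inj_on_def)
  qed
  have 2: "\<exists>i<k. f x \<in> unary A i" if "x \<in> X" for x using that sub all(2) by blast
  show ?thesis
    unfolding lstructure_def
  proof (intro conjI)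
    show "univ (transport X f A) = (\<Union>i<k. unary (transport X f A) i)"
      using 2 by (auto simp: transport_def)
    show "{(a, b). a \<in> univ (transport X f A) \<and> b \<in> univ (transport X f A) \<and> a \<noteq> b} =
        (\<Union>i<k. binary (transport X f A) i)"
      using 1 by (auto simp: transport_def)
    have "m = n" if "a \<in> unary A m" "a \<in> unary A n" for a m n
      using that lstructure_ulab(2)[OF A lstructure_unaryD[OF A that(1)]] by simp
    then show "disjoint_family_on (unary (transport X f A)) {..<k}"
      unfolding disjoint_family_on_def transport_def lstruct.simps by blast
    have "m = n" if "(a, b) \<in> binary A m" "(a, b) \<in> binary A n" for a b m n
      using that lstructure_rlab(2)[OF A lstructure_binaryD(1-3)[OF A that(1)]] by simp
    then show "disjoint_family_on (binary (transport X f A)) {..<k}"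
      unfolding disjoint_family_on_def transport_def lstruct.simps by blast
    show "\<forall>i<k. \<forall>a. (a, a) \<notin> binary (transport X f A) i"
      using lstructure_binaryD(3)[OF A] unfolding transport_def lstruct.simps by blast
    show "\<forall>i<k. \<forall>a b. (a, b) \<in> binary (transport X f A) i \<longleftrightarrow> (b, a) \<in> binary (transport X f A) (Flip i)"
      using lstructureD(3)[OF A] unfolding transport_def lstruct.simps by blast
    show "\<forall>i\<ge>k. unary (transport X f A) i = {} \<and> binary (transport X f A) i = {}"
      using lstructureD(4,5)[OF A] by (simp add: transport_def)
  qed
qed

lemma embedding_transport:
  assumes "inj_on f X" and "f ` X \<subseteq> univ A"
  shows "embedding f (transport X f A) A"
  using assms by (auto simp: embedding_def transport_def)

lemma lstructure_induced:
  assumes A: "lstructure k Flip A"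
  shows "lstructure k Flip (induced A X)"
proof -
  have "induced A X = transport (univ A \<inter> X) (\<lambda>x. x) A"
    using lstructure_binaryD[OF A] lstructure_unaryD[OF A] by (auto simp: induced_def transport_def)
  then show ?thesis using lstructure_transport[OF A, of "\<lambda>x. x" "univ A \<inter> X"] by simp
qed

lemma embeddingD:
  assumes "embedding f A B" and "a \<in> univ A"
  shows "f a \<in> univ B" and "b \<in> univ A \<Longrightarrow> f a = f b \<longleftrightarrow> a = b"
    and "f a \<in> unary B i \<longleftrightarrow> a \<in> unary A i"
    and "b \<in> univ A \<Longrightarrow> (f a, f b) \<in> binary B i \<longleftrightarrow> (a, b) \<in> binary A i"
  using assms unfolding embedding_def inj_on_def by blast+

lemma embeddingI:
  assumes "\<And>a. a \<in> univ A \<Longrightarrow> f a \<in> univ B"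
    and "\<And>a b. a \<in> univ A \<Longrightarrow> b \<in> univ A \<Longrightarrow> f a = f b \<Longrightarrow> a = b"
    and "\<And>a i. a \<in> univ A \<Longrightarrow> a \<in> unary A i \<longleftrightarrow> f a \<in> unary B i"
    and "\<And>a b i. a \<in> univ A \<Longrightarrow> b \<in> univ A \<Longrightarrow> (a, b) \<in> binary A i \<longleftrightarrow> (f a, f b) \<in> binary B i"
  shows "embedding f A B"
  using assms unfolding embedding_def inj_on_def by blast

lemma embedding_comp:
  assumes f: "embedding f A B" and g: "embedding g B C"
  shows "embedding (\<lambda>x. g (f x)) A C"
proof (rule embeddingI)
  fix a i assume a: "a \<in> univ A"
  note fa = embeddingD(1)[OF f a]
  show "g (f a) \<in> univ C" by (rule embeddingD(1)[OF g fa])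
  show "a \<in> unary A i \<longleftrightarrow> g (f a) \<in> unary C i"
    using embeddingD(3)[OF f a] embeddingD(3)[OF g fa] by simp
  fix b assume b: "b \<in> univ A"
  note fb = embeddingD(1)[OF f b]
  show "(a, b) \<in> binary A i \<longleftrightarrow> (g (f a), g (f b)) \<in> binary C i"
    using embeddingD(4)[OF f a b] embeddingD(4)[OF g fa fb] by simp
  assume "g (f a) = g (f b)"
  then show "a = b" using embeddingD(2)[OF f a b] embeddingD(2)[OF g fa fb] by simp
qed

lemma isomorphism_inverse:
  assumes "isomorphism f A B"
  shows "isomorphism (inv_into (univ A) f) B A"
proof -
  let ?g = "inv_into (univ A) f"
  have e: "embedding f A B" and im: "f ` univ A = univ B" using assms by (simp_all add: isomorphism_def)
  have inj: "inj_on f (univ A)" using e by (simp add: embedding_def)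
  have fg: "f (?g b) = b" if "b \<in> univ B" for b using im that by (simp add: f_inv_into_f)
  have gA: "?g b \<in> univ A" if "b \<in> univ B" for b using im that by (simp add: inv_into_into)
  have "embedding ?g B A"
  proof (rule embeddingI)
    fix a i assume a: "a \<in> univ B"
    show "a \<in> unary B i \<longleftrightarrow> ?g a \<in> unary A i"
      using embeddingD(3)[OF e gA[OF a]] fg[OF a] by simp
  next
    fix a b i assume a: "a \<in> univ B" and b: "b \<in> univ B"
    show "(a, b) \<in> binary B i \<longleftrightarrow> (?g a, ?g b) \<in> binary A i"
      using embeddingD(4)[OF e gA[OF a] gA[OF b]] fg[OF a] fg[OF b] by simp
    assume "?g a = ?g b"
    then show "a = b" using fg[OF a] fg[OF b] by metis
  qed (rule gA)
  moreover have "?g ` univ B = univ A" using inv_into_image_cancel[OF inj order_refl] im by simp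
  ultimately show ?thesis by (simp add: isomorphism_def)
qed

section \<open>Partial embeddings of the limit and types of its points\<close>

locale free_limit =
  fixes k :: nat and Flip :: "nat \<Rightarrow> nat" and \<K> :: "nat lstruct set" and K :: "nat lstruct"
  assumes flip: "is_flip k Flip" and amalg: "free_amalgamation \<K>"
    and flim: "fraisse_limit k Flip \<K> K" and ldense: "left_dense \<K> K"
begin

abbreviation R where "R \<equiv> rlab K"
abbreviation U where "U \<equiv> ulab K"

lemma K_struct: "lstructure k Flip K" and univ_K [simp]: "univ K = UNIV" and age_K: "\<K> = age k Flip K"
  and homog: "ultrahomogeneous K"
  using flim by (auto simp: fraisse_limit_def)

text \<open>Members of the class are finite subsets of \<open>K\<close> up to isomorphism, so
  partial self-maps of \<open>K\<close> can replace embeddings between abstract structures.\<close>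

definition pemb :: "(nat \<Rightarrow> nat) \<Rightarrow> nat set \<Rightarrow> bool" where
  "pemb f X \<longleftrightarrow> inj_on f X \<and> (\<forall>x\<in>X. U (f x) = U x) \<and> (\<forall>x\<in>X. \<forall>y\<in>X. x \<noteq> y \<longrightarrow> R (f x) (f y) = R x y)"

lemma pemb_embedding: "pemb f X \<longleftrightarrow> embedding f (induced K X) K"
  unfolding embedding_iff[OF lstructure_induced[OF K_struct] K_struct] pemb_def
  by (auto simp: ulab_induced rlab_induced)

lemma pemb_embedding_induced: "pemb f X \<Longrightarrow> f ` X \<subseteq> Y \<Longrightarrow> embedding f (induced K X) (induced K Y)"
  unfolding embedding_iff[OF lstructure_induced[OF K_struct] lstructure_induced[OF K_struct]] pemb_def
  by (auto simp: ulab_induced rlab_induced image_subset_iff)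

lemma pemb_id: "pemb (\<lambda>x. x) X"
  by (simp add: pemb_def)

lemma pembD:
  assumes "pemb f X" and "x \<in> X"
  shows "U (f x) = U x" and "y \<in> X \<Longrightarrow> f x = f y \<longleftrightarrow> x = y"
    and "y \<in> X \<Longrightarrow> x \<noteq> y \<Longrightarrow> R (f x) (f y) = R x y"
  using assms by (auto simp: pemb_def inj_on_def)

lemma pembI:
  assumes "\<And>x. x \<in> X \<Longrightarrow> U (f x) = U x"
    and "\<And>x y. x \<in> X \<Longrightarrow> y \<in> X \<Longrightarrow> x \<noteq> y \<Longrightarrow> f x \<noteq> f y \<and> R (f x) (f y) = R x y"
  shows "pemb f X"
  using assms unfolding pemb_def inj_on_def by blast

lemma pemb_comp: "pemb f X \<Longrightarrow> pemb g (f ` X) \<Longrightarrow> pemb (\<lambda>x. g (f x)) X"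
  by (rule pembI) (simp_all add: pembD)

lemma pemb_subset: "pemb f X \<Longrightarrow> Y \<subseteq> X \<Longrightarrow> pemb f Y"
  by (rule pembI) (simp_all add: pembD subset_iff)

lemma induced_in_class: "finite X \<Longrightarrow> induced K X \<in> \<K>"
  using pemb_id[of X] by (auto simp: age_K age_def lstructure_induced[OF K_struct] pemb_embedding)

lemma pemb_inverse: "pemb f X \<Longrightarrow> pemb (inv_into X f) (f ` X)"
proof (rule pembI; elim imageE)
  assume f: "pemb f X"
  then have i: "inv_into X f (f x) = x" if "x \<in> X" for x using that by (simp add: pemb_def)
  fix z x assume "z = f x" "x \<in> X"
  then show "U (inv_into X f z) = U z" using i f by (simp add: pembD)
  fix z' x' assume "z' = f x'" "x' \<in> X" "z \<noteq> z'"
  then show "inv_into X f z \<noteq> inv_into X f z' \<and> R (inv_into X f z) (inv_into X f z') = R z z'"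
    using i f \<open>z = f x\<close> \<open>x \<in> X\<close> by (auto simp: pembD)
qed

lemma pemb_automorphism:
  assumes "pemb f X" and "finite X"
  shows "\<exists>h. pemb h UNIV \<and> (\<forall>x\<in>X. h x = f x)"
proof -
  have "isomorphism f (induced K X) (induced K (f ` X))"
    using pemb_embedding_induced[OF assms(1) order_refl] by (simp add: isomorphism_def)
  then obtain h where h: "isomorphism h K K" "\<forall>x\<in>X. h x = f x"
    using homog[unfolded ultrahomogeneous_def univ_K, rule_format, of X "f ` X" f] assms(2) by auto
  have "pemb h UNIV"
    using h(1) unfolding isomorphism_def embedding_iff[OF K_struct K_struct] pemb_def univ_K by blast
  with h show ?thesis by blast
qed

lemma R_flip: "a \<noteq> b \<Longrightarrow> R b a = Flip (R a b)"
  by (rule rlab_flip[OF K_struct]) simp_all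

lemma R_less: "a \<noteq> b \<Longrightarrow> R a b < k"
  using lstructure_rlab(1)[OF K_struct] by simp

text \<open>\<open>W\<close> and \<open>Y\<close> are amalgamated freely over \<open>Z\<close>, the
  amalgam is embedded in \<open>K\<close>, and homogeneity moves the copy of \<open>W\<close> back
  onto \<open>W\<close> point by point. What comes from \<open>Y - Z\<close> is then new and
  unrelated to the rest of \<open>W\<close>.\<close>

lemma free_amalgam:
  assumes Y: "finite Y" "Z \<subseteq> Y" and f: "pemb f Z" and W: "finite W" "f ` Z \<subseteq> W"
  shows "\<exists>g. pemb g Y \<and> (\<forall>z\<in>Z. g z = f z) \<and> (\<forall>y\<in>Y - Z. g y \<notin> W \<and> (\<forall>l\<in>W - f ` Z. R l (g y) = 0))"
proof -
  have "finite Z" using Y finite_subset by blast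
  have e: "embedding f (induced K Z) (induced K W)" "embedding (\<lambda>x. x) (induced K Z) (induced K Y)"
    by (rule pemb_embedding_induced[OF f W(2)], rule pemb_embedding_induced[OF pemb_id]) (simp add: Y(2))
  obtain D r s where D: "D \<in> \<K>" and r: "embedding r (induced K W) D" and s: "embedding s (induced K Y) D"
    and am: "\<forall>a\<in>univ (induced K Z). r (f a) = s a"
    and int: "r ` univ (induced K W) \<inter> s ` univ (induced K Y) = r ` f ` univ (induced K Z)"
    and rel: "\<forall>a\<in>univ D. \<forall>b\<in>univ D.
              \<not> {a, b} \<subseteq> r ` univ (induced K W) \<and> \<not> {a, b} \<subseteq> s ` univ (induced K Y) \<longrightarrow> rlab D a b = 0"
    using amalg[unfolded free_amalgamation_def, THEN bspec, OF induced_in_class[OF \<open>finite Z\<close>],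
        THEN bspec, OF induced_in_class[OF W(1)], THEN bspec, OF induced_in_class[OF Y(1)],
        THEN spec, THEN spec, THEN mp, OF conjI[OF e]]
    by (elim bexE exE conjE) (rule that)
  obtain \<epsilon> where \<epsilon>: "embedding \<epsilon> D K" and Ds: "lstructure k Flip D"
    using D by (auto simp: age_K age_def)
  have pr: "pemb (\<lambda>x. \<epsilon> (r x)) W" and ps: "pemb (\<lambda>x. \<epsilon> (s x)) Y"
    using embedding_comp[OF r \<epsilon>] embedding_comp[OF s \<epsilon>] by (auto simp: pemb_embedding)
  obtain h where h: "pemb h UNIV"
    and hr: "\<forall>x\<in>(\<lambda>x. \<epsilon> (r x)) ` W. h x = inv_into W (\<lambda>x. \<epsilon> (r x)) x"
    using pemb_automorphism[OF pemb_inverse[OF pr]] W by blast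
  have hrw: "h (\<epsilon> (r l)) = l" if "l \<in> W" for l
  proof -
    have "h (\<epsilon> (r l)) = inv_into W (\<lambda>x. \<epsilon> (r x)) (\<epsilon> (r l))" using hr that by blast
    also have "\<dots> = l" by (rule inv_into_f_f[of "\<lambda>x. \<epsilon> (r x)"]) (use pr that in \<open>simp_all add: pemb_def\<close>)
    finally show ?thesis .
  qed
  define g where "g = (\<lambda>y. h (\<epsilon> (s y)))"
  have "pemb g Y" unfolding g_def by (rule pemb_comp[OF ps pemb_subset[OF h]]) simp
  moreover have "g z = f z" if "z \<in> Z" for z
    using am that hrw[of "f z"] W(2) by (auto simp: g_def)
  moreover have "g y \<notin> W \<and> (\<forall>l\<in>W - f ` Z. R l (g y) = 0)" if y: "y \<in> Y - Z" for y
  proof -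
    have hinj: "inj h" using h by (simp add: pemb_def)
    have \<epsilon>inj: "inj_on \<epsilon> (univ D)" and \<epsilon>R: "\<And>a b. a \<in> univ D \<Longrightarrow> b \<in> univ D \<Longrightarrow> a \<noteq> b \<Longrightarrow> R (\<epsilon> a) (\<epsilon> b) = rlab D a b"
      using \<epsilon> unfolding embedding_iff[OF Ds K_struct] by auto
    have sD: "s y \<in> univ D" using s y by (auto simp: embedding_def)
    have rD: "r l \<in> univ D" if "l \<in> W" for l using r that by (auto simp: embedding_def)
    have sinj: "inj_on s Y" and rinj: "inj_on r W" using s r by (auto simp: embedding_def)
    have sy: "s y \<notin> r ` W"
    proof
      assume "s y \<in> r ` W"
      then have "s y \<in> r ` f ` Z" using int y by auto
      then obtain z where "z \<in> Z" "s y = s z" using am by auto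
      then show False using sinj y Y(2) by (auto simp: inj_on_def)
    qed
    have 1: "g y \<notin> W"
    proof
      assume a: "g y \<in> W"
      then have "h (\<epsilon> (r (g y))) = h (\<epsilon> (s y))" using hrw by (simp add: g_def)
      then have "r (g y) = s y" using hinj \<epsilon>inj rD[OF a] sD by (auto simp: inj_on_def)
      then show False using sy a by (metis imageI)
    qed
    moreover have "R l (g y) = 0" if l: "l \<in> W - f ` Z" for l
    proof -
      have ne: "r l \<noteq> s y" using sy l by (metis DiffD1 imageI)
      have "r l \<notin> s ` Y"
      proof
        assume "r l \<in> s ` Y"
        then have "r l \<in> r ` f ` Z" using int l by auto
        then show False using rinj l W(2) by (auto simp: inj_on_def)
      qed
      then have "rlab D (r l) (s y) = 0" using rel rD l sD sy by auto
      moreover have "R (\<epsilon> (r l)) (\<epsilon> (s y)) = rlab D (r l) (s y)" using \<epsilon>R rD l sD ne by simp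
      moreover have "R (h (\<epsilon> (r l))) (h (\<epsilon> (s y))) = R (\<epsilon> (r l)) (\<epsilon> (s y))"
        using pembD(3)[OF h] ne \<epsilon>inj rD l sD by (auto simp: inj_on_def)
      ultimately show ?thesis using hrw l by (simp add: g_def)
    qed
    ultimately show ?thesis by blast
  qed
  ultimately show ?thesis by blast
qed

definition tp :: "nat \<Rightarrow> nat \<Rightarrow> nat list" where
  "tp n y = map (\<lambda>i. R i y) [0..<n]"

lemma length_tp [simp]: "length (tp n y) = n"
  by (simp add: tp_def)

lemma tp_nth: "i < n \<Longrightarrow> tp n y ! i = R i y"
  by (simp add: tp_def)

lemma take_tp: "a \<le> n \<Longrightarrow> take a (tp n y) = tp a y"
  by (simp add: tp_def take_map)

lemma tp_eq_iff: "tp n y = t \<longleftrightarrow> length t = n \<and> (\<forall>i<n. R i y = t ! i)"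
  by (auto simp: tp_def list_eq_iff_nth_eq)

lemma tp_level: "n \<le> y \<Longrightarrow> tp n y \<in> level k n"
  using R_less by (auto simp: tp_def level_def tree_def)

lemma code_K: "code K n = tp n n"
  by (simp add: code_def tp_def)

text \<open>Left density speaks of one-point extensions of an initial segment. For the extension
  that puts \<open>p\<close> at position \<open>n\<close> it gives a point without relations to
  those between \<open>n\<close> and itself, whose code is the type of \<open>p\<close> continued by
  zeroes.\<close>

lemma left_dense_point:
  assumes "n \<le> p"
  shows "\<exists>q\<ge>n. U q = U p \<and> tp q q = zpad q (tp n p)"
proof -
  define f where "f = (\<lambda>i. if i < n then i else p)"
  define A where "A = transport {..<Suc n} f K"
  have inj: "inj_on f {..<Suc n}" using assms by (auto simp: inj_on_def f_def)
  have As: "lstructure k Flip A" unfolding A_def by (rule lstructure_transport[OF K_struct inj]) simp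
  have fe: "embedding f A K" unfolding A_def by (rule embedding_transport[OF inj]) simp
  have uA: "univ A = {..<Suc n}" by (simp add: A_def transport_def)
  have "A \<in> \<K>" using As fe uA by (auto simp: age_K age_def)
  moreover have "initial A n = initial K n"
    by (auto simp: induced_def A_def transport_def f_def fun_eq_iff split: if_splits)
  ultimately obtain q where q: "n \<le> q" and e: "embedding (\<lambda>i. if i < n then i else q) A K"
    and z: "\<forall>r\<in>{n..<q}. R r q = 0"
    using ldense uA unfolding left_dense_def by blast
  have fA: "U (f a) = ulab A a" "b < Suc n \<Longrightarrow> a \<noteq> b \<Longrightarrow> R (f a) (f b) = rlab A a b" if "a < Suc n" for a b
    using fe that uA unfolding embedding_iff[OF As K_struct] by auto
  have qA: "U (if a < n then a else q) = ulab A a"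
    "b < Suc n \<Longrightarrow> a \<noteq> b \<Longrightarrow> R (if a < n then a else q) (if b < n then b else q) = rlab A a b" if "a < Suc n" for a b
    using e that uA unfolding embedding_iff[OF As K_struct] by auto
  have "U q = U p" using fA(1)[of n] qA(1)[of n] by (simp add: f_def)
  moreover have "tp q q = zpad q (tp n p)"
    unfolding tp_eq_iff
  proof (intro conjI allI impI)
    show "length (zpad q (tp n p)) = q" using q by (simp add: zpad_def)
    fix i assume "i < q"
    show "R i q = zpad q (tp n p) ! i"
    proof (cases "i < n")
      case True
      then have "R i q = R i p" using fA(2)[of i n] qA(2)[of i n] by (simp add: f_def)
      then show ?thesis using True by (simp add: zpad_def nth_append tp_nth)
    next
      case False
      then show ?thesis using z \<open>i < q\<close> by (simp add: zpad_def nth_append)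
    qed
  qed
  ultimately show ?thesis using q by blast
qed

lemma k_pos: "0 < k"
  using flip by (auto simp: is_flip_def)

text \<open>For \<open>y \<ge> n\<close> the node \<open>tp n y\<close> is the type of \<open>y\<close> over the first \<open>n\<close> points of \<open>K\<close>. An age map
  that extends nodes sends realised configurations of types to realised configurations.\<close>

definition aext :: "nat list set \<Rightarrow> nat \<Rightarrow> nat \<Rightarrow> (nat list \<Rightarrow> nat list) \<Rightarrow> bool" where
  "aext X n m f \<longleftrightarrow> X \<subseteq> level k n \<and> n \<le> m \<and> (\<forall>x\<in>X. f x \<in> level k m \<and> take n (f x) = x) \<and>
     (\<forall>Y. finite Y \<longrightarrow> (\<forall>y\<in>Y. n \<le> y \<and> tp n y \<in> X) \<longrightarrow>
        (\<exists>b. pemb b Y \<and> (\<forall>y\<in>Y. m \<le> b y \<and> tp m (b y) = f (tp n y))))"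

lemma aext_realize:
  assumes "aext X n m f" and "finite Y" and "\<And>y. y \<in> Y \<Longrightarrow> n \<le> y \<and> tp n y \<in> X"
  shows "\<exists>b. pemb b Y \<and> (\<forall>y\<in>Y. m \<le> b y \<and> tp m (b y) = f (tp n y))"
proof -
  have "finite Y \<longrightarrow> (\<forall>y\<in>Y. n \<le> y \<and> tp n y \<in> X) \<longrightarrow>
      (\<exists>b. pemb b Y \<and> (\<forall>y\<in>Y. m \<le> b y \<and> tp m (b y) = f (tp n y)))"
    using assms(1) unfolding aext_def by (elim conjE) (erule spec)
  then show ?thesis using assms(2,3) by simp
qed

lemma aextI:
  assumes "X \<subseteq> level k n" and "n \<le> m" and "\<And>x. x \<in> X \<Longrightarrow> f x \<in> level k m \<and> take n (f x) = x"
    and "\<And>Y. finite Y \<Longrightarrow> (\<And>y. y \<in> Y \<Longrightarrow> n \<le> y \<and> tp n y \<in> X) \<Longrightarrow>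
        \<exists>b. pemb b Y \<and> (\<forall>y\<in>Y. m \<le> b y \<and> tp m (b y) = f (tp n y))"
  shows "aext X n m f"
  unfolding aext_def using assms by (intro conjI allI impI ballI) simp_all

lemma aext_maps: "aext X n m f \<Longrightarrow> x \<in> X \<Longrightarrow> f x \<in> level k m \<and> take n (f x) = x"
  by (simp add: aext_def)

lemma aext_dom: "aext X n m f \<Longrightarrow> X \<subseteq> level k n \<and> n \<le> m"
  by (simp add: aext_def)

text \<open>In a configuration \<open>Y\<close> the points with types in \<open>X\<close> are
  realised through \<open>f\<close>. The other points are attached by free amalgamation over these
  and the first \<open>n\<close> points, hence have relation 0 to the points from \<open>n\<close>
  to \<open>m\<close>.\<close>

lemma aext_zero:
  assumes f: "aext X n m f"
  shows "aext (level k n) n m (\<lambda>x. if x \<in> X then f x else zpad m x)"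
proof (rule aextI)
  have nm: "n \<le> m" using aext_dom[OF f] by simp
  then show "n \<le> m" .
  fix x assume x: "x \<in> level k n"
  show "(if x \<in> X then f x else zpad m x) \<in> level k m \<and> take n (if x \<in> X then f x else zpad m x) = x"
  proof (cases "x \<in> X")
    case False
    then show ?thesis
      using x nm k_pos by (auto simp: level_def tree_def zpad_def)
  qed (use aext_maps[OF f] in simp)
next
  fix Y assume Y: "finite Y" "\<And>y. y \<in> Y \<Longrightarrow> n \<le> y \<and> tp n y \<in> level k n"
  define Y1 where "Y1 = {y \<in> Y. tp n y \<in> X}"
  have fY1: "finite Y1" using Y(1) by (simp add: Y1_def)
  have nm: "n \<le> m" using aext_dom[OF f] by simp
  obtain b where b: "pemb b Y1" and bt: "\<And>y. y \<in> Y1 \<Longrightarrow> m \<le> b y \<and> tp m (b y) = f (tp n y)"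
    using aext_realize[OF f fY1] Y(2) by (auto simp: Y1_def)
  \<comment> \<open>The first \<open>n\<close> points stay fixed. Together with \<open>b\<close>
    this is an embedding because \<open>f\<close> extends nodes: \<open>y\<close> and
    \<open>b y\<close> have the same relations to the first \<open>n\<close> points.\<close>
  define c where "c = (\<lambda>y. if y < n then y else b y)"
  have Y1n: "n \<le> y" if "y \<in> Y1" for y using that Y(2) by (auto simp: Y1_def)
  have Rb: "R i (b y) = R i y" if "y \<in> Y1" "i < n" for i y
  proof -
    have "tp n (b y) = take n (tp m (b y))" using nm by (simp add: take_tp)
    also have "\<dots> = tp n y" using bt[OF that(1)] aext_maps[OF f] that(1) by (simp add: Y1_def)
    finally show ?thesis using that(2) by (metis tp_nth)
  qed
  have ord: "y \<in> Y1 \<and> n \<le> y \<and> n \<le> b y" if "y \<in> {..<n} \<union> Y1" "\<not> y < n" for y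
    using that bt[of y] nm by auto
  have pc: "pemb c ({..<n} \<union> Y1)"
  proof (rule pembI)
    fix y assume y: "y \<in> {..<n} \<union> Y1"
    show "U (c y) = U y"
      using ord[OF y] pembD(1)[OF b] by (simp add: c_def)
    fix z assume z: "z \<in> {..<n} \<union> Y1" and "y \<noteq> z"
    consider "y < n" "z < n" | "y < n" "\<not> z < n" | "\<not> y < n" "z < n" | "\<not> y < n" "\<not> z < n" by blast
    then show "c y \<noteq> c z \<and> R (c y) (c z) = R y z"
    proof cases
      case 1
      then show ?thesis using \<open>y \<noteq> z\<close> by (simp add: c_def)
    next
      case 2
      then show ?thesis using ord[OF z] Rb[of z y] by (simp add: c_def)
    next
      case 3
      then have "R (b y) z = R y z"
        using ord[OF y] Rb[of y z] R_flip[of z "b y"] R_flip[of z y] by auto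
      then show ?thesis using 3 ord[OF y] by (simp add: c_def)
    next
      case 4
      then show ?thesis
        using ord[OF y] ord[OF z] pembD(2,3)[OF b, of y z] \<open>y \<noteq> z\<close> by (simp add: c_def)
    qed
  qed
  have fin: "finite ({..<n} \<union> Y)" "{..<n} \<union> Y1 \<subseteq> {..<n} \<union> Y" "finite ({..<m} \<union> b ` Y1)"
    using Y(1) fY1 by (auto simp: Y1_def)
  have "c ` ({..<n} \<union> Y1) \<subseteq> {..<m} \<union> b ` Y1"
    using nm by (auto simp: c_def)
  from free_amalgam[OF fin(1,2) pc fin(3) this]
  obtain g where g: "pemb g ({..<n} \<union> Y)" and gc: "\<forall>z\<in>{..<n} \<union> Y1. g z = c z"
    and gz: "\<forall>y\<in>({..<n} \<union> Y) - ({..<n} \<union> Y1). g y \<notin> {..<m} \<union> b ` Y1 \<and>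
      (\<forall>l\<in>({..<m} \<union> b ` Y1) - c ` ({..<n} \<union> Y1). R l (g y) = 0)"
    by (elim exE conjE)
  have "m \<le> g y \<and> tp m (g y) = (if tp n y \<in> X then f (tp n y) else zpad m (tp n y))" if y: "y \<in> Y" for y
  proof (cases "tp n y \<in> X")
    case True
    then have "y \<in> Y1" using y by (simp add: Y1_def)
    then have "g y = b y" using gc Y1n[of y] by (auto simp: c_def)
    then show ?thesis using bt[OF \<open>y \<in> Y1\<close>] True by simp
  next
    case False
    then have yn: "y \<in> ({..<n} \<union> Y) - ({..<n} \<union> Y1)" using y Y(2)[OF y] by (auto simp: Y1_def)
    have "m \<le> g y" using gz yn by (auto simp: not_less[symmetric])
    moreover have "tp m (g y) = zpad m (tp n y)"
      unfolding tp_eq_iff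
    proof (intro conjI allI impI)
      show "length (zpad m (tp n y)) = m" using nm by (simp add: zpad_def)
      fix i assume i: "i < m"
      show "R i (g y) = zpad m (tp n y) ! i"
      proof (cases "i < n")
        case True
        then have "i \<noteq> y" using yn by auto
        have "g i = i" using gc True by (simp add: c_def)
        then have "R i (g y) = R i y"
          using pembD(3)[OF g, of i y] True y \<open>i \<noteq> y\<close> by simp
        then show ?thesis using True by (simp add: zpad_def nth_append tp_nth)
      next
        case False
        \<comment> \<open>The amalgamated part is sent below \<open>n\<close> or, through
          \<open>b\<close>, to \<open>m\<close> and above.\<close>
        have "i \<notin> c ` ({..<n} \<union> Y1)"
          using False i bt by (auto simp: c_def split: if_splits) force
        then have "R i (g y) = 0" using gz yn i by blast
        then show ?thesis using False i by (simp add: zpad_def nth_append)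
      qed
    qed
    ultimately show ?thesis using False by simp
  qed
  then show "\<exists>b. pemb b Y \<and> (\<forall>y\<in>Y. m \<le> b y \<and>
      tp m (b y) = (if tp n y \<in> X then f (tp n y) else zpad m (tp n y)))"
    using pemb_subset[OF g] by blast
qed simp

sublocale ext: ext_system k aext
proof
  show "0 < k" by (rule k_pos)
  show "X \<subseteq> level k n \<and> n \<le> m" if "aext X n m f" for X n m f
    using that by (rule aext_dom)
  show "f x \<in> level k m \<and> take n (f x) = x" if "aext X n m f" "x \<in> X" for X n m f x
    using that by (rule aext_maps)
  show "aext {} n m f" if "n \<le> m" for n m f
    using that by (auto simp: aext_def pemb_def)
  show "aext X n n (\<lambda>x. x)" if "X \<subseteq> level k n" for X n
  proof (rule aextI)
    fix Y assume "\<And>y. y \<in> Y \<Longrightarrow> n \<le> y \<and> tp n y \<in> X"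
    then show "\<exists>b. pemb b Y \<and> (\<forall>y\<in>Y. n \<le> b y \<and> tp n (b y) = tp n y)"
      using pemb_id by blast
  qed (use that level_length in auto)
  show "aext X n p (\<lambda>x. g (f x))" if f: "aext X n m f" and g: "aext (f ` X) m p g" for X n m p f g
  proof (rule aextI)
    show "X \<subseteq> level k n" "n \<le> p" using aext_dom[OF f] aext_dom[OF g] by auto
    fix x assume x: "x \<in> X"
    have "take n (take m (g (f x))) = take n (g (f x))" using aext_dom[OF f] by (simp add: min_absorb1)
    then show "g (f x) \<in> level k p \<and> take n (g (f x)) = x"
      using aext_maps[OF f x] aext_maps[OF g imageI[OF x]] by simp
  next
    fix Y assume Y: "finite Y" "\<And>y. y \<in> Y \<Longrightarrow> n \<le> y \<and> tp n y \<in> X"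
    obtain b where b: "pemb b Y" "\<And>y. y \<in> Y \<Longrightarrow> m \<le> b y \<and> tp m (b y) = f (tp n y)"
      using aext_realize[OF f Y] by blast
    have "finite (b ` Y)" using Y(1) by simp
    moreover have "m \<le> z \<and> tp m z \<in> f ` X" if "z \<in> b ` Y" for z using that b(2) Y(2) by auto
    ultimately have "\<exists>c. pemb c (b ` Y) \<and> (\<forall>z\<in>b ` Y. p \<le> c z \<and> tp p (c z) = g (tp m z))"
      by (rule aext_realize[OF g])
    then obtain c where c: "pemb c (b ` Y)" "\<And>z. z \<in> b ` Y \<Longrightarrow> p \<le> c z \<and> tp p (c z) = g (tp m z)"
      by blast
    show "\<exists>b. pemb b Y \<and> (\<forall>y\<in>Y. p \<le> b y \<and> tp p (b y) = g (f (tp n y)))"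
      using pemb_comp[OF b(1) c(1)] b(2) c(2) by (intro exI[of _ "\<lambda>y. c (b y)"]) simp
  qed
  show "aext Y n m f" if "aext X n m f" "Y \<subseteq> X" for X Y n m f
    using that unfolding aext_def by (meson subset_iff)
  show "aext X n m g" if f: "aext X n m f" and fg: "\<And>x. x \<in> X \<Longrightarrow> f x = g x" for X n m f g
  proof (rule aextI)
    fix Y assume Y: "finite Y" "\<And>y. y \<in> Y \<Longrightarrow> n \<le> y \<and> tp n y \<in> X"
    obtain b where "pemb b Y" "\<And>y. y \<in> Y \<Longrightarrow> m \<le> b y \<and> tp m (b y) = f (tp n y)"
      using aext_realize[OF f Y] by blast
    then show "\<exists>b. pemb b Y \<and> (\<forall>y\<in>Y. m \<le> b y \<and> tp m (b y) = g (tp n y))"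
      using fg Y(2) by (intro exI[of _ b]) simp
  next
    fix x assume "x \<in> X"
    then show "g x \<in> level k m \<and> take n (g x) = x" using aext_maps[OF f] fg by metis
  qed (use aext_dom[OF f] in simp_all)
  show "aext ((\<lambda>x. take a (f x)) ` X) a b h"
    if f: "aext X n m f" and nab: "n \<le> a" "a \<le> b" "b \<le> m"
      and h: "\<And>x. x \<in> X \<Longrightarrow> h (take a (f x)) = take b (f x)" for X n m f a b h
  proof (rule aextI)
    show "(\<lambda>x. take a (f x)) ` X \<subseteq> level k a"
      using aext_maps[OF f] nab by (auto intro!: take_level[of _ k m])
    show "a \<le> b" by (rule nab)
    fix z assume "z \<in> (\<lambda>x. take a (f x)) ` X"
    then obtain x where x: "x \<in> X" "z = take a (f x)" by auto
    have "take a (take b (f x)) = take a (f x)" using nab by (simp add: min_absorb1)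
    moreover have "take b (f x) \<in> level k b" using aext_maps[OF f x(1)] nab by (auto intro: take_level)
    ultimately show "h z \<in> level k b \<and> take a (h z) = z" using x h by simp
  next
    fix Y assume Y: "finite Y" "\<And>y. y \<in> Y \<Longrightarrow> a \<le> y \<and> tp a y \<in> (\<lambda>x. take a (f x)) ` X"
    have tX: "\<exists>x\<in>X. tp a y = take a (f x) \<and> tp n y = x" if yY: "y \<in> Y" for y
    proof -
      obtain x where x: "x \<in> X" "tp a y = take a (f x)" using Y(2)[OF yY] by auto
      have "tp n y = take n (take a (f x))" using x(2) nab by (metis take_tp)
      also have "\<dots> = x" using nab aext_maps[OF f x(1)] by (simp add: min_absorb1)
      finally show ?thesis using x by blast
    qed
    have "n \<le> y \<and> tp n y \<in> X" if "y \<in> Y" for y using tX[OF that] Y(2)[OF that] nab by auto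
    from aext_realize[OF f Y(1) this]
    obtain c where c: "pemb c Y" "\<And>y. y \<in> Y \<Longrightarrow> m \<le> c y \<and> tp m (c y) = f (tp n y)"
      by blast
    have "b \<le> c y \<and> tp b (c y) = h (tp a y)" if yY: "y \<in> Y" for y
    proof -
      obtain x where x: "x \<in> X" "tp a y = take a (f x)" "tp n y = x" using tX[OF yY] by blast
      have "tp b (c y) = take b (tp m (c y))" using nab by (simp add: take_tp)
      then show ?thesis using c(2)[OF yY] nab x h by simp
    qed
    then show "\<exists>c. pemb c Y \<and> (\<forall>y\<in>Y. b \<le> c y \<and> tp b (c y) = h (tp a y))"
      using c(1) by blast
  qed
  show "aext (level k n) n m (\<lambda>x. if x \<in> X then f x else zpad m x)" if "aext X n m f" for X n m f
    using that by (rule aext_zero)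
qed

section \<open>Age maps read over a copy of an initial segment\<close>

definition cp :: "(nat \<Rightarrow> nat) \<Rightarrow> nat \<Rightarrow> nat \<Rightarrow> nat list" where
  "cp l j y = map (\<lambda>i. R (l i) y) [0..<j]"

lemma cp_id: "cp (\<lambda>i. i) j y = tp j y"
  by (simp add: cp_def tp_def)

lemma cp_level:
  assumes "y \<notin> l ` {..<j}"
  shows "cp l j y \<in> level k j"
proof -
  have "R (l i) y < k" if "i < j" for i by (rule R_less) (use assms that in blast)
  then show ?thesis by (auto simp: cp_def level_def tree_def)
qed

lemma cp_eq_iff: "cp l j y = t \<longleftrightarrow> length t = j \<and> (\<forall>i<j. R (l i) y = t ! i)"
  by (auto simp: cp_def list_eq_iff_nth_eq)

text \<open>
  With \<open>l\<close> embedding \<open>A\<^sub>j\<close> into \<open>K\<close>, labeled structures in the class of \<open>A\<close> at \<open>j\<close> are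
  finite sets of points of \<open>K\<close> outside \<open>l ` {..<j}\<close>; \<open>aged l j n H\<close> is the nontrivial half of \<open>H\<close> being
  an age map to level \<open>n\<close>.
\<close>

definition aged :: "(nat \<Rightarrow> nat) \<Rightarrow> nat \<Rightarrow> nat \<Rightarrow> (nat list \<Rightarrow> nat list) \<Rightarrow> bool" where
  "aged l j n H \<longleftrightarrow> (\<forall>Y. finite Y \<longrightarrow> Y \<inter> l ` {..<j} = {} \<longrightarrow>
     (\<exists>b. pemb b Y \<and> (\<forall>y\<in>Y. n \<le> b y \<and> tp n (b y) = H (cp l j y))))"

lemma aged_realize:
  assumes "aged l j n H" and "finite Y" and "Y \<inter> l ` {..<j} = {}"
  shows "\<exists>b. pemb b Y \<and> (\<forall>y\<in>Y. n \<le> b y \<and> tp n (b y) = H (cp l j y))"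
  using assms unfolding aged_def by simp

lemma aged_aext:
  assumes H: "aged l j n H" and e: "aext (level k n) n m e"
  shows "aged l j m (\<lambda>z. e (H z))"
  unfolding aged_def
proof (intro allI impI)
  fix Y :: "nat set" assume Y: "finite Y" "Y \<inter> l ` {..<j} = {}"
  then obtain b where b: "pemb b Y" "\<forall>y\<in>Y. n \<le> b y \<and> tp n (b y) = H (cp l j y)"
    using aged_realize[OF H] by blast
  have "finite (b ` Y)" using Y(1) by simp
  moreover have "n \<le> z \<and> tp n z \<in> level k n" if "z \<in> b ` Y" for z
    using that b(2) tp_level by blast
  ultimately have "\<exists>c. pemb c (b ` Y) \<and> (\<forall>z\<in>b ` Y. m \<le> c z \<and> tp m (c z) = e (tp n z))"
    by (rule aext_realize[OF e])
  then obtain c where c: "pemb c (b ` Y)" "\<And>z. z \<in> b ` Y \<Longrightarrow> m \<le> c z \<and> tp m (c z) = e (tp n z)"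
    by blast
  show "\<exists>b. pemb b Y \<and> (\<forall>y\<in>Y. m \<le> b y \<and> tp m (b y) = e (H (cp l j y)))"
    using pemb_comp[OF b(1) c(1)] b(2) c(2) by (intro exI[of _ "\<lambda>y. c (b y)"]) simp
qed

lemma aged_id: "aged (\<lambda>i. i) n n (\<lambda>z. z)"
  unfolding aged_def cp_id
proof (intro allI impI)
  fix Y :: "nat set" assume "Y \<inter> (\<lambda>i. i) ` {..<n} = {}"
  then show "\<exists>b. pemb b Y \<and> (\<forall>y\<in>Y. n \<le> b y \<and> tp n (b y) = tp n y)"
    using pemb_id by (intro exI[of _ "\<lambda>y. y"]) (auto simp: not_less[symmetric])
qed

lemma aged_aext_word:
  assumes g: "aext (level k a) a n g" and H: "aged (\<lambda>i. i) n m H"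
    and Hn: "\<And>z. z \<in> level k n \<Longrightarrow> H z \<in> level k m \<and> take a (H z) = take a z" and nm: "n \<le> m"
  shows "aext (level k a) a m (\<lambda>z. H (g z))"
proof (rule aextI)
  show "a \<le> m" using aext_dom[OF g] nm by simp
  fix x assume "x \<in> level k a"
  then show "H (g x) \<in> level k m \<and> take a (H (g x)) = x"
    using Hn aext_maps[OF g] by simp
next
  fix Y assume Y: "finite Y" "\<And>y. y \<in> Y \<Longrightarrow> a \<le> y \<and> tp a y \<in> level k a"
  obtain b where b: "pemb b Y" "\<And>y. y \<in> Y \<Longrightarrow> n \<le> b y \<and> tp n (b y) = g (tp a y)"
    using aext_realize[OF g Y] by blast
  have "finite (b ` Y)" "b ` Y \<inter> (\<lambda>i. i) ` {..<n} = {}"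
    using Y(1) b(2) by (auto simp: not_less[symmetric])
  then obtain c where c: "pemb c (b ` Y)" "\<forall>y\<in>b ` Y. m \<le> c y \<and> tp m (c y) = H (tp n y)"
    using aged_realize[OF H, unfolded cp_id] by blast
  show "\<exists>b. pemb b Y \<and> (\<forall>y\<in>Y. m \<le> b y \<and> tp m (b y) = H (g (tp a y)))"
    using pemb_comp[OF b(1) c(1)] b(2) c(2) by (intro exI[of _ "\<lambda>y. c (b y)"]) simp
qed simp

text \<open>The new last entry has to become the relation to \<open>p\<close>. If \<open>l j\<close>
  is realised along with \<open>Y\<close>, its image has the type of \<open>p\<close> over the first
  \<open>p\<close> points and the same unary label, so homogeneity moves it to \<open>p\<close> and
  fixes those points.\<close>

lemma aged_Suc:
  assumes H: "aged l j p h" and l: "l j \<notin> l ` {..<j}"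
    and cd: "h (cp l j (l j)) = tp p p" and u: "U (l j) = U p"
    and H': "\<And>z i. H' (z @ [i]) = h z @ [i]"
  shows "aged l (Suc j) (Suc p) H'"
  unfolding aged_def
proof (intro allI impI)
  fix Y :: "nat set" assume Y: "finite Y" "Y \<inter> l ` {..<Suc j} = {}"
  have "finite (insert (l j) Y)" "insert (l j) Y \<inter> l ` {..<j} = {}"
    using Y l by auto
  then obtain b where b: "pemb b (insert (l j) Y)"
    and bt: "\<forall>y\<in>insert (l j) Y. p \<le> b y \<and> tp p (b y) = h (cp l j y)"
    using aged_realize[OF H] by blast
  define q where "q = b (l j)"
  have q: "p \<le> q" "tp p q = tp p p" "U q = U p"
    using bt cd u pembD(1)[OF b] by (auto simp: q_def)
  define f where "f = (\<lambda>i. if i < p then i else p)"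
  have Rq: "R i q = R i p" if "i < p" for i using q(2) that by (metis tp_nth)
  have "pemb f (insert q {..<p})"
  proof (rule pembI)
    fix x assume x: "x \<in> insert q {..<p}"
    then show "U (f x) = U x" using q by (auto simp: f_def)
    fix y assume y: "y \<in> insert q {..<p}" and "x \<noteq> y"
    show "f x \<noteq> f y \<and> R (f x) (f y) = R x y"
    proof (cases "x < p")
      case True
      then show ?thesis using y q(1) Rq[of x] \<open>x \<noteq> y\<close> by (auto simp: f_def)
    next
      case False
      then have "x = q" "y < p" using x y \<open>x \<noteq> y\<close> by auto
      then have "R p y = R q y" using Rq[of y] R_flip[of y p] R_flip[of y q] q(1) by simp
      then show ?thesis using \<open>x = q\<close> \<open>y < p\<close> False by (auto simp: f_def)
    qed
  qed
  from pemb_automorphism[OF this] obtain s where s: "pemb s UNIV" "\<forall>x\<in>insert q {..<p}. s x = f x"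
    by auto
  have sq: "s q = p" and si: "\<And>i. i < p \<Longrightarrow> s i = i" using s(2) q(1) by (auto simp: f_def)
  have seq: "s x = s y \<longleftrightarrow> x = y" for x y using pembD(2)[OF s(1)] by simp
  have sR: "x \<noteq> y \<Longrightarrow> R (s x) (s y) = R x y" for x y using pembD(3)[OF s(1)] by simp
  have "Suc p \<le> s (b y) \<and> tp (Suc p) (s (b y)) = H' (cp l (Suc j) y)" if y: "y \<in> Y" for y
  proof -
    have ny: "l j \<noteq> y" using Y(2) y by auto
    have byq: "b y \<noteq> q" using pembD(2)[OF b, of y "l j"] y ny by (auto simp: q_def)
    have byp: "p \<le> b y" "tp p (b y) = h (cp l j y)" using bt y by auto
    have "s (b y) \<noteq> p" using seq[of "b y" q] sq byq by simp
    moreover have "\<not> s (b y) < p"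
    proof
      assume "s (b y) < p"
      then have "s (s (b y)) = s (b y)" using si by simp
      then show False using seq \<open>s (b y) < p\<close> byp(1) by simp
    qed
    ultimately have 1: "Suc p \<le> s (b y)" by simp
    have "tp p (s (b y)) = tp p (b y)"
      unfolding tp_eq_iff
    proof (intro conjI allI impI)
      fix i assume "i < p"
      then show "R i (s (b y)) = tp p (b y) ! i"
        using sR[of i "b y"] si[of i] byp(1) by (simp add: tp_nth)
    qed simp
    moreover have "R p (s (b y)) = R (l j) y"
      using sR[of q "b y"] sq byq pembD(3)[OF b, of "l j" y] y ny by (simp add: q_def)
    moreover have "tp (Suc p) (s (b y)) = tp p (s (b y)) @ [R p (s (b y))]" by (simp add: tp_def)
    moreover have "cp l (Suc j) y = cp l j y @ [R (l j) y]" by (simp add: cp_def)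
    ultimately show ?thesis using 1 byp(2) H' by simp
  qed
  then show "\<exists>b. pemb b Y \<and> (\<forall>y\<in>Y. Suc p \<le> b y \<and> tp (Suc p) (b y) = H' (cp l (Suc j) y))"
    using pemb_comp[OF pemb_subset[OF b subset_insertI] pemb_subset[OF s(1) subset_UNIV]]
    by (intro exI[of _ "\<lambda>y. s (b y)"]) simp
qed

end

section \<open>Embeddings of coding trees\<close>

lemma level_fun_eq:
  assumes "0 < k" and "f ` level k j \<subseteq> level k n"
  shows "level_fun k f j = n"
  unfolding level_fun_def
proof (rule the_equality)
  fix n' assume n': "f ` level k j \<subseteq> level k n'"
  have "replicate j 0 \<in> level k j" using \<open>0 < k\<close> by (auto simp: level_def tree_def)
  then have "f (replicate j 0) \<in> level k n" "f (replicate j 0) \<in> level k n'" using assms(2) n' by auto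
  then show "n' = n" using level_length by blast
qed (rule assms)

lemma longest_common_prefix_append:
  "longest_common_prefix (r @ xs) (r @ ys) = r @ longest_common_prefix xs ys"
  by (induction r) auto

definition succ_ext :: "nat \<Rightarrow> enat \<Rightarrow> (nat list \<Rightarrow> nat list) \<Rightarrow> bool" where
  "succ_ext k M f \<longleftrightarrow> (\<forall>s i. s @ [i] \<in> tree_lt k M \<longrightarrow> prefix (f s @ [i]) (f (s @ [i])))"

lemma tree_lt_prefix: "prefix s t \<Longrightarrow> t \<in> tree_lt k M \<Longrightarrow> s \<in> tree_lt k M"
proof -
  assume s: "prefix s t" and t: "t \<in> tree_lt k M"
  have "length s \<le> length t" using s prefix_length_le by blast
  then have "enat (length s) \<le> enat (length t)" by simp
  also have "\<dots> < M" using t by (simp add: tree_lt_def)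
  finally have "enat (length s) < M" .
  moreover have "set s \<subseteq> {..<k}"
    using t set_mono_prefix[OF s] unfolding tree_lt_def tree_def by blast
  ultimately show "s \<in> tree_lt k M" by (simp add: tree_lt_def tree_def)
qed

lemma succ_ext_prefix:
  assumes f: "succ_ext k M f" and "s @ t \<in> tree_lt k M"
  shows "prefix (f s) (f (s @ t))"
  using assms(2)
proof (induction t rule: rev_induct)
  case (snoc i t)
  have "s @ t \<in> tree_lt k M" by (rule tree_lt_prefix[OF _ snoc(2)]) simp
  then have "prefix (f s) (f (s @ t))" by (rule snoc(1))
  moreover have "prefix (f (s @ t) @ [i]) (f ((s @ t) @ [i]))"
    using f snoc(2) unfolding succ_ext_def append_assoc[symmetric] by blast
  ultimately show ?case by (metis append_assoc prefix_order.trans append_prefixD)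
qed simp

lemma succ_ext_prefix_snoc:
  assumes f: "succ_ext k M f" and "s @ i # t \<in> tree_lt k M"
  shows "prefix (f s @ [i]) (f (s @ i # t))"
proof -
  have st: "(s @ [i]) @ t \<in> tree_lt k M" using assms(2) by simp
  have "s @ [i] \<in> tree_lt k M" by (rule tree_lt_prefix[OF _ st]) simp
  then have "prefix (f s @ [i]) (f (s @ [i]))" using f by (simp add: succ_ext_def)
  also have "prefix \<dots> (f ((s @ [i]) @ t))" by (rule succ_ext_prefix[OF f st])
  finally show ?thesis by simp
qed

text \<open>The entries concerned are the passing numbers. Injectivity, the points coded by an
  embedding and the converse half of the age condition are later read off from them.\<close>

lemma succ_ext_nth:
  assumes f: "succ_ext k M f" and s: "s \<in> tree_lt k M" and i: "i < length s"
  shows "prefix (f (take i s)) (f s)" and "f s ! length (f (take i s)) = s ! i"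
proof -
  have eq: "s = take i s @ s ! i # drop (Suc i) s" using i by (simp add: id_take_nth_drop)
  then have "prefix (f (take i s) @ [s ! i]) (f s)" using succ_ext_prefix_snoc[OF f] s by metis
  then obtain r where "f s = (f (take i s) @ [s ! i]) @ r" by (auto elim: prefixE)
  then show "prefix (f (take i s)) (f s)" "f s ! length (f (take i s)) = s ! i"
    by (simp_all add: nth_append)
qed

text \<open>If both words go on beyond their meet \<open>r\<close>, they do so with different
  letters, and the images repeat these letters directly after \<open>f r\<close>. If one of them is
  \<open>r\<close>, the images are comparable.\<close>

lemma succ_ext_meet:
  assumes f: "succ_ext k M f" and s: "s \<in> tree_lt k M" and t: "t \<in> tree_lt k M"
  shows "f (longest_common_prefix s t) = longest_common_prefix (f s) (f t)"
proof -
  define r where "r = longest_common_prefix s t"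
  obtain s' t' where st: "s = r @ s'" "t = r @ t'"
    using longest_common_prefix_prefix1 longest_common_prefix_prefix2 unfolding r_def by (metis prefix_def)
  have "longest_common_prefix (r @ s') (r @ t') = r" unfolding st[symmetric] by (rule r_def[symmetric])
  then have "r @ longest_common_prefix s' t' = r" by (simp only: longest_common_prefix_append)
  then have e: "longest_common_prefix s' t' = []" by simp
  have left: "longest_common_prefix (x @ z) x = x" "longest_common_prefix x (x @ z) = x" for x z :: "nat list"
    using longest_common_prefix_append[of x z "[]"] longest_common_prefix_append[of x "[]" z] by (simp_all del: longest_common_prefix.simps(1))
  show ?thesis
    unfolding r_def[symmetric]
  proof (cases "s' = [] \<or> t' = []")
    case True
    then show "f r = longest_common_prefix (f s) (f t)"
    proof
      assume "s' = []"
      then have "s = r" using st by simp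
      moreover have "prefix (f r) (f t)" using succ_ext_prefix[OF f, of r t'] st(2) t by metis
      ultimately show ?thesis using left(2) by (auto elim!: prefixE)
    next
      assume "t' = []"
      then have "t = r" using st by simp
      moreover have "prefix (f r) (f s)" using succ_ext_prefix[OF f, of r s'] st(1) s by metis
      ultimately show ?thesis using left(1) by (auto elim!: prefixE)
    qed
  next
    case False
    then obtain x s'' y t'' where xy: "s' = x # s''" "t' = y # t''" by (meson list.exhaust)
    then have "x \<noteq> y" using e by auto
    have "prefix (f r @ [x]) (f s)" "prefix (f r @ [y]) (f t)"
      using succ_ext_prefix_snoc[OF f, of r x s''] succ_ext_prefix_snoc[OF f, of r y t''] s t st xy by metis+
    then obtain a b where "f s = f r @ x # a" "f t = f r @ y # b" by (auto elim!: prefixE)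
    then show "f r = longest_common_prefix (f s) (f t)"
      using \<open>x \<noteq> y\<close> by (simp add: longest_common_prefix_append)
  qed
qed

text \<open>Injectivity and preservation of meets follow from the successor condition, which leaves
  conditions that can be checked level by level.\<close>

lemma EmbI:
  assumes k: "0 < k" and ext: "f \<in> extensional (tree_lt k M)"
    and lev: "\<And>j. enat j < M \<Longrightarrow> f ` level k j \<subseteq> level k (l j)"
    and mono: "\<And>i j. enat j < M \<Longrightarrow> i < j \<Longrightarrow> l i < l j"
    and suc: "succ_ext k M f"
    and code: "\<And>j. enat j < M \<Longrightarrow> f (code A j) = code K (l j) \<and> ulab A j = ulab K (l j)"
  shows "f \<in> Emb k K A M"
proof -
  have lf: "level_fun k f j = l j" if "enat j < M" for j
    by (rule level_fun_eq[OF k lev[OF that]])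
  have sl: "f s \<in> level k (l (length s))" if "s \<in> tree_lt k M" for s
    using that lev[of "length s"] by (auto simp: tree_lt_def level_def)
  have linj: "i = j" if "enat i < M" "enat j < M" "l i = l j" for i j
    using mono[of i j] mono[of j i] that by (cases i j rule: linorder_cases) auto
  have inj: "inj_on f (tree_lt k M)"
  proof (rule inj_onI)
    fix s t assume s: "s \<in> tree_lt k M" and t: "t \<in> tree_lt k M" and eq: "f s = f t"
    have "l (length s) = l (length t)" using sl[OF s] sl[OF t] eq by (auto simp: level_def)
    then have len: "length s = length t" using linj s t by (simp add: tree_lt_def)
    have "s ! i = t ! i" if i: "i < length s" for i
    proof -
      have "enat i < M" using i s by (auto simp: tree_lt_def intro: order_less_trans[of _ "enat (length s)"])
      moreover have "take i s \<in> level k i" "take i t \<in> level k i"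
        using s t i len by (auto simp: tree_lt_def level_def tree_def dest: in_set_takeD)
      ultimately have "length (f (take i s)) = l i" "length (f (take i t)) = l i"
        using lev[OF \<open>enat i < M\<close>] by (blast intro: level_length)+
      then show ?thesis
        using succ_ext_nth(2)[OF suc s i] succ_ext_nth(2)[OF suc t, of i] i len eq by simp
    qed
    then show "s = t" using len by (simp add: list_eq_iff_nth_eq)
  qed
  show ?thesis
    unfolding Emb_def
  proof (intro CollectI conjI)
    show "f \<in> tree_lt k M \<rightarrow>\<^sub>E tree k"
      using ext sl by (auto simp: PiE_def level_def)
    show "strict_mono_on {j. enat j < M} (level_fun k f)"
      by (rule strict_mono_onI) (use lf mono in simp)
    show "\<forall>j. enat j < M \<longrightarrow> f ` level k j \<subseteq> level k (level_fun k f j)"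
      using lev lf by simp
    show "\<forall>s\<in>tree_lt k M. \<forall>t\<in>tree_lt k M. f (longest_common_prefix s t) = longest_common_prefix (f s) (f t)"
      using succ_ext_meet[OF suc] by simp
    show "\<forall>s i. s @ [i] \<in> tree_lt k M \<longrightarrow> prefix (f s @ [i]) (f (s @ [i]))"
      using suc by (simp add: succ_ext_def)
    show "\<forall>j. enat j < M \<longrightarrow> f (code A j) = code K (level_fun k f j) \<and> ulab A j = ulab K (level_fun k f j)"
      using code lf by simp
  qed (rule inj)
qed

section \<open>Labeled classes as finite sets of points of the limit\<close>

context free_limit
begin

text \<open>That \<open>l\<close> embeds the substructure of \<open>A\<close> on its first
  \<open>j\<close> points into \<open>K\<close>, in terms of labels.\<close>

definition points :: "nat lstruct \<Rightarrow> (nat \<Rightarrow> nat) \<Rightarrow> nat \<Rightarrow> bool" where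
  "points A l j \<longleftrightarrow> {..<j} \<subseteq> univ A \<and> (\<forall>a<j. U (l a) = ulab A a) \<and>
     (\<forall>a<j. \<forall>b<j. a \<noteq> b \<longrightarrow> l a \<noteq> l b \<and> R (l a) (l b) = rlab A a b)"

lemma points_id: "points K (\<lambda>i. i) j"
  by (simp add: points_def)

lemma in_class_iff:
  assumes "finite (univ S)"
  shows "in_class \<K> S \<longleftrightarrow> (\<exists>e. embedding e S K)"
proof
  assume "in_class \<K> S"
  then obtain C g where C: "C \<in> \<K>" "isomorphism g C S" by (auto simp: in_class_def)
  obtain e where "embedding e C K" using C(1) by (auto simp: age_K age_def)
  then show "\<exists>e. embedding e S K"
    using isomorphism_inverse[OF C(2)] embedding_comp unfolding isomorphism_def by blast
next
  assume "\<exists>e. embedding e S K"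
  then obtain e where e: "embedding e S K" by blast
  let ?C = "induced K (e ` univ S)"
  have "embedding e S ?C"
  proof (rule embeddingI)
    fix a assume a: "a \<in> univ S"
    show "e a \<in> univ ?C" using a by simp
    show "a \<in> unary S i \<longleftrightarrow> e a \<in> unary ?C i" for i
      using embeddingD(3)[OF e a] a by (simp add: induced_def)
    fix b assume b: "b \<in> univ S"
    show "(a, b) \<in> binary S i \<longleftrightarrow> (e a, e b) \<in> binary ?C i" for i
      using embeddingD(4)[OF e a b] a b by (simp add: induced_def)
    show "a = b" if "e a = e b" using embeddingD(2)[OF e a b] that by simp
  qed
  then have "isomorphism e S ?C" by (simp add: isomorphism_def)
  then have "isomorphism (inv_into (univ S) e) ?C S" by (rule isomorphism_inverse)
  moreover have "?C \<in> \<K>" using assms by (simp add: induced_in_class)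
  ultimately show "in_class \<K> S" unfolding in_class_def by blast
qed

text \<open>An embedding of the attached structure in \<open>K\<close> is corrected by homogeneity
  so that the point \<open>a\<close> of \<open>A\<close> goes to the prescribed \<open>l a\<close>.
  Conversely, \<open>l\<close> and \<open>b\<close> together embed the attached structure.\<close>

lemma labeled_class_iff:
  assumes A: "lstructure k Flip A" and l: "points A l j"
  shows "(B, \<phi>) \<in> labeled_class k Flip \<K> A j \<longleftrightarrow> (B, \<phi>) \<in> labeled k Flip (level k j) \<and>
    (\<exists>b. embedding b B K \<and> (\<forall>x\<in>univ B. \<forall>a<j. b x \<noteq> l a \<and> R (l a) (b x) = \<phi> x ! a))"
proof (cases "(B, \<phi>) \<in> labeled k Flip (level k j)")
  case False
  then show ?thesis by (simp add: labeled_class_def)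
next
  case True
  then have B: "lstructure k Flip B" "finite (univ B)" and \<phi>: "\<And>x. x \<in> univ B \<Longrightarrow> \<phi> x \<in> level k j"
    by (auto simp: labeled_def)
  have \<phi>k: "\<phi> x ! a < k" if "x \<in> univ B" "a < j" for x a
  proof -
    have "set (\<phi> x) \<subseteq> {..<k}" "length (\<phi> x) = j" using \<phi>[OF that(1)] by (auto simp: level_def tree_def)
    then show ?thesis using nth_mem[of a "\<phi> x"] that(2) by (metis lessThan_iff subsetD)
  qed
  define S where "S = attach Flip j B \<phi> A"
  have jA: "{..<j} \<subseteq> univ A" using l by (simp add: points_def)
  have lA: "\<And>a. a < j \<Longrightarrow> U (l a) = ulab A a"
    "\<And>a b. a < j \<Longrightarrow> b < j \<Longrightarrow> a \<noteq> b \<Longrightarrow> l a \<noteq> l b \<and> R (l a) (l b) = rlab A a b"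
    using l by (simp_all add: points_def)
  have uS: "univ S = Inl ` {..<j} \<union> Inr ` univ B"
    using jA by (auto simp: S_def attach_def)
  have unS: "Inl a \<in> unary S i \<longleftrightarrow> a \<in> unary A i \<and> a < j" "Inr x \<in> unary S i \<longleftrightarrow> x \<in> unary B i" for a x i
    by (auto simp: S_def attach_def induced_def)
  have binS: "(Inl a, Inl b) \<in> binary S i \<longleftrightarrow> (a, b) \<in> binary A i \<and> a < j \<and> b < j"
    "(Inr x, Inr y) \<in> binary S i \<longleftrightarrow> (x, y) \<in> binary B i"
    "(Inl a, Inr x) \<in> binary S i \<longleftrightarrow> a < j \<and> x \<in> univ B \<and> \<phi> x ! a = i"
    "(Inr x, Inl a) \<in> binary S i \<longleftrightarrow> a < j \<and> x \<in> univ B \<and> Flip (\<phi> x ! a) = i" for a b x y i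
    by (auto simp: S_def attach_def induced_def)
  have bK: "(p, q) \<in> binary K i \<longleftrightarrow> p \<noteq> q \<and> R p q = i" for p q i
    using lstructure_rlab(2)[OF K_struct, of p q i] lstructure_binaryD(3)[OF K_struct, of p q i] by auto
  have uK: "p \<in> unary K i \<longleftrightarrow> U p = i" for p i
    using lstructure_ulab(2)[OF K_struct, of p i] by simp
  have bA: "(a, b) \<in> binary A i \<longleftrightarrow> a \<noteq> b \<and> rlab A a b = i" if "a < j" "b < j" for a b i
    using lstructure_rlab(2)[OF A, of a b i] lstructure_binaryD(3)[OF A, of a b i] jA that by auto
  have uA: "a \<in> unary A i \<longleftrightarrow> ulab A a = i" if "a < j" for a i
    using lstructure_ulab(2)[OF A, of a i] jA that by auto
  have "finite (univ S)" using B(2) by (simp add: uS)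
  then have "(B, \<phi>) \<in> labeled_class k Flip \<K> A j \<longleftrightarrow> (\<exists>e. embedding e S K)"
    using True in_class_iff by (simp add: labeled_class_def S_def)
  also have "\<dots> \<longleftrightarrow> (\<exists>b. embedding b B K \<and> (\<forall>x\<in>univ B. \<forall>a<j. b x \<noteq> l a \<and> R (l a) (b x) = \<phi> x ! a))"
  proof
    assume "\<exists>e. embedding e S K"
    then obtain e where e: "embedding e S K" by blast
    have aS: "Inl a \<in> univ S" if "a < j" for a using that by (simp add: uS)
    have xS: "Inr x \<in> univ S" if "x \<in> univ B" for x using that by (simp add: uS)
    define f where "f = (\<lambda>p. l (inv_into {..<j} (\<lambda>a. e (Inl a)) p))"
    have inj: "inj_on (\<lambda>a. e (Inl a)) {..<j}"
      using embeddingD(2)[OF e aS aS] by (auto simp: inj_on_def)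
    have f: "f (e (Inl a)) = l a" if "a < j" for a
      unfolding f_def using inv_into_f_f[OF inj, of a] that by simp
    have Ua: "U (e (Inl a)) = ulab A a" if "a < j" for a
      using embeddingD(3)[OF e aS[OF that], of "ulab A a"] unS(1) uA[OF that] uK that by simp
    have Rab: "R (e (Inl a)) (e (Inl b)) = rlab A a b" if "a < j" "b < j" "a \<noteq> b" for a b
      using embeddingD(4)[OF e aS[OF that(1)] aS[OF that(2)], of "rlab A a b"] binS(1) bA bK that by simp
    have Rax: "R (e (Inl a)) (e (Inr x)) = \<phi> x ! a" if "a < j" "x \<in> univ B" for a x
      using embeddingD(4)[OF e aS[OF that(1)] xS[OF that(2)], of "\<phi> x ! a"] binS(3) bK that by simp
    have ax: "e (Inl a) \<noteq> e (Inr x)" if "a < j" "x \<in> univ B" for a x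
      using embeddingD(2)[OF e aS[OF that(1)] xS[OF that(2)]] by simp
    have "pemb f ((\<lambda>a. e (Inl a)) ` {..<j})"
    proof (rule pembI; elim imageE)
      fix p a assume p: "p = e (Inl a)" "a \<in> {..<j}"
      then show "U (f p) = U p" using f Ua lA(1) by simp
      fix q b assume q: "q = e (Inl b)" "b \<in> {..<j}" and "p \<noteq> q"
      then have "a \<noteq> b" using p by auto
      then show "f p \<noteq> f q \<and> R (f p) (f q) = R p q" using p q f Rab lA(2) by simp
    qed
    from pemb_automorphism[OF this] obtain s where s: "pemb s UNIV" and sf: "\<And>a. a < j \<Longrightarrow> s (e (Inl a)) = l a"
      using f by auto
    have sK: "embedding s K K"
      unfolding embedding_iff[OF K_struct K_struct] using s by (simp add: pemb_def)
    have InrE: "embedding Inr B S"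
      by (rule embeddingI) (simp_all add: xS unS binS)
    have "embedding (\<lambda>x. s (e (Inr x))) B K"
      by (rule embedding_comp[OF embedding_comp[OF InrE e] sK])
    moreover have "s (e (Inr x)) \<noteq> l a \<and> R (l a) (s (e (Inr x))) = \<phi> x ! a" if "x \<in> univ B" "a < j" for x a
      using sf[OF that(2)] pembD(2,3)[OF s, of "e (Inl a)" "e (Inr x)"] ax[OF that(2,1)] Rax[OF that(2,1)]
      by auto
    ultimately show "\<exists>b. embedding b B K \<and> (\<forall>x\<in>univ B. \<forall>a<j. b x \<noteq> l a \<and> R (l a) (b x) = \<phi> x ! a)"
      by blast
  next
    assume "\<exists>b. embedding b B K \<and> (\<forall>x\<in>univ B. \<forall>a<j. b x \<noteq> l a \<and> R (l a) (b x) = \<phi> x ! a)"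
    then obtain b where b: "embedding b B K"
      and bl: "\<And>x a. x \<in> univ B \<Longrightarrow> a < j \<Longrightarrow> b x \<noteq> l a \<and> R (l a) (b x) = \<phi> x ! a" by blast
    have "embedding (case_sum l b) S K"
    proof (rule embeddingI)
      fix u assume u: "u \<in> univ S"
      show "case_sum l b u \<in> univ K" by simp
      show "u \<in> unary S i \<longleftrightarrow> case_sum l b u \<in> unary K i" for i
      proof (cases u)
        case (Inl a)
        then have "a < j" using u by (auto simp: uS)
        then show ?thesis using Inl by (simp add: unS uA uK lA)
      next
        case (Inr x)
        then have "x \<in> univ B" using u by (auto simp: uS)
        then show ?thesis using Inr embeddingD(3)[OF b] by (simp add: unS)
      qed
      fix v assume v: "v \<in> univ S"
      have cs: "(case_sum l b u = case_sum l b v \<longrightarrow> u = v) \<and>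
        ((u, v) \<in> binary S i \<longleftrightarrow> (case_sum l b u, case_sum l b v) \<in> binary K i)" for i
      proof (cases u)
        case u: (Inl a)
        then have a: "a < j" using \<open>u \<in> univ S\<close> by (auto simp: uS)
        show ?thesis
        proof (cases v)
          case v: (Inl c)
          then have "c < j" using \<open>v \<in> univ S\<close> by (auto simp: uS)
          then show ?thesis using lA(2)[of a c] u v a by (cases "a = c") (auto simp: binS bA bK)
        next
          case v: (Inr x)
          then have "x \<in> univ B" using \<open>v \<in> univ S\<close> by (auto simp: uS)
          then show ?thesis using bl[of x a] u v a by (auto simp: binS bK)
        qed
      next
        case u: (Inr x)
        then have x: "x \<in> univ B" using \<open>u \<in> univ S\<close> by (auto simp: uS)
        show ?thesis
        proof (cases v)
          case v: (Inl a)
          then have a: "a < j" using \<open>v \<in> univ S\<close> by (auto simp: uS)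
          have "R (b x) (l a) = Flip (\<phi> x ! a)" using bl[OF x a] R_flip[of "l a" "b x"] by simp
          then show ?thesis using bl[OF x a] u v x a by (auto simp: binS bK)
        next
          case v: (Inr y)
          then have "y \<in> univ B" using \<open>v \<in> univ S\<close> by (auto simp: uS)
          then show ?thesis
            using embeddingD(2)[OF b, of x y] embeddingD(4)[OF b, of x y i] u v x by (auto simp: binS)
        qed
      qed
      show "(u, v) \<in> binary S i \<longleftrightarrow> (case_sum l b u, case_sum l b v) \<in> binary K i" for i using cs by blast
      show "u = v" if "case_sum l b u = case_sum l b v" using cs that by blast
    qed
    then show "\<exists>e. embedding e S K" by blast
  qed
  finally show ?thesis using True by simp
qed

lemma labeled_class_realize:
  assumes "lstructure k Flip A" and "points A l j" and "(B, \<phi>) \<in> labeled_class k Flip \<K> A j"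
  shows "\<exists>b. embedding b B K \<and> (\<forall>x\<in>univ B. \<forall>a<j. b x \<noteq> l a \<and> R (l a) (b x) = \<phi> x ! a)"
  using assms(3) labeled_class_iff[OF assms(1,2)] by (elim iffD1[THEN conjunct2, rotated]) simp

lemma labeled_classI:
  assumes "lstructure k Flip A" and "points A l j" and "(B, \<phi>) \<in> labeled k Flip (level k j)"
    and "embedding b B K"
    and "\<And>x a. x \<in> univ B \<Longrightarrow> a < j \<Longrightarrow> b x \<noteq> l a \<and> R (l a) (b x) = \<phi> x ! a"
  shows "(B, \<phi>) \<in> labeled_class k Flip \<K> A j"
  by (rule iffD2[OF labeled_class_iff[OF assms(1,2)]])
    (intro conjI exI[of _ b] ballI allI impI assms(3,4); use assms(5) in simp)

text \<open>The set \<open>Y\<close>, labeled by its types over the points \<open>l a\<close>, is in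
  the class of \<open>A\<close>, as the inclusion in \<open>K\<close> shows. The age map carries it
  into the class of \<open>K\<close> at \<open>n\<close>, and a realisation there is the required
  \<open>b\<close>.\<close>

lemma aged_of_age_map:
  assumes A: "lstructure k Flip A" and l: "points A l j"
    and f: "age_map k Flip f (level k j) (labeled_class k Flip \<K> A j)
       (level k n) (labeled_class k Flip \<K> K n)"
  shows "aged l j n f"
  unfolding aged_def
proof (intro allI impI)
  fix Y :: "nat set" assume Y: "finite Y" "Y \<inter> l ` {..<j} = {}"
  define B where "B = induced K Y"
  define \<phi> where "\<phi> = restrict (cp l j) Y"
  have uB: "univ B = Y" by (simp add: B_def)
  have cpl: "cp l j y \<in> level k j" if "y \<in> Y" for y by (rule cp_level) (use Y(2) that in blast)
  have lab: "(B, \<phi>) \<in> labeled k Flip (level k j)"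
    using Y(1) cpl lstructure_induced[OF K_struct] by (auto simp: labeled_def uB \<phi>_def B_def)
  have "embedding (\<lambda>x. x) B K" using pemb_id by (simp add: B_def pemb_embedding[symmetric])
  moreover have "x \<noteq> l a \<and> R (l a) x = \<phi> x ! a" if "x \<in> Y" "a < j" for x a
    using that Y(2) by (auto simp: \<phi>_def cp_def)
  ultimately have "(B, \<phi>) \<in> labeled_class k Flip \<K> A j"
    using labeled_classI[OF A l lab] uB by blast
  then have "(B, compose (univ B) f \<phi>) \<in> labeled_class k Flip \<K> K n"
    using f lab unfolding age_map_def by blast
  from labeled_class_realize[OF K_struct points_id this]
  obtain b where b: "embedding b B K"
    and bx: "\<forall>x\<in>univ B. \<forall>a<n. b x \<noteq> a \<and> R a (b x) = compose (univ B) f \<phi> x ! a"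
    by (elim exE conjE)
  have "n \<le> b y \<and> tp n (b y) = f (cp l j y)" if y: "y \<in> Y" for y
  proof
    show "n \<le> b y" using bx y uB by (metis not_le_imp_less)
    have "f (cp l j y) \<in> level k n" using f cpl[OF y] by (auto simp: age_map_def)
    then show "tp n (b y) = f (cp l j y)"
      using bx y uB by (auto simp: tp_eq_iff compose_def \<phi>_def dest: level_length)
  qed
  moreover have "pemb b Y" using b by (simp add: B_def pemb_embedding)
  ultimately show "\<exists>b. pemb b Y \<and> (\<forall>y\<in>Y. n \<le> b y \<and> tp n (b y) = f (cp l j y))" by blast
qed

text \<open>Only the forward half of the age condition uses \<open>aged\<close>. For the converse, a
  realisation over the first \<open>n\<close> points is looked at over the points
  \<open>l' a\<close> alone, where \<open>f s\<close> shows the entries of \<open>s\<close>. Any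
  copy of the first \<open>j\<close> points of \<open>A\<close> decides membership in its class, so
  the two halves may use different copies.\<close>

lemma age_map_of_aged:
  assumes A: "lstructure k Flip A" and l: "points A l j" and l': "points A l' j"
    and ag: "aged l j n f" and fm: "f ` level k j \<subseteq> level k n" and inj: "inj_on f (level k j)"
    and l'n: "\<And>a. a < j \<Longrightarrow> l' a < n" and nth: "\<And>s a. s \<in> level k j \<Longrightarrow> a < j \<Longrightarrow> f s ! l' a = s ! a"
  shows "age_map k Flip f (level k j) (labeled_class k Flip \<K> A j)
       (level k n) (labeled_class k Flip \<K> K n)"
  unfolding age_map_def
proof (intro conjI ballI)
  show "f \<in> level k j \<rightarrow> level k n" using fm by auto
  show "inj_on f (level k j)" by (rule inj)
  fix z assume z: "z \<in> labeled k Flip (level k j)"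
  obtain B \<phi> where z_eq: "z = (B, \<phi>)" by (cases z)
  have lab: "(B, \<phi>) \<in> labeled k Flip (level k j)" using z z_eq by simp
  then have B: "lstructure k Flip B" "finite (univ B)" and \<phi>: "\<And>x. x \<in> univ B \<Longrightarrow> \<phi> x \<in> level k j"
    by (auto simp: labeled_def)
  let ?\<psi> = "compose (univ B) f \<phi>"
  have \<psi>: "?\<psi> x = f (\<phi> x)" if "x \<in> univ B" for x using that by (simp add: compose_def)
  have \<psi>l: "f (\<phi> x) \<in> level k n" if "x \<in> univ B" for x using \<phi>[OF that] fm by blast
  have lab': "(B, ?\<psi>) \<in> labeled k Flip (level k n)"
    using B \<psi>l by (auto simp: labeled_def compose_def)
  have "(B, \<phi>) \<in> labeled_class k Flip \<K> A j \<longleftrightarrow> (B, ?\<psi>) \<in> labeled_class k Flip \<K> K n"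
  proof
    assume "(B, \<phi>) \<in> labeled_class k Flip \<K> A j"
    from labeled_class_realize[OF A l this]
    obtain b where b: "embedding b B K"
      and bx: "\<forall>x\<in>univ B. \<forall>a<j. b x \<noteq> l a \<and> R (l a) (b x) = \<phi> x ! a"
      by (elim exE conjE)
    have "finite (b ` univ B)" "b ` univ B \<inter> l ` {..<j} = {}" using B(2) bx by auto
    from aged_realize[OF ag this] obtain c where c: "pemb c (b ` univ B)"
      and ct: "\<And>y. y \<in> b ` univ B \<Longrightarrow> n \<le> c y \<and> tp n (c y) = f (cp l j y)" by blast
    have cpb: "cp l j (b x) = \<phi> x" if "x \<in> univ B" for x
      unfolding cp_eq_iff using bx that \<phi>[OF that] by (auto dest: level_length)
    have "embedding (\<lambda>x. c (b x)) B K"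
    proof (rule embedding_comp[where f = b and g = c and B = "induced K (b ` univ B)"])
      show "embedding c (induced K (b ` univ B)) K" using c by (simp add: pemb_embedding)
      show "embedding b B (induced K (b ` univ B))"
        using b by (auto simp: embedding_def induced_def)
    qed
    moreover have "c (b x) \<noteq> a \<and> R a (c (b x)) = ?\<psi> x ! a" if "x \<in> univ B" "a < n" for x a
      using ct[OF imageI[OF that(1)]] cpb[OF that(1)] \<psi>[OF that(1)] that(2) by (metis not_le tp_nth)
    ultimately show "(B, ?\<psi>) \<in> labeled_class k Flip \<K> K n"
      by (rule labeled_classI[OF K_struct points_id lab'])
  next
    assume "(B, ?\<psi>) \<in> labeled_class k Flip \<K> K n"
    from labeled_class_realize[OF K_struct points_id this]
    obtain b where b: "embedding b B K"
      and bx: "\<forall>x\<in>univ B. \<forall>a<n. b x \<noteq> a \<and> R a (b x) = ?\<psi> x ! a"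
      by (elim exE conjE)
    have "b x \<noteq> l' a \<and> R (l' a) (b x) = \<phi> x ! a" if "x \<in> univ B" "a < j" for x a
      using bx[rule_format, OF that(1) l'n[OF that(2)]] \<psi>[OF that(1)] nth[OF \<phi>[OF that(1)] that(2)] by simp
    with b show "(B, \<phi>) \<in> labeled_class k Flip \<K> A j"
      by (rule labeled_classI[OF A l' lab])
  qed
  then show "case z of (B, \<phi>) \<Rightarrow> (B, \<phi>) \<in> labeled_class k Flip \<K> A j \<longleftrightarrow>
      (B, compose (univ B) f \<phi>) \<in> labeled_class k Flip \<K> K n"
    by (simp add: z_eq)
qed

end

lemma EmbD:
  assumes "f \<in> Emb k K A M"
  shows "f \<in> extensional (tree_lt k M)" and "inj_on f (tree_lt k M)" and "succ_ext k M f"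
    and "enat j < M \<Longrightarrow> i < j \<Longrightarrow> level_fun k f i < level_fun k f j"
    and "s \<in> level k j \<Longrightarrow> enat j < M \<Longrightarrow> f s \<in> level k (level_fun k f j)"
    and "enat j < M \<Longrightarrow> f (code A j) = code K (level_fun k f j)"
    and "enat j < M \<Longrightarrow> ulab A j = ulab K (level_fun k f j)"
proof -
  show "level_fun k f i < level_fun k f j" if "enat j < M" "i < j"
  proof -
    have "enat i < M" using that by (meson enat_ord_simps(2) less_trans)
    then show ?thesis
      using assms that unfolding Emb_def by (auto elim!: strict_mono_onD)
  qed
qed (use assms in \<open>auto simp: Emb_def succ_ext_def PiE_def\<close>)

lemma level_tree_lt: "s \<in> level k j \<Longrightarrow> enat j < M \<Longrightarrow> s \<in> tree_lt k M"
  by (simp add: level_def tree_lt_def)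

lemma Emb_nth:
  assumes f: "f \<in> Emb k K A M" and j: "enat j < M" and s: "s \<in> level k j" and i: "i < j"
  shows "f s ! level_fun k f i = s ! i"
proof -
  have "length s = j" using s by (rule level_length)
  have "enat i < M" using i j by (meson enat_ord_simps(2) less_trans)
  moreover have "take i s \<in> level k i" using take_level[OF s] i by simp
  ultimately have "length (f (take i s)) = level_fun k f i"
    using EmbD(5)[OF f] by (blast intro: level_length)
  then show ?thesis
    using succ_ext_nth(2)[OF EmbD(3)[OF f] level_tree_lt[OF s j], of i] i \<open>length s = j\<close> by simp
qed

context free_limit
begin

lemma aged_cong:
  assumes H: "aged l j n H" and HH: "\<And>z. z \<in> level k j \<Longrightarrow> H z = H' z"
  shows "aged l j n H'"
  unfolding aged_def
proof (intro allI impI)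
  fix Y :: "nat set" assume Y: "finite Y" "Y \<inter> l ` {..<j} = {}"
  then have "H (cp l j y) = H' (cp l j y)" if "y \<in> Y" for y
    by (intro HH cp_level) (use that in blast)
  then show "\<exists>b. pemb b Y \<and> (\<forall>y\<in>Y. n \<le> b y \<and> tp n (b y) = H' (cp l j y))"
    using aged_realize[OF H Y] by simp
qed

lemma code_level:
  assumes A: "lstructure k Flip A" and j: "{..<Suc j} \<subseteq> univ A"
  shows "code A j \<in> level k j"
proof -
  have "rlab A i j < k" if "i < j" for i
    by (rule lstructure_rlab(1)[OF A]) (use that j in auto)
  then show ?thesis by (auto simp: code_def level_def tree_def)
qed

text \<open>Codes go to codes, so the passing numbers at coding levels are the relations of
  \<open>A\<close>; pairs in the opposite order follow by flipping.\<close>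

lemma Emb_points:
  assumes A: "lstructure k Flip A" and f: "f \<in> Emb k K A M"
    and j: "{..<j} \<subseteq> univ A" "\<And>a. a < j \<Longrightarrow> enat a < M"
  shows "points A (level_fun k f) j"
proof -
  let ?l = "level_fun k f"
  have less: "?l a < ?l b \<and> R (?l a) (?l b) = rlab A a b" if ab: "a < b" "b < j" for a b
  proof
    show lt: "?l a < ?l b" by (rule EmbD(4)[OF f j(2)[OF ab(2)] ab(1)])
    have "{..<Suc b} \<subseteq> univ A" using j(1) ab(2) by auto
    then have "code A b \<in> level k b" by (rule code_level[OF A])
    then have "f (code A b) ! ?l a = code A b ! a"
      using Emb_nth[OF f j(2)[OF ab(2)] _ ab(1)] by simp
    moreover have "f (code A b) = code K (?l b)" by (rule EmbD(6)[OF f j(2)[OF ab(2)]])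
    ultimately show "R (?l a) (?l b) = rlab A a b" using lt ab(1) by (simp add: code_def)
  qed
  have "?l a \<noteq> ?l b \<and> R (?l a) (?l b) = rlab A a b" if ab: "a < j" "b < j" "a \<noteq> b" for a b
  proof (cases "a < b")
    case True
    then show ?thesis using less[of a b] ab by simp
  next
    case False
    then have ba: "b < a" using ab(3) by simp
    have "rlab A a b = Flip (rlab A b a)"
      by (rule rlab_flip[OF A]) (use ab j(1) in auto)
    then show ?thesis using less[OF ba ab(1)] R_flip[of "?l b" "?l a"] by simp
  qed
  moreover have "U (?l a) = ulab A a" if "a < j" for a using EmbD(7)[OF f j(2)[OF that]] by simp
  ultimately show ?thesis using j(1) by (simp add: points_def)
qed

lemma AEmb_aged:
  assumes "lstructure k Flip A" and "points A l j" and "f \<in> AEmb k Flip \<K> K A M" and "enat j < M"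
  shows "aged l j (level_fun k f j) f"
  by (rule aged_of_age_map[OF assms(1,2)]) (use assms(3,4) in \<open>simp add: AEmb_def\<close>)

lemma AEmbI:
  assumes A: "lstructure k Flip A" and f: "f \<in> Emb k K A M"
    and uA: "\<And>j. enat j < M \<Longrightarrow> {..<j} \<subseteq> univ A"
    and ag: "\<And>j. enat j < M \<Longrightarrow> points A l j \<and> aged l j (level_fun k f j) f"
  shows "f \<in> AEmb k Flip \<K> K A M"
proof -
  have "age_map k Flip f (level k j) (labeled_class k Flip \<K> A j)
      (level k (level_fun k f j)) (labeled_class k Flip \<K> K (level_fun k f j))" if j: "enat j < M" for j
  proof (rule age_map_of_aged[OF A])
    have jM: "\<And>a. a < j \<Longrightarrow> enat a < M" using j by (meson enat_ord_simps(2) less_trans)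
    show "points A l j" "aged l j (level_fun k f j) f" using ag[OF j] by simp_all
    show "points A (level_fun k f) j" by (rule Emb_points[OF A f uA[OF j] jM])
    show "f ` level k j \<subseteq> level k (level_fun k f j)" using EmbD(5)[OF f _ j] by blast
    show "inj_on f (level k j)"
      by (rule inj_on_subset[OF EmbD(2)[OF f]]) (use level_tree_lt[OF _ j] in blast)
    show "level_fun k f a < level_fun k f j" if "a < j" for a by (rule EmbD(4)[OF f j that])
    show "f s ! level_fun k f a = s ! a" if "s \<in> level k j" "a < j" for s a
      by (rule Emb_nth[OF f j that])
  qed
  then show ?thesis using f by (simp add: AEmb_def)
qed

end

section \<open>Colorings\<close>

lemma tree_lt_infinity: "s \<in> tree_lt k \<infinity> \<longleftrightarrow> s \<in> tree k"
  by (simp add: tree_lt_def)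

context free_limit
begin

lemma aged_point:
  assumes H: "aged l j n H" and p: "p \<notin> l ` {..<j}"
  shows "\<exists>q\<ge>n. tp n q = H (cp l j p) \<and> U q = U p"
proof -
  obtain b where b: "pemb b {p}" and bt: "\<forall>y\<in>{p}. n \<le> b y \<and> tp n (b y) = H (cp l j y)"
    using aged_realize[OF H, of "{p}"] p by auto
  then show ?thesis using pembD(1)[OF b, of p] by (intro exI[of _ "b p"]) simp
qed

lemma zpad_aext: "n \<le> m \<Longrightarrow> aext (level k n) n m (zpad m)"
  using aext_zero[OF ext.E_empty, of n m] by simp

text \<open>Taking the least candidate makes this a function of the value at \<open>x0\<close> only,
  so maps that agree at \<open>x0\<close> are padded to the same level. If \<open>t\<close> is not
  realised with label \<open>u\<close>, the value is arbitrary.\<close>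

definition next_code :: "nat \<Rightarrow> nat \<Rightarrow> nat list \<Rightarrow> nat" where
  "next_code u m t = (LEAST q. m \<le> q \<and> U q = u \<and> tp q q = zpad q t)"

lemma next_code:
  assumes "m \<le> p"
  shows "m \<le> next_code (U p) m (tp m p)" and "U (next_code (U p) m (tp m p)) = U p"
    and "code K (next_code (U p) m (tp m p)) = zpad (next_code (U p) m (tp m p)) (tp m p)"
proof -
  obtain q where "m \<le> q \<and> U q = U p \<and> tp q q = zpad q (tp m p)" using left_dense_point[OF assms] by blast
  from LeastI[of "\<lambda>q. m \<le> q \<and> U q = U p \<and> tp q q = zpad q (tp m p)", OF this]
  show "m \<le> next_code (U p) m (tp m p)" "U (next_code (U p) m (tp m p)) = U p"
    "code K (next_code (U p) m (tp m p)) = zpad (next_code (U p) m (tp m p)) (tp m p)"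
    unfolding next_code_def code_K by blast+
qed

end

section \<open>The monochromatic embedding, built level by level\<close>

locale coloring = free_limit +
  fixes N u0 :: nat and x0 :: "nat list" and P :: "(nat list \<Rightarrow> nat list) \<Rightarrow> bool"
  assumes x0: "x0 \<in> level k N"
    and local: "(\<And>x. x \<in> level k N \<Longrightarrow> u x = v x) \<Longrightarrow> P u = P v"
begin

definition hits :: "nat \<Rightarrow> (nat list \<Rightarrow> nat list) \<Rightarrow> bool" where
  "hits n g \<longleftrightarrow> aext (level k N) N n g \<and> g x0 = code K n \<and> U n = u0"

text \<open>One level of the embedding under construction before its coding node is taken care of;
  \<open>full\<close> is the finished level. \<open>H z\<close> need not extend \<open>z\<close>,
  since it has to pass through \<open>w\<close>.\<close>

definition stage ::
    "nat \<Rightarrow> (nat list \<Rightarrow> nat list) \<Rightarrow> nat \<Rightarrow> nat \<Rightarrow> (nat list \<Rightarrow> nat list) \<Rightarrow> bool" where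
  "stage q w n r H \<longleftrightarrow> n \<le> r \<and> q \<le> r \<and> aged (\<lambda>i. i) n r H \<and>
     (\<forall>z\<in>level k n. H z \<in> level k r \<and> take q (H z) = w (take N z))"

definition full ::
    "bool \<Rightarrow> nat \<Rightarrow> (nat list \<Rightarrow> nat list) \<Rightarrow> nat \<Rightarrow> nat \<Rightarrow> (nat list \<Rightarrow> nat list) \<Rightarrow> bool" where
  "full b q w n r H \<longleftrightarrow> stage q w n r H \<and> H (code K n) = code K r \<and> U r = U n \<and>
     (\<forall>g. hits n g \<longrightarrow> P (\<lambda>x. H (g x)) = b)"

text \<open>
  A map \<open>u\<close> need not send \<open>x0\<close> to a coding node, so its color is read off after continuing it by zeroes
  up to the next coding node above \<open>u x0\<close>.
\<close>

definition decides :: "bool \<Rightarrow> nat \<Rightarrow> (nat list \<Rightarrow> nat list) \<Rightarrow> bool" where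
  "decides b q w \<longleftrightarrow> N \<le> q \<and> aext (level k N) N q w \<and>
     (\<forall>n\<ge>q. \<exists>m\<ge>n. \<exists>e. aext (level k n) n m e \<and>
        (\<forall>u. aext (level k N) N n u \<longrightarrow> (\<forall>x\<in>level k N. take q (u x) = w x) \<longrightarrow>
          P (\<lambda>x. zpad (next_code u0 m (e (u x0))) (e (u x))) = b))"

lemma decides_ex: "\<exists>b q w. decides b q w"
proof -
  let ?D = "\<lambda>m v. P (\<lambda>x. zpad (next_code u0 m (v x0)) (v x))"
  have "ext.local_col N ?D"
    unfolding ext.local_col_def by (intro allI impI local) (use x0 in simp)
  from ext.extension_dichotomy[OF this] show ?thesis unfolding decides_def .
qed

lemma stage_take:
  assumes "decides b q w" and "stage q w n r H" and "N \<le> n" and "z \<in> level k n"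
  shows "take N (H z) = take N z"
proof -
  have "take N z \<in> level k N" by (rule take_level[OF assms(4,3)])
  then have "take N (w (take N z)) = take N z"
    using assms(1) aext_maps unfolding decides_def by blast
  moreover have "take q (H z) = w (take N z)" using assms(2,4) by (simp add: stage_def)
  ultimately have "take N (take q (H z)) = take N z" by simp
  then show ?thesis using assms(1) by (simp add: decides_def min_absorb1)
qed

lemma stage_word:
  assumes "decides b q w" and s: "stage q w n r H" and "N \<le> n" and "aext (level k N) N n g"
  shows "aext (level k N) N r (\<lambda>x. H (g x))"
proof (rule aged_aext_word[OF assms(4)])
  show "aged (\<lambda>i. i) n r H" "n \<le> r" using s by (simp_all add: stage_def)
  fix z assume z: "z \<in> level k n"
  then show "H z \<in> level k r \<and> take N (H z) = take N z"
    using s stage_take[OF assms(1-3) z] by (simp add: stage_def)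
qed

text \<open>All \<open>g\<close> with \<open>hits n g\<close> have the same value
  \<open>code K n\<close> at \<open>x0\<close>, so after \<open>H\<close> and the deciding map
  \<open>e\<close> the same coding node comes next for all of them. Hence one level \<open>p\<close>
  and one map \<open>h\<close> serve every \<open>g\<close>.\<close>

lemma stage_full:
  assumes d: "decides b q w" and s: "stage q w n r H" and n: "N \<le> n"
  shows "\<exists>p h. full b q w n p h \<and> r \<le> p \<and> (\<forall>z\<in>level k n. take r (h z) = H z)"
proof -
  have nr: "n \<le> r" "q \<le> r" and H: "aged (\<lambda>i. i) n r H" and Hl: "\<And>z. z \<in> level k n \<Longrightarrow> H z \<in> level k r"
    and Hw: "\<And>z. z \<in> level k n \<Longrightarrow> take q (H z) = w (take N z)"
    using s by (auto simp: stage_def)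
  have "\<exists>m\<ge>r. \<exists>e. aext (level k r) r m e \<and> (\<forall>g. hits n g \<longrightarrow>
      P (\<lambda>x. zpad (next_code u0 m (e (H (g x0)))) (e (H (g x)))) = b)"
  proof -
    obtain m e where m: "r \<le> m" and e: "aext (level k r) r m e"
      and eb: "\<forall>u. aext (level k N) N r u \<longrightarrow> (\<forall>x\<in>level k N. take q (u x) = w x) \<longrightarrow>
          P (\<lambda>x. zpad (next_code u0 m (e (u x0))) (e (u x))) = b"
      using d nr(2) unfolding decides_def by blast
    have "P (\<lambda>x. zpad (next_code u0 m (e (H (g x0)))) (e (H (g x)))) = b" if g: "hits n g" for g
    proof (rule eb[rule_format])
      have ga: "aext (level k N) N n g" using g by (simp add: hits_def)
      show "aext (level k N) N r (\<lambda>x. H (g x))" by (rule stage_word[OF d s n ga])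
      fix x assume "x \<in> level k N"
      then have "g x \<in> level k n" "take N (g x) = x" using aext_maps[OF ga] by auto
      then show "take q (H (g x)) = w x" using Hw by simp
    qed
    then show ?thesis using m e by blast
  qed
  then obtain m e where m: "r \<le> m" and e: "aext (level k r) r m e"
    and eb: "\<And>g. hits n g \<Longrightarrow> P (\<lambda>x. zpad (next_code u0 m (e (H (g x0)))) (e (H (g x)))) = b"
    by blast
  \<comment> \<open>The node \<open>code K n\<close> is realised by the point \<open>n\<close>, and
    its image remains realised with the same unary label. This guarantees that
    \<open>next_code\<close> has a candidate.\<close>
  obtain p' where p': "m \<le> p'" "tp m p' = e (H (code K n))" "U p' = U n"
    using aged_point[OF aged_aext[OF H e], of n] by (auto simp: cp_id code_K)
  define p where "p = next_code (U n) m (e (H (code K n)))"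
  have p: "m \<le> p" "U p = U n" "code K p = zpad p (e (H (code K n)))"
    using next_code[OF p'(1)] by (simp_all add: p'(2,3) p_def)
  define h where "h = (\<lambda>z. zpad p (e (H z)))"
  have hr: "h z \<in> level k p \<and> take r (h z) = H z" if "z \<in> level k n" for z
  proof -
    have "e (H z) \<in> level k m" "take r (e (H z)) = H z" using aext_maps[OF e Hl[OF that]] by auto
    moreover from this(1) have "h z \<in> level k p" "take m (h z) = e (H z)"
      using aext_maps[OF zpad_aext[OF p(1)]] by (auto simp: h_def)
    ultimately show ?thesis using m by (metis min_absorb1 take_take)
  qed
  have "stage q w n p h"
    unfolding stage_def
  proof (intro conjI ballI)
    show "n \<le> p" "q \<le> p" using nr m p(1) by simp_all
    show "aged (\<lambda>i. i) n p h"
      unfolding h_def by (rule aged_aext[OF aged_aext[OF H e] zpad_aext[OF p(1)]])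
    fix z assume z: "z \<in> level k n"
    show "h z \<in> level k p" using hr[OF z] by simp
    have "take q (h z) = take q (take r (h z))" using nr(2) by (simp add: min_absorb1)
    then show "take q (h z) = w (take N z)" using hr[OF z] Hw[OF z] by simp
  qed
  moreover have "P (\<lambda>x. h (g x)) = b" if g: "hits n g" for g
    using eb[OF g] g by (simp add: h_def p_def hits_def)
  ultimately have "full b q w n p h" using p(2,3) by (simp add: full_def h_def)
  moreover have "r \<le> p" using m p(1) by simp
  ultimately show ?thesis using hr by blast
qed

text \<open>Level \<open>p\<close> carries the image of the coding node of level \<open>n\<close>,
  so by \<open>aged_Suc\<close> the last entry of a node may be appended right after level
  \<open>p\<close>. The result is a stage for level \<open>Suc n\<close>, which
  \<open>stage_full\<close> completes.\<close>

lemma full_Suc: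
  assumes d: "decides b q w" and s: "full b q w n p h" and n: "N \<le> n"
  shows "\<exists>p' h'. full b q w (Suc n) p' h' \<and> p < p' \<and>
    (\<forall>z i. z @ [i] \<in> level k (Suc n) \<longrightarrow> prefix (h z @ [i]) (h' (z @ [i])))"
proof -
  have st: "n \<le> p" "q \<le> p" "aged (\<lambda>i. i) n p h"
    and hl: "\<And>z. z \<in> level k n \<Longrightarrow> h z \<in> level k p \<and> take q (h z) = w (take N z)"
    using s by (auto simp: full_def stage_def)
  define H where "H = (\<lambda>z. h (butlast z) @ [last z])"
  have "stage q w (Suc n) (Suc p) H"
    unfolding stage_def
  proof (intro conjI ballI)
    show "Suc n \<le> Suc p" "q \<le> Suc p" using st by simp_all
    show "aged (\<lambda>i. i) (Suc n) (Suc p) H"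
      by (rule aged_Suc[OF st(3)]) (use s in \<open>auto simp: full_def cp_id code_K H_def\<close>)
    fix z assume z: "z \<in> level k (Suc n)"
    then have "z \<noteq> []" by (auto simp: level_def)
    then obtain y i where yi: "z = y @ [i]" by (cases z rule: rev_cases) auto
    then have y: "y \<in> level k n" "i < k" using z by (auto simp: level_def tree_def)
    have hy: "h y \<in> level k p" using hl[OF y(1)] by simp
    then have "length (h y) = p" by (rule level_length)
    then show "take q (H z) = w (take N z)"
      using hl[OF y(1)] st(2) n level_length[OF y(1)] by (simp add: H_def yi)
    show "H z \<in> level k (Suc p)" using hy y(2) by (simp add: H_def yi level_def tree_def)
  qed
  then obtain p' h' where f: "full b q w (Suc n) p' h'" "Suc p \<le> p'"
    and t: "\<forall>z\<in>level k (Suc n). take (Suc p) (h' z) = H z"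
    using stage_full[OF d] n by (metis le_SucI)
  have pre: "prefix (h z @ [i]) (h' (z @ [i]))" if "z @ [i] \<in> level k (Suc n)" for z i
    using t[rule_format, OF that] take_is_prefix[of "Suc p" "h' (z @ [i])"] by (simp add: H_def)
  show ?thesis
  proof (intro exI conjI allI impI)
    show "full b q w (Suc n) p' h'" by (rule f(1))
    show "p < p'" using f(2) by simp
  qed (rule pre)
qed

lemma full_sequence:
  "\<exists>b q w p h. decides b q w \<and> (\<forall>i. full b q w (N + i) (p i) (h i)) \<and> (\<forall>i. p i < p (Suc i)) \<and>
     (\<forall>j z i. z @ [i] \<in> level k (N + Suc j) \<longrightarrow> prefix (h j z @ [i]) (h (Suc j) (z @ [i])))"
proof -
  obtain b q w where d: "decides b q w" using decides_ex by blast
  then have q: "N \<le> q" and w: "aext (level k N) N q w" by (simp_all add: decides_def)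
  have w_stage: "stage q w N q w"
    unfolding stage_def
  proof (intro conjI ballI)
    show "aged (\<lambda>i. i) N q w" by (rule aged_aext[OF aged_id w])
    fix z assume z: "z \<in> level k N"
    then show "w z \<in> level k q" using aext_maps[OF w] by simp
    then show "take q (w z) = w (take N z)" using level_length z by simp
  qed (use q in simp_all)
  have "\<exists>s. \<forall>n. full b q w (N + n) (fst (s n)) (snd (s n)) \<and> (fst (s n) < fst (s (Suc n)) \<and>
      (\<forall>z i. z @ [i] \<in> level k (N + Suc n) \<longrightarrow> prefix (snd (s n) z @ [i]) (snd (s (Suc n)) (z @ [i]))))"
  proof (rule dependent_nat_choice)
    show "\<exists>x. full b q w (N + 0) (fst x) (snd x)"
      using stage_full[OF d w_stage] by auto
  next
    fix x n assume "full b q w (N + n) (fst x) (snd x)"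
    from full_Suc[OF d this le_add1] obtain p' h' where "full b q w (Suc (N + n)) p' h'" "fst x < p'"
      "\<forall>z i. z @ [i] \<in> level k (Suc (N + n)) \<longrightarrow> prefix (snd x z @ [i]) (h' (z @ [i]))"
      by (elim exE conjE)
    then show "\<exists>y. full b q w (N + Suc n) (fst y) (snd y) \<and> (fst x < fst y \<and>
        (\<forall>z i. z @ [i] \<in> level k (N + Suc n) \<longrightarrow> prefix (snd x z @ [i]) (snd y (z @ [i]))))"
      by (intro exI[of _ "(p', h')"]) simp
  qed
  then obtain s where s: "\<forall>n. full b q w (N + n) (fst (s n)) (snd (s n)) \<and> (fst (s n) < fst (s (Suc n)) \<and>
      (\<forall>z i. z @ [i] \<in> level k (N + Suc n) \<longrightarrow> prefix (snd (s n) z @ [i]) (snd (s (Suc n)) (z @ [i]))))"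
    by (elim exE)
  show ?thesis
  proof (intro exI conjI allI impI)
    show "decides b q w" by (rule d)
    show "full b q w (N + i) (fst (s i)) (snd (s i))" "fst (s i) < fst (s (Suc i))" for i
      using s by simp_all
    show "prefix (snd (s j) z @ [i]) (snd (s (Suc j)) (z @ [i]))" if "z @ [i] \<in> level k (N + Suc j)" for j z i
      using s that by simp
  qed
qed

text \<open>That the composite hits again is part of the claim because the composed extensions must
  themselves be extensions of the given map.\<close>

lemma coloring_embedding:
  "\<exists>b. \<exists>h\<in>AEmb k Flip \<K> K K \<infinity>. (\<forall>s\<in>tree k. length s < N \<longrightarrow> h s = s) \<and>
     (\<forall>n g. N \<le> n \<longrightarrow> hits n g \<longrightarrow> hits (level_fun k h n) (\<lambda>x. h (g x)) \<and> P (\<lambda>x. h (g x)) = b)"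
proof -
  obtain b q w p hs where d: "decides b q w" and fl: "\<And>i. full b q w (N + i) (p i) (hs i)"
    and pS: "\<And>i. p i < p (Suc i)"
    and pre: "\<And>j z i. z @ [i] \<in> level k (N + Suc j) \<Longrightarrow> prefix (hs j z @ [i]) (hs (Suc j) (z @ [i]))"
    using full_sequence by metis
  have st: "stage q w (N + i) (p i) (hs i)" for i using fl by (simp add: full_def)
  have hl: "hs i z \<in> level k (p i)" "take N (hs i z) = take N z" if "z \<in> level k (N + i)" for i z
    using st[of i] stage_take[OF d st _ that] that by (auto simp: stage_def)
  define h where "h = (\<lambda>s. if s \<in> tree k then if length s < N then s else hs (length s - N) s else undefined)"
  define l where "l = (\<lambda>j. if j < N then j else p (j - N))"
  have h_small: "h s = s" if "s \<in> level k j" "j < N" for s j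
    using that by (simp add: h_def level_def)
  have h_large: "h s = hs i s" if "s \<in> level k (N + i)" for s i
    using that by (simp add: h_def level_def)
  have split: "j < N \<or> (\<exists>i. j = N + i)" for j by (metis le_Suc_ex not_le)
  have lev: "h ` level k j \<subseteq> level k (l j)" for j
  proof (cases "j < N")
    case True
    then show ?thesis using h_small by (auto simp: l_def)
  next
    case False
    then obtain i where j: "j = N + i" using split by blast
    then have "l j = p i" by (simp add: l_def)
    then show ?thesis using hl(1) h_large j by auto
  qed
  have lS: "l j < l (Suc j)" for j
  proof -
    have "N \<le> p 0" using st[of 0] by (simp add: stage_def)
    then have "j < N \<Longrightarrow> j < p 0" by simp
    moreover have "p (j - N) < p (Suc j - N)" if "\<not> j < N" using pS[of "j - N"] that by (simp add: Suc_diff_le)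
    moreover have "Suc j - N = 0" if "j < N" using that by simp
    ultimately show ?thesis by (simp add: l_def)
  qed
  have cd: "h (code K j) = code K (l j) \<and> U j = U (l j)" for j
  proof (cases "j < N")
    case True
    then show ?thesis using h_small[of "code K j" j] tp_level[of j j] by (simp add: l_def code_K)
  next
    case False
    then obtain i where j: "j = N + i" using split by blast
    then have "h (code K j) = hs i (code K j)" using h_large tp_level[of j j] by (simp add: code_K)
    then show ?thesis using fl[of i] j by (simp add: full_def l_def)
  qed
  have suc: "prefix (h s @ [i]) (h (s @ [i]))" if si: "s @ [i] \<in> tree k" for s i
  proof -
    have sl: "s \<in> level k (length s)" "s @ [i] \<in> level k (Suc (length s))" using si by (auto simp: level_def tree_def)
    consider "Suc (length s) < N" | "Suc (length s) = N" | "N \<le> length s" by linarith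
    then show ?thesis
    proof cases
      case 1
      then show ?thesis using h_small[OF sl(1)] h_small[OF sl(2)] by simp
    next
      \<comment> \<open>The seam: the identity below \<open>N\<close> fits the first constructed
        level because that level extends the nodes of level \<open>N\<close>, as \<open>w\<close>
        does.\<close>
      case 2
      then have e: "h s = s" "s @ [i] \<in> level k (N + 0)" using h_small[OF sl(1)] sl(2) by simp_all
      have "h (s @ [i]) = hs 0 (s @ [i])" by (rule h_large[OF e(2)])
      moreover have "take N (hs 0 (s @ [i])) = s @ [i]" using hl(2)[OF e(2)] 2 by simp
      ultimately show ?thesis using e(1) take_is_prefix by metis
    next
      case 3
      then obtain j where j: "length s = N + j" using le_Suc_ex by blast
      then have e: "s \<in> level k (N + j)" "s @ [i] \<in> level k (N + Suc j)" using sl by simp_all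
      show ?thesis unfolding h_large[OF e(1)] h_large[OF e(2)] by (rule pre[OF e(2)])
    qed
  qed
  have hE: "h \<in> Emb k K K \<infinity>"
  proof (rule EmbI[OF k_pos])
    show "h \<in> extensional (tree_lt k \<infinity>)" by (simp add: h_def extensional_def tree_lt_infinity)
    show "succ_ext k \<infinity> h" using suc by (simp add: succ_ext_def tree_lt_infinity)
    show "l i < l j" if "i < j" for i j by (rule lift_Suc_mono_less[of l, OF lS that])
  qed (use lev cd in simp_all)
  have lf: "level_fun k h j = l j" for j by (rule level_fun_eq[OF k_pos lev])
  have hA: "aged (\<lambda>i. i) j (l j) h" for j
  proof (cases "j < N")
    case True
    have "aged (\<lambda>i. i) j j h" by (rule aged_cong[OF aged_id]) (use h_small True in simp)
    then show ?thesis using True by (simp add: l_def)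
  next
    case False
    then obtain i where j: "j = N + i" using split by blast
    have "aged (\<lambda>i. i) (N + i) (p i) h"
      by (rule aged_cong[of _ _ _ "hs i"]) (use st[of i] h_large in \<open>simp_all add: stage_def\<close>)
    then show ?thesis using j by (simp add: l_def)
  qed
  have "h \<in> AEmb k Flip \<K> K K \<infinity>"
    by (rule AEmbI[OF K_struct hE, of "\<lambda>i. i"]) (simp_all add: points_id lf hA)
  moreover have "hits (level_fun k h n) (\<lambda>x. h (g x)) \<and> P (\<lambda>x. h (g x)) = b" if n: "N \<le> n" and g: "hits n g" for n g
  proof
    obtain i where i: "n = N + i" using n le_Suc_ex by blast
    have ga: "aext (level k N) N n g" and gx: "g x0 = code K n" and un: "U n = u0"
      using g by (auto simp: hits_def)
    have ghs: "h (g x) = hs i (g x)" if "x \<in> level k N" for x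
      by (rule h_large) (use aext_maps[OF ga that] i in simp)
    have "P (\<lambda>x. h (g x)) = P (\<lambda>x. hs i (g x))" by (rule local) (rule ghs)
    then show "P (\<lambda>x. h (g x)) = b" using fl[of i] g i by (simp add: full_def)
    have "aext (level k N) N (p i) (\<lambda>x. hs i (g x))"
      by (rule stage_word[OF d st]) (use ga i in simp_all)
    then have "aext (level k N) N (p i) (\<lambda>x. h (g x))"
      by (rule ext.E_cong) (simp add: ghs)
    moreover have "level_fun k h n = p i" using i by (simp add: lf l_def)
    ultimately show "hits (level_fun k h n) (\<lambda>x. h (g x))"
      unfolding hits_def using cd[of n] gx un lf[of n] by metis
  qed
  moreover have "h s = s" if "s \<in> tree k" "length s < N" for s
    using that by (simp add: h_def)
  ultimately show ?thesis by blast
qed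

end

section \<open>One-level extensions as maps on a level\<close>

locale coding_step = free_limit +
  fixes A :: "nat lstruct" and m :: nat and f :: "nat list \<Rightarrow> nat list"
  assumes A: "lstructure k Flip A" and dom_A: "{..<Suc m} \<subseteq> univ A"
    and f: "f \<in> AEmb k Flip \<K> K A (enat m)"
begin

abbreviation lam :: "nat \<Rightarrow> nat" where "lam \<equiv> level_fun k f"

text \<open>The added 1 makes room for the letter that the successor condition puts after
  \<open>f s\<close>. For \<open>m = 0\<close> there is no earlier level, and the root takes
  over.\<close>

definition N :: nat where "N = (if m = 0 then 0 else Suc (lam (m - 1)))"

text \<open>The value at a node \<open>s\<close> of length \<open>m\<close> of any extension of \<open>f\<close> lies above \<open>fplus s\<close>.\<close>

definition fplus :: "nat list \<Rightarrow> nat list" where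
  "fplus s = (if m = 0 then [] else f (butlast s) @ [last s])"

definition x0 :: "nat list" where "x0 = fplus (code A m)"

text \<open>Only the values of \<open>v\<close> on the image of \<open>fplus\<close> enter, and this
  image need not be all of level \<open>N\<close>.\<close>

definition glue :: "(nat list \<Rightarrow> nat list) \<Rightarrow> nat list \<Rightarrow> nat list" where
  "glue v = (\<lambda>s\<in>tree_lt k (enat (Suc m)). if length s = m then v (fplus s) else f s)"

lemma f_Emb: "f \<in> Emb k K A (enat m)"
  using f by (simp add: AEmb_def)

lemma points_lam: "j \<le> m \<Longrightarrow> points A lam j"
  by (rule Emb_points[OF A f_Emb]) (use dom_A in auto)

lemma lam_less: "i < m \<Longrightarrow> lam i < N"
proof -
  assume i: "i < m"
  then have "enat (m - 1) < enat m" by simp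
  moreover have "i < m - 1 \<or> i = m - 1" using i by linarith
  ultimately have "lam i \<le> lam (m - 1)"
    using EmbD(4)[OF f_Emb, of "m - 1" i] by (auto intro: less_imp_le)
  then show ?thesis using i by (simp add: N_def)
qed

lemma level_SucE:
  assumes "s \<in> level k (Suc j)"
  obtains t i where "s = t @ [i]" and "t \<in> level k j" and "i < k"
proof -
  have "s \<noteq> []" using assms by (auto simp: level_def)
  then obtain t i where "s = t @ [i]" by (cases s rule: rev_cases) auto
  then show thesis using assms that by (auto simp: level_def tree_def)
qed

lemma fplus_snoc: "m = Suc j \<Longrightarrow> fplus (t @ [i]) = f t @ [i]"
  unfolding fplus_def by simp

lemma fplus_0: "m = 0 \<Longrightarrow> fplus s = []"
  unfolding fplus_def by simp

lemma N_0: "m = 0 \<Longrightarrow> N = 0" and N_Suc: "m = Suc j \<Longrightarrow> N = Suc (lam j)"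
  unfolding N_def by simp_all

lemma fplus_level:
  assumes s: "s \<in> level k m"
  shows "fplus s \<in> level k N"
proof (cases m)
  case 0
  then show ?thesis unfolding fplus_0[OF 0] N_0[OF 0] by (simp add: level_def tree_def)
next
  case (Suc j)
  obtain t i where t: "s = t @ [i]" "t \<in> level k j" "i < k" using s unfolding Suc by (rule level_SucE)
  have "f t \<in> level k (lam j)" by (rule EmbD(5)[OF f_Emb t(2)]) (simp add: Suc)
  then show ?thesis unfolding t(1) fplus_snoc[OF Suc] N_Suc[OF Suc] using t(3) by (simp add: level_def tree_def)
qed

lemma fplus_nth:
  assumes s: "s \<in> level k m" and i: "i < m"
  shows "fplus s ! lam i = s ! i"
proof -
  obtain j where Suc: "m = Suc j" using i by (cases m) auto
  obtain t c where t: "s = t @ [c]" "t \<in> level k j" using s unfolding Suc by (rule level_SucE)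
  have jm: "enat j < enat m" by (simp add: Suc)
  have lt: "length t = j" "length (f t) = lam j"
    using level_length[OF t(2)] level_length[OF EmbD(5)[OF f_Emb t(2) jm]] by auto
  show ?thesis
  proof (cases "i = j")
    case True
    then show ?thesis using lt t(1) by (simp add: fplus_snoc[OF Suc] nth_append)
  next
    case False
    then have "i < j" using i Suc by simp
    then have "lam i < lam j" "f t ! lam i = t ! i"
      using EmbD(4)[OF f_Emb jm] Emb_nth[OF f_Emb jm t(2)] by auto
    then show ?thesis using lt t(1) \<open>i < j\<close> by (simp add: fplus_snoc[OF Suc] nth_append)
  qed
qed

text \<open>For positive \<open>m\<close> this is \<open>aged_Suc\<close> at the last level of
  \<open>f\<close>, whose coding node is sent to a coding node. For \<open>m = 0\<close> there is
  nothing to realise beyond the empty type.\<close>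

lemma fplus_aged: "aged lam m N fplus"
proof (cases m)
  case 0
  have "\<exists>b. pemb b Y \<and> (\<forall>y\<in>Y. 0 \<le> b y \<and> tp 0 (b y) = [])" for Y
    using pemb_id by (intro exI[of _ "\<lambda>y. y"]) (simp add: tp_def)
  then show ?thesis unfolding aged_def fplus_0[OF 0] N_0[OF 0] by simp
next
  case (Suc j)
  have jm: "enat j < enat m" by (simp add: Suc)
  have p: "points A lam j" by (rule points_lam) (simp add: Suc)
  have cpj: "cp lam j (lam j) = code A j"
  proof -
    have "rlab A i j = R (lam i) (lam j)" if "i < j" for i
    proof -
      have "code A j \<in> level k j" by (rule code_level[OF A]) (use dom_A Suc in auto)
      then have "f (code A j) ! lam i = code A j ! i" by (rule Emb_nth[OF f_Emb jm _ that])
      moreover have "lam i < lam j" by (rule EmbD(4)[OF f_Emb jm that])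
      ultimately show ?thesis using EmbD(6)[OF f_Emb jm] that by (simp add: code_def)
    qed
    then show ?thesis by (simp add: cp_def code_def)
  qed
  have "aged lam (Suc j) (Suc (lam j)) fplus"
  proof (rule aged_Suc)
    show "aged lam j (lam j) f" by (rule AEmb_aged[OF A p f jm])
    have "lam i \<noteq> lam j" if "i < j" for i using EmbD(4)[OF f_Emb jm that] by simp
    then show "lam j \<notin> lam ` {..<j}" by (metis imageE lessThan_iff)
    show "f (cp lam j (lam j)) = tp (lam j) (lam j)" using EmbD(6)[OF f_Emb jm] by (simp add: cpj code_K)
  qed (simp_all add: fplus_snoc[OF Suc])
  then show ?thesis unfolding N_Suc[OF Suc] using Suc by metis
qed

lemma code_m: "code A m \<in> level k m"
  by (rule code_level[OF A dom_A])

lemma x0_level: "x0 \<in> level k N"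
  unfolding x0_def by (rule fplus_level[OF code_m])

text \<open>A copy of \<open>hits\<close> from the locale \<open>coloring\<close>, which can be
  interpreted only later, when the color predicate has been defined through
  \<open>glue\<close>.\<close>

definition hitting :: "nat \<Rightarrow> (nat list \<Rightarrow> nat list) \<Rightarrow> bool" where
  "hitting n v \<longleftrightarrow> aext (level k N) N n v \<and> v x0 = code K n \<and> U n = ulab A m"

lemma glue_top: "s \<in> level k m \<Longrightarrow> glue v s = v (fplus s)"
  by (simp add: glue_def level_def tree_lt_def)

lemma glue_below: "s \<in> level k j \<Longrightarrow> j < m \<Longrightarrow> glue v s = f s"
  by (auto simp: glue_def level_def tree_lt_def)

lemma restrict_glue: "restrict (glue v) (tree_lt k (enat m)) = f"
proof
  fix s
  show "restrict (glue v) (tree_lt k (enat m)) s = f s"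
  proof (cases "s \<in> tree_lt k (enat m)")
    case True
    then show ?thesis by (auto simp: glue_def tree_lt_def)
  next
    case False
    then show ?thesis using EmbD(1)[OF f_Emb] by (simp add: extensional_def)
  qed
qed

text \<open>Below level \<open>m\<close> everything is inherited from \<open>f\<close>. At level
  \<open>m\<close> the map is \<open>fplus\<close> followed by \<open>v\<close>, so its age
  condition is \<open>fplus_aged\<close> continued by an age map, and the coding node is reached
  because \<open>v\<close> reaches it from \<open>x0\<close>.\<close>

lemma glue_AEmb:
  assumes v: "hitting p v"
  shows "glue v \<in> AEmb k Flip \<K> K A (enat (Suc m))"
proof -
  have va: "aext (level k N) N p v" and vx: "v x0 = code K p" and up: "U p = ulab A m"
    using v by (auto simp: hitting_def)
  have Np: "N \<le> p" using aext_dom[OF va] by simp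
  have vl: "v x \<in> level k p" "take N (v x) = x" if "x \<in> level k N" for x using aext_maps[OF va that] by auto
  define l where "l = (\<lambda>j. if j < m then lam j else p)"
  have lev: "glue v ` level k j \<subseteq> level k (l j)" if "enat j < enat (Suc m)" for j
  proof (cases "j < m")
    case True
    then show ?thesis using glue_below[OF _ True] EmbD(5)[OF f_Emb, of _ j] by (auto simp: l_def)
  next
    case False
    then have "j = m" using that by simp
    then show ?thesis using glue_top vl(1)[OF fplus_level] by (auto simp: l_def)
  qed
  have cd: "glue v (code A j) = code K (l j) \<and> ulab A j = U (l j)" if "enat j < enat (Suc m)" for j
  proof (cases "j < m")
    case True
    have "code A j \<in> level k j" by (rule code_level[OF A]) (use dom_A True in auto)
    then show ?thesis using glue_below[OF _ True] EmbD(6,7)[OF f_Emb, of j] True by (simp add: l_def)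
  next
    case False
    then have "j = m" using that by simp
    then show ?thesis using glue_top[OF code_m] vx up by (simp add: l_def x0_def)
  qed
  have suc: "succ_ext k (enat (Suc m)) (glue v)"
    unfolding succ_ext_def
  proof (intro allI impI)
    fix s i assume si: "s @ [i] \<in> tree_lt k (enat (Suc m))"
    have s: "s \<in> level k (length s)" "s @ [i] \<in> level k (Suc (length s))" "length s < m"
      using si by (auto simp: level_def tree_lt_def tree_def)
    note gs = glue_below[OF s(1,3)]
    show "prefix (glue v s @ [i]) (glue v (s @ [i]))"
    proof (cases "Suc (length s) < m")
      case True
      then have "prefix (f s @ [i]) (f (s @ [i]))"
        using EmbD(3)[OF f_Emb] level_tree_lt[OF s(2)] by (simp add: succ_ext_def)
      then show ?thesis using gs glue_below[OF s(2) True] by simp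
    next
      case False
      then have m: "m = Suc (length s)" using s(3) by simp
      have sm: "s @ [i] \<in> level k m" using s(2) m by simp
      have "prefix (fplus (s @ [i])) (v (fplus (s @ [i])))"
        using vl(2)[OF fplus_level[OF sm]] take_is_prefix by metis
      then show ?thesis using gs glue_top[OF sm] by (simp add: fplus_snoc[OF m])
    qed
  qed
  have E: "glue v \<in> Emb k K A (enat (Suc m))"
  proof (rule EmbI[OF k_pos _ lev _ suc cd])
    show "glue v \<in> extensional (tree_lt k (enat (Suc m)))" by (simp add: glue_def)
    show "l i < l j" if "enat j < enat (Suc m)" "i < j" for i j
      using that EmbD(4)[OF f_Emb, of j i] lam_less[of i] Np by (auto simp: l_def)
  qed
  show ?thesis
  proof (rule AEmbI[OF A E])
    fix j assume j: "enat j < enat (Suc m)"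
    show "{..<j} \<subseteq> univ A" using j dom_A by auto
    have lf: "level_fun k (glue v) j = l j" by (rule level_fun_eq[OF k_pos lev[OF j]])
    have pj: "points A lam j" using points_lam j by simp
    have "aged lam j (l j) (glue v)"
    proof (cases "j < m")
      case True
      have "aged lam j (lam j) f" by (rule AEmb_aged[OF A pj f]) (simp add: True)
      then have "aged lam j (lam j) (glue v)" by (rule aged_cong) (simp add: glue_below[OF _ True])
      then show ?thesis using True by (simp add: l_def)
    next
      case False
      then have "j = m" using j by simp
      have "aged lam m p (glue v)"
        by (rule aged_cong[OF aged_aext[OF fplus_aged va]]) (simp add: glue_top)
      then show ?thesis using \<open>j = m\<close> by (simp add: l_def)
    qed
    then show "points A lam j \<and> aged lam j (level_fun k (glue v) j) (glue v)" using pj lf by simp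
  qed
qed

text \<open>On level \<open>m\<close> the map \<open>g\<close> factors through the injective
  \<open>fplus\<close>. The factor is an age map on the image of \<open>fplus\<close>, since a type
  over the first \<open>N\<close> points determines the type over the points \<open>lam i\<close>;
  zeroes extend it to all of level \<open>N\<close>.\<close>

lemma extension_glue:
  assumes g: "g \<in> AEmb k Flip \<K> K A (enat (Suc m))" and gf: "restrict g (tree_lt k (enat m)) = f"
  shows "\<exists>v. N \<le> level_fun k g m \<and> hitting (level_fun k g m) v \<and> (\<forall>s\<in>level k m. g s = v (fplus s))"
proof -
  have gE: "g \<in> Emb k K A (enat (Suc m))" using g by (simp add: AEmb_def)
  have mm: "enat m < enat (Suc m)" by simp
  define n where "n = level_fun k g m"
  have gfs: "g s = f s" if "s \<in> level k j" "j < m" for s j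
    using fun_cong[OF gf, of s] that level_tree_lt[OF that(1), of "enat m"] by simp
  have gl: "level_fun k g i = lam i" if "i < m" for i
  proof -
    have "g ` level k i \<subseteq> level k (lam i)"
      using gfs[OF _ that] EmbD(5)[OF f_Emb, of _ i] that by auto
    then show ?thesis by (rule level_fun_eq[OF k_pos])
  qed
  have Nn: "N \<le> n"
    using EmbD(4)[OF gE mm, of "m - 1"] gl[of "m - 1"] by (auto simp: N_def n_def)
  have ag: "aged lam m n g" unfolding n_def by (rule AEmb_aged[OF A points_lam g mm]) simp
  have glev: "g z \<in> level k n" if "z \<in> level k m" for z unfolding n_def by (rule EmbD(5)[OF gE that mm])
  have pre: "take N (g z) = fplus z" if z: "z \<in> level k m" for z
  proof (cases m)
    case 0
    show ?thesis unfolding fplus_0[OF 0] N_0[OF 0] by simp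
  next
    case (Suc j)
    obtain t i where t: "z = t @ [i]" "t \<in> level k j" using z unfolding Suc by (rule level_SucE)
    have "prefix (g t @ [i]) (g z)"
      using EmbD(3)[OF gE] level_tree_lt[OF z mm] t(1) by (simp add: succ_ext_def)
    then have "prefix (fplus z) (g z)" unfolding t(1) fplus_snoc[OF Suc] using gfs[OF t(2)] Suc by simp
    moreover have "length (fplus z) = N" using fplus_level[OF z] by (rule level_length)
    ultimately show ?thesis by (auto elim!: prefixE)
  qed
  \<comment> \<open>At the positions \<open>lam i\<close> the node \<open>fplus z\<close> has the
    entries of \<open>z\<close>, so a point of this type over the first \<open>N\<close> points has
    type \<open>z\<close> over the coding points of \<open>f\<close>.\<close>
  have fcp: "cp lam m y = z" if "z \<in> level k m" "tp N y = fplus z" for y z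
    unfolding cp_eq_iff
  proof (intro conjI allI impI)
    show "length z = m" using that(1) by (rule level_length)
    fix i assume i: "i < m"
    have "R (lam i) y = tp N y ! lam i" using lam_less[OF i] by (simp add: tp_nth)
    then show "R (lam i) y = z ! i" using that fplus_nth[OF that(1) i] by simp
  qed
  have inj: "inj_on fplus (level k m)"
  proof (rule inj_onI)
    fix y z assume y: "y \<in> level k m" and z: "z \<in> level k m" and "fplus y = fplus z"
    then have "y ! i = z ! i" if "i < m" for i using fplus_nth[OF y that] fplus_nth[OF z that] by simp
    then show "y = z" using level_length[OF y] level_length[OF z] by (simp add: list_eq_iff_nth_eq)
  qed
  define e where "e = (\<lambda>x. g (inv_into (level k m) fplus x))"
  have e: "e (fplus z) = g z" if "z \<in> level k m" for z using inv_into_f_f[OF inj that] by (simp add: e_def)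
  have "aext (fplus ` level k m) N n e"
  proof (rule aextI)
    show "fplus ` level k m \<subseteq> level k N" using fplus_level by blast
    show "e x \<in> level k n \<and> take N (e x) = x" if "x \<in> fplus ` level k m" for x
      using that e glev pre by auto
    fix Y :: "nat set" assume fin: "finite Y" and Y: "\<And>y. y \<in> Y \<Longrightarrow> N \<le> y \<and> tp N y \<in> fplus ` level k m"
    have "Y \<inter> lam ` {..<m} = {}" using Y lam_less by fastforce
    from aged_realize[OF ag fin this] obtain b where b: "pemb b Y"
      and bt: "\<forall>y\<in>Y. n \<le> b y \<and> tp n (b y) = g (cp lam m y)"
      by (elim exE conjE)
    have "g (cp lam m y) = e (tp N y)" if "y \<in> Y" for y
      using Y[OF that] fcp e by auto
    then show "\<exists>b. pemb b Y \<and> (\<forall>y\<in>Y. n \<le> b y \<and> tp n (b y) = e (tp N y))" using b bt by auto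
  qed (rule Nn)
  then have va: "aext (level k N) N n (\<lambda>x. if x \<in> fplus ` level k m then e x else zpad n x)" (is "aext _ _ _ ?v")
    by (rule aext_zero)
  have v: "?v (fplus s) = g s" if "s \<in> level k m" for s using e[OF that] that by simp
  have "?v x0 = g (code A m)" unfolding x0_def by (rule v[OF code_m])
  also have "\<dots> = code K n" unfolding n_def by (rule EmbD(6)[OF gE mm])
  finally have "?v x0 = code K n" .
  moreover have "U n = ulab A m" using EmbD(7)[OF gE mm] by (simp add: n_def)
  ultimately have "hitting n ?v" using va by (simp add: hitting_def)
  then show ?thesis using Nn v unfolding n_def[symmetric] by (intro exI[of _ ?v]) simp
qed

lemma one_step:
  fixes \<chi> :: "(nat list \<Rightarrow> nat list) \<Rightarrow> nat"
  defines "F \<equiv> {g \<in> AEmb k Flip \<K> K A (enat (Suc m)). restrict g (tree_lt k (enat m)) = f}"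
  assumes \<chi>: "\<chi> \<in> F \<rightarrow> {..<2}"
  shows "\<exists>h\<in>AEmb k Flip \<K> K K \<infinity>. (\<forall>s\<in>tree k. length s < N \<longrightarrow> h s = s) \<and>
           monochromatic F \<chi> {compose (tree_lt k (enat (Suc m))) h g | g. g \<in> F}"
proof -
  \<comment> \<open>Maps that hit no coding node get a color as well, from whatever
    \<open>\<chi>\<close> does outside \<open>F\<close>. This is harmless, as the conclusion of
    \<open>coloring_embedding\<close> concerns only maps that hit.\<close>
  define P where "P = (\<lambda>v. \<chi> (glue v) = 0)"
  have glue_cong: "glue u = glue v" if "\<And>x. x \<in> level k N \<Longrightarrow> u x = v x" for u v
    unfolding glue_def using that[OF fplus_level]
    by (intro restrict_ext) (auto simp: tree_lt_def level_def)
  interpret coloring k Flip \<K> K N "ulab A m" x0 P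
  proof
    show "x0 \<in> level k N" by (rule x0_level)
    show "P u = P v" if "\<And>x. x \<in> level k N \<Longrightarrow> u x = v x" for u v
      unfolding P_def by (subst glue_cong[OF that]) simp_all
  qed
  have hh: "hits = hitting" by (simp add: hits_def hitting_def fun_eq_iff)
  obtain b h where h: "h \<in> AEmb k Flip \<K> K K \<infinity>" and h_id: "\<And>s. s \<in> tree k \<Longrightarrow> length s < N \<Longrightarrow> h s = s"
    and hP: "\<And>n v. N \<le> n \<Longrightarrow> hitting n v \<Longrightarrow>
        hitting (level_fun k h n) (\<lambda>x. h (v x)) \<and> P (\<lambda>x. h (v x)) = b"
    using coloring_embedding unfolding hh by blast
  have main: "compose (tree_lt k (enat (Suc m))) h g \<in> F \<and>
      (\<chi> (compose (tree_lt k (enat (Suc m))) h g) = 0) = b" if "g \<in> F" for g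
  proof -
    have g: "g \<in> AEmb k Flip \<K> K A (enat (Suc m))" "restrict g (tree_lt k (enat m)) = f"
      using that by (simp_all add: F_def)
    obtain n v where v: "N \<le> n" "hitting n v" "\<And>s. s \<in> level k m \<Longrightarrow> g s = v (fplus s)"
      using extension_glue[OF g] by blast
    have "compose (tree_lt k (enat (Suc m))) h g = glue (\<lambda>x. h (v x))"
      unfolding glue_def compose_def
    proof (rule restrict_ext)
      fix s assume s: "s \<in> tree_lt k (enat (Suc m))"
      show "h (g s) = (if length s = m then h (v (fplus s)) else f s)"
      proof (cases "length s = m")
        case True
        then show ?thesis using v(3)[of s] s by (simp add: level_def tree_lt_def)
      next
        case False
        then have s': "s \<in> tree_lt k (enat m)" "length s < m" using s by (auto simp: tree_lt_def)
        then have "g s = f s" using fun_cong[OF g(2), of s] by simp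
        moreover have "f s \<in> level k (lam (length s))"
          by (rule EmbD(5)[OF f_Emb]) (use s' in \<open>simp_all add: level_def tree_lt_def\<close>)
        \<comment> \<open>The values of \<open>f\<close> lie below level \<open>N\<close>, where
          \<open>h\<close> is the identity.\<close>
        then have "h (f s) = f s" using h_id[of "f s"] lam_less[OF s'(2)] by (simp add: level_def)
        ultimately show ?thesis using False by simp
      qed
    qed
    moreover have "glue (\<lambda>x. h (v x)) \<in> F"
      using glue_AEmb hP[OF v(1,2)] restrict_glue by (auto simp: F_def)
    ultimately show ?thesis using hP[OF v(1,2)] by (simp add: P_def)
  qed
  have "\<chi> c = (if b then 0 else 1)" if "c \<in> F" "(\<chi> c = 0) = b" for c
    using funcset_mem[OF \<chi> that(1)] that(2) by auto
  then have "monochromatic F \<chi> {compose (tree_lt k (enat (Suc m))) h g | g. g \<in> F}"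
    unfolding monochromatic_def using main by blast
  then show ?thesis using h h_id by blast
qed

end

theorem theorem3p1:
  fixes k m :: nat and Flip :: "nat \<Rightarrow> nat"
    and \<K> :: "nat lstruct set" and K A :: "nat lstruct"
    and f :: "nat list \<Rightarrow> nat list"
    and F :: "(nat list \<Rightarrow> nat list) set" and \<chi> :: "(nat list \<Rightarrow> nat list) \<Rightarrow> nat"
  assumes "is_flip k Flip"
    and "fraisse_class k Flip \<K>" and "free_amalgamation \<K>"
    and "fraisse_limit k Flip \<K> K" and "left_dense \<K> K"
    and "enumerated k Flip A" and "age k Flip A \<subseteq> \<K>" and "enat m < ecard (univ A)"
    and "f \<in> AEmb k Flip \<K> K A (enat m)"
    and "F = {g \<in> AEmb k Flip \<K> K A (enat (m + 1)). restrict g (tree_lt k (enat m)) = f}"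
    and "\<chi> \<in> F \<rightarrow> {..<2}"
  shows "\<exists>h \<in> AEmb k Flip \<K> K K \<infinity>.
           (0 < m \<longrightarrow> (\<forall>s \<in> tree_le k (level_fun k f (m - 1)). h s = s)) \<and>
           monochromatic F \<chi> {compose (tree_lt k (enat (m + 1))) h g | g. g \<in> F}"
proof -
  have A: "lstructure k Flip A" "univ A = {i. enat i < ecard (univ A)}"
    using assms(6) by (auto simp: enumerated_def)
  have "i \<in> univ A" if "i < Suc m" for i
  proof -
    have "enat i \<le> enat m" using that by simp
    then have "enat i < ecard (univ A)" using assms(8) by (rule le_less_trans)
    then show ?thesis using A(2) by blast
  qed
  then interpret coding_step k Flip \<K> K A m f
    by unfold_locales (use assms(1,3-5,9) A(1) in auto)
  obtain h where "h \<in> AEmb k Flip \<K> K K \<infinity>" "\<forall>s\<in>tree k. length s < N \<longrightarrow> h s = s"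
    "monochromatic F \<chi> {compose (tree_lt k (enat (Suc m))) h g | g. g \<in> F}"
    using one_step[of \<chi>] assms(10,11) by auto
  \<comment> \<open>For positive \<open>m\<close>, length below \<open>N\<close> means length at
    most \<open>lam (m - 1)\<close>.\<close>
  then show ?thesis by (intro bexI[of _ h]) (auto simp: N_def tree_le_def)
qed

end
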